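(* Let $t_1,t_2\ge 0$ be integers with $t_1\ge 1$ or $t_2\ge 2$, let $k_1,\ldots,k_{t_1}\ge 2$ and $p_1,\ldots,p_{t_2}\ge 2$ be integers with $\max\{k_1,\ldots,k_{t_1},p_1,\ldots,p_{t_2}\}\ge 3$, and let $\kappa:=\sum_{i=1}^{t_1}k_i+\sum_{i=1}^{t_2}p_i-(t_1+t_2)$. There is $n_0$ such that for every $n\ge n_0$: if $G$ is a graph on $n$ vertices with $\lambda(G)\ge \lambda(S_{n,\kappa}^+)$, then $G$ contains $\mathcal{CP}_{2k_1,\ldots,2k_{t_1};2p_1,\ldots,2p_{t_2}}$ as a subgraph unless $G=S_{n,\kappa}^+$.
   Context: $\lambda(G)$ is the adjacency spectral radius. $\mathcal{CP}_{2k_1,\ldots,2k_{t_1};2p_1,\ldots,2p_{t_2}}$ is the graph obtained by taking $t_1$ cycles of lengths $2k_1,\ldots,2k_{t_1}$ and $t_2$ paths on $2p_1,\ldots,2p_{t_2}$ vertices, all sharing exactly one common vertex and otherwise vertex-disjoint, where each path has the common vertex as an endpoint; equivalently, it is obtained from the graph formed by $t_1+t_2$ cycles $C_{2k_1},\ldots,C_{2k_{t_1}},C_{2p_1},\ldots,C_{2p_{t_2}}$ meeting at exactly one common vertex by deleting, from each cycle $C_{2p_i}$, one edge incident to the common vertex. $S_{n,k}:=K_k\vee(n-k)K_1$ and $S_{n,k}^+$ is $S_{n,k}$ with one edge added inside the independent set. *)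

theory Defs
  imports "Jordan_Normal_Form.Spectral_Radius" "Graph_Theory.Graph_Theory"
begin

text \<open>
  A finite simple graph is a \<^emph>\<open>pair_graph\<close>: a finite vertex set with a finite, symmetric,
  irreflexive arc relation, so that an edge \<open>uv\<close> is the pair of arcs \<open>(u,v)\<close>, \<open>(v,u)\<close>.
\<close>

definition adjacency_matrix :: "'a pair_pre_digraph \<Rightarrow> 'a list \<Rightarrow> complex mat" where
  "adjacency_matrix G vs =
     mat (length vs) (length vs) (\<lambda>(i, j). if (vs ! i, vs ! j) \<in> parcs G then 1 else 0)"

text \<open>
  The enumeration of the vertices is chosen arbitrarily; the value does not depend on it,
  see \<open>adj_spectral_radius_eq\<close> below.
\<close>

definition adj_spectral_radius :: "'a pair_pre_digraph \<Rightarrow> real" where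
  "adj_spectral_radius G =
     spectral_radius (adjacency_matrix G (SOME vs. distinct vs \<and> set vs = pverts G))"

definition contains_subgraph :: "'a pair_pre_digraph \<Rightarrow> 'b pair_pre_digraph \<Rightarrow> bool" where
  "contains_subgraph G F \<longleftrightarrow>
     (\<exists>H. subgraph (with_proj H) (with_proj G) \<and> digraph_iso (with_proj H) (with_proj F))"

text \<open>
  \<open>S_graph n k\<close> is $K_k \vee (n-k)K_1$ on \<open>{..<n}\<close>, the clique being \<open>{..<k}\<close>. The extra edge of
  \<open>S_plus_graph n k\<close> joins \<open>k\<close> and \<open>k + 1\<close>; this is the intended graph for \<open>k + 2 \<le> n\<close>.
\<close>

definition S_graph :: "nat \<Rightarrow> nat \<Rightarrow> nat pair_pre_digraph" where
  "S_graph n k =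
     \<lparr> pverts = {..<n},
       parcs = {(u, v). u < n \<and> v < n \<and> u \<noteq> v \<and> (u < k \<or> v < k)} \<rparr>"

definition S_plus_graph :: "nat \<Rightarrow> nat \<Rightarrow> nat pair_pre_digraph" where
  "S_plus_graph n k =
     \<lparr> pverts = pverts (S_graph n k),
       parcs = parcs (S_graph n k) \<union> {(k, k + 1), (k + 1, k)} \<rparr>"

datatype cp_vertex = Centre | Cycle_Vertex nat nat | Path_Vertex nat nat

text \<open>
  \<open>cycle_pos i j\<close> is the vertex in position \<open>j\<close> of the \<open>i\<close>-th cycle, and \<open>path_pos i j\<close> that of the
  \<open>i\<close>-th path; position 0 is always the common vertex.
\<close>

definition cycle_pos :: "nat \<Rightarrow> nat \<Rightarrow> cp_vertex" where
  "cycle_pos i j = (if j = 0 then Centre else Cycle_Vertex i j)"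

definition path_pos :: "nat \<Rightarrow> nat \<Rightarrow> cp_vertex" where
  "path_pos i j = (if j = 0 then Centre else Path_Vertex i j)"

definition CP_oriented_arcs :: "nat list \<Rightarrow> nat list \<Rightarrow> cp_vertex rel" where
  "CP_oriented_arcs ks ps =
     {(cycle_pos i j, cycle_pos i (Suc j mod (2 * ks ! i))) | i j.
        i < length ks \<and> j < 2 * ks ! i} \<union>
     {(path_pos i j, path_pos i (Suc j)) | i j.
        i < length ps \<and> Suc j < 2 * ps ! i}"

definition CP_graph :: "nat list \<Rightarrow> nat list \<Rightarrow> cp_vertex pair_pre_digraph" where
  "CP_graph ks ps =
     \<lparr> pverts = {Centre} \<union>
         {cycle_pos i j | i j. i < length ks \<and> j < 2 * ks ! i} \<union>
         {path_pos i j | i j. i < length ps \<and> j < 2 * ps ! i},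
       parcs = CP_oriented_arcs ks ps \<union> (CP_oriented_arcs ks ps)\<inverse> \<rparr>"

lemma adjacency_matrix_eigenvalue_reorder:
  assumes us: "distinct us" "set us = pverts G" and vs: "distinct vs" "set vs = pverts G"
    and ev: "eigenvalue (adjacency_matrix G us) x"
  shows "eigenvalue (adjacency_matrix G vs) x"
proof -
  define n where "n = length us"
  have n: "length vs = n"
    using us vs distinct_card unfolding n_def by metis
  have "\<forall>i\<in>{..<n}. \<exists>j. j < n \<and> us ! j = vs ! i"
    using us vs n by (metis in_set_conv_nth lessThan_iff n_def)
  then obtain f where f: "\<And>i. i < n \<Longrightarrow> f i < n \<and> us ! f i = vs ! i"
    by (metis lessThan_iff)
  have inj: "inj_on f {..<n}"
  proof (rule inj_onI)
    fix i j assume "i \<in> {..<n}" "j \<in> {..<n}" "f i = f j"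
    then have "vs ! i = vs ! j" using f by (metis lessThan_iff)
    then show "i = j"
      using vs n \<open>i \<in> {..<n}\<close> \<open>j \<in> {..<n}\<close> by (simp add: nth_eq_iff_index_eq)
  qed
  have "f ` {..<n} \<subseteq> {..<n}" using f by auto
  then have bij: "bij_betw f {0..<n} {0..<n}"
    using inj endo_inj_surj[of "{..<n}" f] by (simp add: bij_betw_def lessThan_atLeast0)
  from ev obtain v where v: "v \<in> carrier_vec n" "v \<noteq> 0\<^sub>v n"
      and eq: "adjacency_matrix G us *\<^sub>v v = x \<cdot>\<^sub>v v"
    by (auto simp: eigenvalue_def eigenvector_def adjacency_matrix_def n_def)
  have row: "(\<Sum>j\<in>{0..<n}. (if (us ! i, us ! j) \<in> parcs G then 1 else 0) * v $ j) = x * v $ i"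
    if "i < n" for i
    using arg_cong[OF eq, of "\<lambda>w. w $ i"] that v
    by (simp add: adjacency_matrix_def n_def scalar_prod_def)
  define w where "w = vec n (\<lambda>i. v $ f i)"
  have "w \<noteq> 0\<^sub>v n"
  proof
    assume w0: "w = 0\<^sub>v n"
    have "v $ j = 0" if "j < n" for j
    proof -
      have "j \<in> f ` {0..<n}" using bij_betw_imp_surj_on[OF bij] that by simp
      then obtain i where "i < n" "j = f i" by auto
      then show ?thesis using arg_cong[OF w0, of "\<lambda>u. u $ i"] by (simp add: w_def)
    qed
    then have "v = 0\<^sub>v n" using v(1) by (intro eq_vecI) auto
    then show False using v(2) by simp
  qed
  moreover have "adjacency_matrix G vs *\<^sub>v w = x \<cdot>\<^sub>v w"
  proof (rule eq_vecI)
    fix i assume "i < dim_vec (x \<cdot>\<^sub>v w)"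
    then have i: "i < n" by (simp add: w_def)
    have "(adjacency_matrix G vs *\<^sub>v w) $ i =
        (\<Sum>j\<in>{0..<n}. (if (vs ! i, vs ! j) \<in> parcs G then 1 else 0) * v $ f j)"
      using i n by (simp add: adjacency_matrix_def scalar_prod_def w_def)
    also have "\<dots> = (\<Sum>j\<in>{0..<n}. (if (us ! f i, us ! f j) \<in> parcs G then 1 else 0) * v $ f j)"
      using f i by (intro sum.cong) auto
    also have "\<dots> = (\<Sum>j\<in>{0..<n}. (if (us ! f i, us ! j) \<in> parcs G then 1 else 0) * v $ j)"
      by (rule sum.reindex_bij_betw[OF bij])
    also have "\<dots> = x * v $ f i" using row f i by blast
    finally show "(adjacency_matrix G vs *\<^sub>v w) $ i = (x \<cdot>\<^sub>v w) $ i"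
      using i by (simp add: w_def)
  qed (simp add: adjacency_matrix_def w_def n)
  ultimately show ?thesis
    unfolding eigenvalue_def eigenvector_def
    by (intro exI[of _ w]) (simp add: adjacency_matrix_def w_def n)
qed

lemma adj_spectral_radius_eq:
  assumes "distinct vs" "set vs = pverts G"
  shows "adj_spectral_radius G = spectral_radius (adjacency_matrix G vs)"
proof -
  let ?us = "SOME vs. distinct vs \<and> set vs = pverts G"
  have "distinct ?us \<and> set ?us = pverts G"
    by (rule someI[of _ vs]) (use assms in simp)
  then have "spectrum (adjacency_matrix G ?us) = spectrum (adjacency_matrix G vs)"
    unfolding spectrum_def using assms
      adjacency_matrix_eigenvalue_reorder[of ?us G vs] adjacency_matrix_eigenvalue_reorder[of vs G ?us]
    by auto
  then show ?thesis by (simp add: adj_spectral_radius_def spectral_radius_def)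
qed

lemma pair_graph_S_plus_graph:
  assumes "k + 2 \<le> n"
  shows "pair_graph (S_plus_graph n k)"
proof -
  let ?G = "S_plus_graph n k"
  have V: "pverts ?G = {..<n}" by (simp add: S_plus_graph_def S_graph_def)
  have arc: "(u, v) \<in> parcs ?G \<longleftrightarrow>
      u < n \<and> v < n \<and> u \<noteq> v \<and> (u < k \<or> v < k) \<or> u = k \<and> v = k + 1 \<or> u = k + 1 \<and> v = k" for u v
    by (auto simp: S_plus_graph_def S_graph_def)
  have sub: "u < n \<and> v < n \<and> u \<noteq> v" if "(u, v) \<in> parcs ?G" for u v
    using that assms unfolding arc by auto
  have fin: "finite (parcs ?G)"
    by (rule finite_subset[of _ "{..<n} \<times> {..<n}"]) (use sub in auto)
  have "sym (parcs ?G)" by (rule symI) (use arc in blast)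
  then have "symmetric (with_proj ?G)" by (simp add: symmetric_def)
  then show ?thesis
    by unfold_locales (use sub fin in \<open>auto simp: V\<close>)
qed

lemma pair_graph_CP_graph:
  assumes "\<forall>k\<in>set ks. k \<ge> 2" "\<forall>p\<in>set ps. p \<ge> 2"
  shows "pair_graph (CP_graph ks ps)"
proof -
  let ?V = "pverts (CP_graph ks ps)"
  have fin: "finite ?V"
  proof -
    have "?V = {Centre} \<union> (\<Union>i<length ks. cycle_pos i ` {..<2 * ks ! i}) \<union>
        (\<Union>i<length ps. path_pos i ` {..<2 * ps ! i})"
      by (auto simp: CP_graph_def)
    then show ?thesis by simp
  qed
  have pos: "0 < ks ! i" "2 \<le> ks ! i" if "i < length ks" for i
    using assms(1) nth_mem[OF that] by force+
  have mod: "Suc j mod (2 * ks ! i) \<noteq> j" if "i < length ks" "j < 2 * ks ! i" for i j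
    using pos[OF that(1)] that(2) by (auto simp: mod_Suc)
  have cV: "cycle_pos i j \<in> ?V" if "i < length ks" "j < 2 * ks ! i" for i j
    using that unfolding CP_graph_def pair_pre_digraph.simps by blast
  have pV: "path_pos i j \<in> ?V" if "i < length ps" "j < 2 * ps ! i" for i j
    using that unfolding CP_graph_def pair_pre_digraph.simps by blast
  have arc: "u \<in> ?V \<and> v \<in> ?V \<and> u \<noteq> v" if uv: "(u, v) \<in> CP_oriented_arcs ks ps" for u v
  proof -
    consider i j where "i < length ks" "j < 2 * ks ! i" "u = cycle_pos i j"
        "v = cycle_pos i (Suc j mod (2 * ks ! i))"
      | i j where "i < length ps" "Suc j < 2 * ps ! i" "u = path_pos i j" "v = path_pos i (Suc j)"
      using uv unfolding CP_oriented_arcs_def by blast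
    then show ?thesis
    proof cases
      case 1
      have "Suc j mod (2 * ks ! i) < 2 * ks ! i" using pos[OF 1(1)] by simp
      moreover have "u \<noteq> v"
        using mod[OF 1(1,2)] unfolding 1(3,4) cycle_pos_def by (simp split: if_split)
      ultimately show ?thesis using cV[OF 1(1)] 1 by simp
    next
      case 2
      have "u \<noteq> v" unfolding 2(3,4) path_pos_def by simp
      then show ?thesis using pV[OF 2(1), of j] pV[OF 2(1), of "Suc j"] 2 by simp
    qed
  qed
  have arcs: "parcs (CP_graph ks ps) = CP_oriented_arcs ks ps \<union> (CP_oriented_arcs ks ps)\<inverse>"
    by (simp add: CP_graph_def)
  have sub: "parcs (CP_graph ks ps) \<subseteq> ?V \<times> ?V"
    unfolding arcs using arc by fast
  have no_loop: "u \<noteq> v" if "(u, v) \<in> parcs (CP_graph ks ps)" for u v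
    using that arc unfolding arcs by blast
  show ?thesis
  proof unfold_locales
    show "finite (parcs (CP_graph ks ps))"
      using finite_subset[OF sub] fin by simp
    show "symmetric (with_proj (CP_graph ks ps))"
      unfolding symmetric_def with_proj_simps arcs by (rule symI) blast
  qed (use fin sub no_loop in auto)
qed

end

theory Submission
  imports Defs "HOL-Analysis.Convex" "HOL-Library.Disjoint_Sets"
begin

text \<open>
  Let \<open>x\<close> be the entrywise modulus of an eigenvector for the spectral radius \<open>\<lambda>\<close> of a graph without
  the forbidden fan, scaled to maximum 1; then \<open>\<lambda> x \<le> A x\<close> entrywise, and \<open>\<lambda>\<^sup>2 \<ge> \<kappa> (n - \<kappa>)\<close>.
  Dense bipartite graphs contain long alternating paths, and one of them between a neighbourhood
  \<open>N(w)\<close> and the rest closes up to a branch centred at \<open>w\<close>; so few edges leave \<open>N(w)\<close>, and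
  comparing \<open>\<lambda>\<^sup>2 x\<^sub>w\<close> with the number of walks of length two from \<open>w\<close> shows that every vertex of
  degree below \<open>\<delta> n\<close> has small weight. (A single even cycle needs a second argument, on the edges
  leaving the second neighbourhood.) As \<open>\<kappa> + 1\<close> vertices have boundedly many common neighbours,
  the same comparison at a vertex of weight 1 leaves exactly \<open>\<kappa>\<close> vertices, forming a set \<open>L\<close>, of
  weight close to 1 and degree close to \<open>n\<close>.

  The common neighbourhood of \<open>L\<close> spans at most one edge, since a path on three vertices or two
  disjoint edges would complete a fan. Finally the quadratic form of \<open>x\<close> does not decrease when the
  graph is replaced by \<open>S\<^sup>+\<close> with clique \<open>L\<close>: the edges outside \<open>L\<close> that are lost at the exceptional
  vertices weigh less than the missing edges to \<open>L\<close>. The positive eigenvector of \<open>S\<^sup>+\<close> is explicit,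
  so Rayleigh's inequality and its equality case are elementary, and force the graph to be \<open>S\<^sup>+\<close>.
\<close>

section \<open>Dense bipartite relations\<close>

lemma obtain_element_card_less:
  assumes "finite A" "card A < card B"
  obtains b where "b \<in> B" "b \<notin> A"
  using assms by (metis card_mono linorder_not_less subsetI)

lemma card_converse_restrict: "card (R\<inverse> \<inter> B \<times> A) = card (R \<inter> A \<times> B)"
proof -
  have "R\<inverse> \<inter> B \<times> A = (R \<inter> A \<times> B)\<inverse>" by auto
  then show ?thesis by simp
qed

lemma card_restrict_remove:
  assumes "finite A" "finite B" "a \<in> A"
  shows "card (R \<inter> A \<times> B) = card (R \<inter> (A - {a}) \<times> B) + card (R `` {a} \<inter> B)"
proof -
  have "R \<inter> A \<times> B = (R \<inter> (A - {a}) \<times> B) \<union> Pair a ` (R `` {a} \<inter> B)"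
    using assms(3) by auto
  moreover have "card ((R \<inter> (A - {a}) \<times> B) \<union> Pair a ` (R `` {a} \<inter> B))
      = card (R \<inter> (A - {a}) \<times> B) + card (Pair a ` (R `` {a} \<inter> B))"
    by (rule card_Un_disjoint) (use assms in auto)
  ultimately show ?thesis by (simp add: card_image inj_on_def)
qed

lemma dense_core:
  assumes "finite A" "finite B" "p * card A + q * card B < card (R \<inter> A \<times> B)"
  shows "\<exists>A' B'. A' \<subseteq> A \<and> B' \<subseteq> B \<and> A' \<noteq> {} \<and>
    (\<forall>a\<in>A'. p < card (R `` {a} \<inter> B')) \<and> (\<forall>b\<in>B'. q < card (R\<inverse> `` {b} \<inter> A'))"
  using assms
proof (induction "card A + card B" arbitrary: A B rule: less_induct)
  case less
  consider (core) "\<forall>a\<in>A. p < card (R `` {a} \<inter> B)" "\<forall>b\<in>B. q < card (R\<inverse> `` {b} \<inter> A)"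
    | (left) a where "a \<in> A" "card (R `` {a} \<inter> B) \<le> p"
    | (right) b where "b \<in> B" "card (R\<inverse> `` {b} \<inter> A) \<le> q"
    by force
  then show ?case
  proof cases
    case core
    have "A \<noteq> {}" using less.prems(3) by auto
    then show ?thesis using core by blast
  next
    case left
    have card_A: "card A = Suc (card (A - {a}))"
      using left(1) less.prems(1) by (metis card.remove)
    have "p * card (A - {a}) + q * card B < card (R \<inter> (A - {a}) \<times> B)"
      using less.prems(3) left(2) card_restrict_remove[OF less.prems(1,2) left(1), of R]
      unfolding card_A by simp
    then have "\<exists>A' B'. A' \<subseteq> A - {a} \<and> B' \<subseteq> B \<and> A' \<noteq> {} \<and>
        (\<forall>a\<in>A'. p < card (R `` {a} \<inter> B')) \<and> (\<forall>b\<in>B'. q < card (R\<inverse> `` {b} \<inter> A'))"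
      by (intro less.hyps) (use less.prems card_A in auto)
    then show ?thesis by (meson Diff_subset subset_trans)
  next
    case right
    have card_B: "card B = Suc (card (B - {b}))"
      using right(1) less.prems(2) by (metis card.remove)
    have "card (R \<inter> A \<times> B) = card (R \<inter> A \<times> (B - {b})) + card (R\<inverse> `` {b} \<inter> A)"
      using card_restrict_remove[OF less.prems(2,1) right(1), of "R\<inverse>"]
      unfolding card_converse_restrict .
    then have "p * card A + q * card (B - {b}) < card (R \<inter> A \<times> (B - {b}))"
      using less.prems(3) right(2) unfolding card_B by simp
    then have "\<exists>A' B'. A' \<subseteq> A \<and> B' \<subseteq> B - {b} \<and> A' \<noteq> {} \<and>
        (\<forall>a\<in>A'. p < card (R `` {a} \<inter> B')) \<and> (\<forall>b\<in>B'. q < card (R\<inverse> `` {b} \<inter> A'))"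
      by (intro less.hyps) (use less.prems card_B in auto)
    then show ?thesis by (meson Diff_subset subset_trans)
  qed
qed

section \<open>Neighbourhoods and edge counts\<close>

context pair_graph
begin

abbreviation V :: "'a set" where
  "V \<equiv> pverts G"

definition nbhd :: "'a \<Rightarrow> 'a set" where
  "nbhd v = parcs G `` {v}"

definition edge_count :: "'a set \<Rightarrow> 'a set \<Rightarrow> nat" where
  "edge_count A B = card (parcs G \<inter> A \<times> B)"

definition common_nbhd :: "'a set \<Rightarrow> 'a set" where
  "common_nbhd S = {v \<in> V. \<forall>s\<in>S. (s, v) \<in> parcs G}"

lemma mem_nbhd_iff [simp]: "u \<in> nbhd v \<longleftrightarrow> (v, u) \<in> parcs G"
  by (simp add: nbhd_def)

lemma arcs_sym_iff: "(u, v) \<in> parcs G \<longleftrightarrow> (v, u) \<in> parcs G"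
  using arcs_symmetric by blast

lemma converse_parcs: "(parcs G)\<inverse> = parcs G"
  using arcs_symmetric by auto

lemma not_arc_self [simp]: "(v, v) \<notin> parcs G"
  using no_loops' by blast

lemma not_in_nbhd_self: "v \<notin> nbhd v"
  by simp

lemma nbhd_subset: "nbhd v \<subseteq> V"
  using in_arcsD2 by auto

lemma finite_if_subset_V: "A \<subseteq> V \<Longrightarrow> finite A"
  using finite_subset pair_finite_verts by blast

lemma finite_nbhd [simp]: "finite (nbhd v)"
  by (rule finite_if_subset_V[OF nbhd_subset])

lemma card_nbhd_le: "card (nbhd v) \<le> card V"
  by (simp add: card_mono nbhd_subset)

lemma common_nbhd_subset: "common_nbhd S \<subseteq> V"
  by (auto simp: common_nbhd_def)

lemma finite_common_nbhd [simp]: "finite (common_nbhd S)"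
  by (rule finite_if_subset_V[OF common_nbhd_subset])

lemma card_diff_common_nbhd: "card (V - common_nbhd S) + card (common_nbhd S) = card V"
  using card_Int_Diff[OF pair_finite_verts, of "common_nbhd S"] common_nbhd_subset[of S]
  by (simp add: Int_absorb1)

lemma common_nbhd_disjoint: "S \<inter> common_nbhd S = {}"
  by (auto simp: common_nbhd_def)

lemma common_nbhd_insert: "common_nbhd (insert v S) = nbhd v \<inter> common_nbhd S"
  using in_arcsD2 by (auto simp: common_nbhd_def)

lemma edge_count_commute: "edge_count A B = edge_count B A"
  using card_converse_restrict[of "parcs G"] by (simp add: edge_count_def converse_parcs)

lemma edge_count_mono: "A \<subseteq> A' \<Longrightarrow> B \<subseteq> B' \<Longrightarrow> edge_count A B \<le> edge_count A' B'"
  unfolding edge_count_def by (rule card_mono) auto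

lemma edge_count_Un_right_le: "edge_count A (B \<union> B') \<le> edge_count A B + edge_count A B'"
  unfolding edge_count_def by (simp add: Times_Un_distrib1 Int_Un_distrib Sigma_Un_distrib2 card_Un_le)

lemma edge_count_Un_left_le: "edge_count (A \<union> A') B \<le> edge_count A B + edge_count A' B"
  using edge_count_Un_right_le[of B A A'] by (simp only: edge_count_commute[of _ B])

lemma edge_count_le_mult:
  assumes "finite A" "finite B"
  shows "edge_count A B \<le> card A * card B"
  unfolding edge_count_def card_cartesian_product[symmetric]
  by (rule card_mono) (use assms in auto)

lemma sum_arcs_between:
  assumes "finite A"
  shows "(\<Sum>(a, b)\<in>parcs G \<inter> A \<times> B. f a b) = (\<Sum>a\<in>A. \<Sum>b\<in>nbhd a \<inter> B. f a b)"
proof -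
  have "parcs G \<inter> A \<times> B = (SIGMA a:A. nbhd a \<inter> B)" by auto
  then show ?thesis using assms by (simp add: sum.Sigma)
qed

lemma sum_arcs_swap:
  "(\<Sum>(a, b)\<in>parcs G \<inter> A \<times> B. f a b) = (\<Sum>(b, a)\<in>parcs G \<inter> B \<times> A. f a b)"
  by (rule sum.reindex_bij_witness[of _ prod.swap prod.swap]) (auto simp: arcs_sym_iff)

lemma edge_count_eq_sum: "finite A \<Longrightarrow> edge_count A B = (\<Sum>a\<in>A. card (nbhd a \<inter> B))"
  using sum_arcs_between[where f = "\<lambda>_ _. 1 :: nat"] by (simp add: edge_count_def)

lemma edge_count_le_degree_bound:
  assumes "finite A" "\<And>a. a \<in> A \<Longrightarrow> card (nbhd a \<inter> B) \<le> \<Delta>"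
  shows "edge_count A B \<le> card A * \<Delta>"
  using sum_bounded_above[of A "\<lambda>a. card (nbhd a \<inter> B)" \<Delta>] assms by (simp add: edge_count_eq_sum)

lemma edge_count_delete_le:
  assumes "finite A" "finite U" "\<And>a. a \<in> A \<Longrightarrow> card (nbhd a \<inter> B) \<le> \<Delta>"
  shows "edge_count A B \<le> edge_count (A - U) (B - U) + card U * (\<Delta> + card A)"
proof -
  have "edge_count A B \<le> edge_count (A - U) ((B - U) \<union> (B \<inter> U)) + edge_count (A \<inter> U) B"
    using edge_count_Un_left_le[of "A - U" "A \<inter> U" B] by (simp add: Un_Diff_Int)
  also have "\<dots> \<le> edge_count (A - U) (B - U) + edge_count (A - U) (B \<inter> U) + edge_count (A \<inter> U) B"
    using edge_count_Un_right_le by simp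
  also have "edge_count (A - U) (B \<inter> U) \<le> card (A - U) * card (B \<inter> U)"
    by (rule edge_count_le_mult) (use assms in auto)
  also have "\<dots> \<le> card A * card U"
    by (intro mult_le_mono card_mono) (use assms in auto)
  also have "edge_count (A \<inter> U) B \<le> card (A \<inter> U) * \<Delta>"
    by (rule edge_count_le_degree_bound) (use assms in auto)
  also have "\<dots> \<le> card U * \<Delta>"
    using assms(2) by (simp add: card_mono)
  finally show ?thesis by (simp add: algebra_simps)
qed

lemma vpath_iff:
  "vpath xs (with_proj G) \<longleftrightarrow>
    xs \<noteq> [] \<and> set xs \<subseteq> V \<and> distinct xs \<and> successively (\<lambda>u v. (u, v) \<in> parcs G) xs"
proof -
  have "set (vwalk_arcs xs) \<subseteq> parcs G \<longleftrightarrow> successively (\<lambda>u v. (u, v) \<in> parcs G) xs"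
    by (induction xs rule: vwalk_arcs.induct) auto
  then show ?thesis by (auto simp: vpath_def vwalk_def)
qed

lemma vpath_Cons_iff:
  "xs \<noteq> [] \<Longrightarrow> vpath (x # xs) (with_proj G) \<longleftrightarrow>
    vpath xs (with_proj G) \<and> (x, hd xs) \<in> parcs G \<and> x \<notin> set xs"
  using in_arcsD1 by (auto simp: vpath_iff successively_Cons)

lemma vpath_append_iff:
  "xs \<noteq> [] \<Longrightarrow> ys \<noteq> [] \<Longrightarrow> vpath (xs @ ys) (with_proj G) \<longleftrightarrow>
    vpath xs (with_proj G) \<and> vpath ys (with_proj G) \<and> (last xs, hd ys) \<in> parcs G \<and> set xs \<inter> set ys = {}"
  by (auto simp: vpath_iff successively_append_iff)

lemma vpath_extend_two:
  assumes xs: "vpath xs (with_proj G)"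
    and into_B: "card (set xs \<inter> B) < card (nbhd (hd xs) \<inter> B)"
    and into_A: "\<And>b. b \<in> B \<Longrightarrow> card (insert b (set xs) \<inter> A) < card (nbhd b \<inter> A)"
  obtains a b where "a \<in> A" "b \<in> B" "vpath (a # b # xs) (with_proj G)"
proof -
  obtain b where b: "(hd xs, b) \<in> parcs G" "b \<in> B" "b \<notin> set xs"
    using obtain_element_card_less[OF _ into_B] by auto
  obtain a where a: "(b, a) \<in> parcs G" "a \<in> A" "a \<noteq> b" "a \<notin> set xs"
    using obtain_element_card_less[OF _ into_A[OF b(2)]] by auto
  have "xs \<noteq> []" using xs by (simp add: vpath_iff)
  then have "vpath (a # b # xs) (with_proj G)"
    using xs a b by (auto simp: vpath_Cons_iff arcs_sym_iff)
  then show thesis using that a(2) b(2) by blast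
qed

definition alternating_vpath :: "'a set \<Rightarrow> 'a set \<Rightarrow> 'a \<Rightarrow> nat \<Rightarrow> 'a list \<Rightarrow> bool" where
  "alternating_vpath A B a k xs \<longleftrightarrow>
     vpath xs (with_proj G) \<and> length xs = 2 * k - 1 \<and> hd xs \<in> A \<and> last xs = a \<and> set xs \<subseteq> A \<union> B \<and>
     (A \<inter> B = {} \<longrightarrow> card (set xs \<inter> A) = k \<and> card (set xs \<inter> B) = k - 1)"

text \<open>
  On disjoint sides the degrees only have to beat the number of path vertices on the same side, which
  gives the sharp bounds \<open>k - 1\<close> and \<open>k\<close>.
\<close>

lemma alternating_vpath_extend:
  assumes xs: "alternating_vpath A B a j xs" and j: "1 \<le> j" "j < k"
    and deg_A: "\<And>a. a \<in> A \<Longrightarrow> (if A \<inter> B = {} then k - 1 else 2 * k) \<le> card (nbhd a \<inter> B)"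
    and deg_B: "\<And>b. b \<in> B \<Longrightarrow> (if A \<inter> B = {} then k else 2 * k) \<le> card (nbhd b \<inter> A)"
  shows "\<exists>ys. alternating_vpath A B a (Suc j) ys"
proof -
  have path: "vpath xs (with_proj G)" "length xs = 2 * j - 1" "hd xs \<in> A" "last xs = a" "set xs \<subseteq> A \<union> B"
    and counts: "A \<inter> B = {} \<Longrightarrow> card (set xs \<inter> A) = j" "A \<inter> B = {} \<Longrightarrow> card (set xs \<inter> B) = j - 1"
    using xs by (simp_all add: alternating_vpath_def)
  have "xs \<noteq> []" "card (set xs) = 2 * j - 1"
    using path(1,2) by (auto simp: vpath_iff distinct_card)
  then have card_Int: "card (insert b (set xs) \<inter> X) \<le> 2 * j" for b X
    using card_mono[of "insert b (set xs)" "insert b (set xs) \<inter> X"] j(1)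
    by (simp add: card_insert_if split: if_splits)
  obtain c b where cb: "c \<in> A" "b \<in> B" "vpath (c # b # xs) (with_proj G)"
  proof (rule vpath_extend_two[OF path(1)])
    show "card (set xs \<inter> B) < card (nbhd (hd xs) \<inter> B)"
      using counts(2) card_Int[of "hd xs" B] deg_A[OF path(3)] \<open>xs \<noteq> []\<close> j
      by (auto simp: insert_absorb split: if_splits)
    show "card (insert b (set xs) \<inter> A) < card (nbhd b \<inter> A)" if "b \<in> B" for b
    proof -
      have "A \<inter> B = {} \<Longrightarrow> insert b (set xs) \<inter> A = set xs \<inter> A" using that by auto
      then show ?thesis using counts(1) card_Int[of b A] deg_B[OF that] j by (auto split: if_splits)
    qed
  qed
  have "card (set (c # b # xs) \<inter> A) = Suc j" "card (set (c # b # xs) \<inter> B) = j"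
    if disjoint: "A \<inter> B = {}"
  proof -
    have "set (c # b # xs) \<inter> A = insert c (set xs \<inter> A)" "set (c # b # xs) \<inter> B = insert b (set xs \<inter> B)"
      using disjoint cb(1,2) by auto
    moreover have "c \<notin> set xs" "b \<notin> set xs" using cb(3) by (auto simp: vpath_iff)
    ultimately show "card (set (c # b # xs) \<inter> A) = Suc j" "card (set (c # b # xs) \<inter> B) = j"
      using disjoint counts j(1) by (simp_all del: set_simps)
  qed
  then have "alternating_vpath A B a (Suc j) (c # b # xs)"
    using path cb j(1) \<open>xs \<noteq> []\<close> by (simp add: alternating_vpath_def)
  then show ?thesis by blast
qed

lemma alternating_vpath_exists:
  assumes "A \<subseteq> V" "a\<^sub>0 \<in> A" "1 \<le> k"
    and "\<And>a. a \<in> A \<Longrightarrow> (if A \<inter> B = {} then k - 1 else 2 * k) \<le> card (nbhd a \<inter> B)"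
    and "\<And>b. b \<in> B \<Longrightarrow> (if A \<inter> B = {} then k else 2 * k) \<le> card (nbhd b \<inter> A)"
  obtains xs where "alternating_vpath A B a\<^sub>0 k xs"
proof -
  have "\<exists>xs. alternating_vpath A B a\<^sub>0 j xs" if "1 \<le> j" "j \<le> k" for j
    using that
  proof (induction j rule: dec_induct)
    case base
    have "alternating_vpath A B a\<^sub>0 1 [a\<^sub>0]"
      using assms(1,2) by (auto simp: alternating_vpath_def vpath_iff)
    then show ?case by blast
  next
    case (step j)
    then show ?case using alternating_vpath_extend[OF _ _ _ assms(4,5)] by auto
  qed
  from this[of k] show thesis using that assms(3) by blast
qed

end

section \<open>Branches and fans\<close>

context pair_graph
begin

text \<open>
  The list omits the centre \<open>c\<close>. A cycle of length \<open>2k\<close> and a path on \<open>2k\<close> vertices both leave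
  \<open>2k - 1\<close> vertices and differ only in the closing edge.
\<close>

definition branch :: "'a \<Rightarrow> bool \<Rightarrow> nat \<Rightarrow> 'a list \<Rightarrow> bool" where
  "branch c cyc k xs \<longleftrightarrow>
     length xs = 2 * k - 1 \<and> vpath (c # xs) (with_proj G) \<and> (cyc \<longrightarrow> (last xs, c) \<in> parcs G)"

definition fan :: "'i set \<Rightarrow> ('i \<Rightarrow> nat) \<Rightarrow> ('i \<Rightarrow> bool) \<Rightarrow> 'a \<Rightarrow> ('i \<Rightarrow> 'a list) \<Rightarrow> bool" where
  "fan I half cyclic c xss \<longleftrightarrow>
     (\<forall>i\<in>I. branch c (cyclic i) (half i) (xss i)) \<and> disjoint_family_on (\<lambda>i. set (xss i)) I"

lemma branchI:
  assumes "vpath xs (with_proj G)" "length xs = 2 * k - 1" "c \<notin> set xs"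
    and "(c, hd xs) \<in> parcs G" "(last xs, c) \<in> parcs G"
  shows "branch c cyc k xs"
proof -
  have "xs \<noteq> []" using assms(1) by (simp add: vpath_iff)
  then show ?thesis using assms by (simp add: branch_def vpath_Cons_iff)
qed

lemma card_set_branch: "branch c cyc k xs \<Longrightarrow> card (set xs) = 2 * k - 1"
  by (simp add: branch_def vpath_def distinct_card)

lemma centre_notin_branch: "branch c cyc k xs \<Longrightarrow> c \<notin> set xs"
  by (simp add: branch_def vpath_iff)

lemma fan_insert:
  assumes "fan I half cyclic c xss" "i \<notin> I" "branch c (cyclic i) (half i) xs"
    and "set xs \<inter> (\<Union>j\<in>I. set (xss j)) = {}"
  shows "fan (insert i I) half cyclic c (xss(i := xs))"
proof -
  have "(xss(i := xs)) j = xss j" if "j \<in> I" for j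
    using that assms(2) by auto
  then have "disjoint_family_on (\<lambda>j. set ((xss(i := xs)) j)) (insert i I)"
    using assms unfolding fan_def disjoint_family_on_insert[OF assms(2)]
    by (simp add: disjoint_family_on_def)
  then show ?thesis
    using assms(1,3) by (auto simp: fan_def)
qed

lemma branch_of_dense:
  assumes "A \<subseteq> nbhd w" "B \<subseteq> V" "w \<notin> B" "1 \<le> k"
    and dense: "2 * k * card A + (if A \<inter> B = {} then k - 1 else 2 * k) * card B < edge_count A B"
  obtains xs where "branch w cyc k xs" "set xs \<subseteq> A \<union> B"
proof -
  have "A \<subseteq> V" using assms(1) nbhd_subset by blast
  then have "finite A" "finite B" using assms(2) finite_if_subset_V by auto
  then obtain A' B' where core: "A' \<subseteq> A" "B' \<subseteq> B" "A' \<noteq> {}"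
      "\<And>a. a \<in> A' \<Longrightarrow> 2 * k < card (nbhd a \<inter> B')"
      "\<And>b. b \<in> B' \<Longrightarrow> (if A \<inter> B = {} then k - 1 else 2 * k) < card (nbhd b \<inter> A')"
    using dense_core[of A B "2 * k" "if A \<inter> B = {} then k - 1 else 2 * k" "parcs G"] dense
    unfolding edge_count_def nbhd_def converse_parcs by blast
  obtain a\<^sub>0 where a\<^sub>0: "a\<^sub>0 \<in> A'" using core(3) by blast
  obtain xs where "alternating_vpath A' B' a\<^sub>0 k xs"
  proof (rule alternating_vpath_exists[of A' a\<^sub>0 k B'])
    show "(if A' \<inter> B' = {} then k - 1 else 2 * k) \<le> card (nbhd a \<inter> B')" if "a \<in> A'" for a
      using core(4)[OF that] by auto
    show "(if A' \<inter> B' = {} then k else 2 * k) \<le> card (nbhd b \<inter> A')" if "b \<in> B'" for b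
    proof (cases "A \<inter> B = {}")
      case True
      then have "A' \<inter> B' = {}" using core(1,2) by blast
      then show ?thesis using core(5)[OF that] True by simp
    next
      case False
      then show ?thesis using core(5)[OF that] by simp
    qed
  qed (use a\<^sub>0 core(1) \<open>A \<subseteq> V\<close> assms(4) in auto)
  then have xs: "vpath xs (with_proj G)" "length xs = 2 * k - 1" "hd xs \<in> A'" "last xs = a\<^sub>0"
      "set xs \<subseteq> A' \<union> B'"
    by (simp_all add: alternating_vpath_def)
  have "hd xs \<in> nbhd w" "last xs \<in> nbhd w"
    using xs(3,4) a\<^sub>0 core(1) assms(1) by blast+
  then have "(w, hd xs) \<in> parcs G" "(last xs, w) \<in> parcs G"
    by (auto dest: arcs_symmetric)
  moreover have "w \<notin> set xs"
    using xs(5) core(1,2) assms(1,3) not_in_nbhd_self by blast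
  ultimately have "branch w cyc k xs"
    using xs(1,2) by (intro branchI)
  then show thesis using that xs(5) core(1,2) by blast
qed

lemma greedy_fan:
  assumes "finite I"
    and branch_avoiding: "\<And>i U. i \<in> I \<Longrightarrow> finite U \<Longrightarrow> card U \<le> (\<Sum>i\<in>I. 2 * half i) \<Longrightarrow>
        \<exists>xs. branch c (cyclic i) (half i) xs \<and> set xs \<inter> U = {}"
  shows "\<exists>xss. fan I half cyclic c xss"
proof -
  have "\<exists>xss. fan J half cyclic c xss" if "J \<subseteq> I" for J
    using finite_subset[OF that assms(1)] that
  proof (induction J rule: finite_induct)
    case empty
    show ?case by (simp add: fan_def disjoint_family_on_def)
  next
    case (insert i J)
    then obtain xss where xss: "fan J half cyclic c xss" by auto
    let ?U = "\<Union>j\<in>J. set (xss j)"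
    have "card ?U \<le> (\<Sum>j\<in>J. card (set (xss j)))" by (rule card_UN_le[OF insert.hyps(1)])
    also have "\<dots> \<le> (\<Sum>j\<in>J. 2 * half j)"
      by (rule sum_mono) (use xss card_set_branch in \<open>fastforce simp: fan_def\<close>)
    also have "\<dots> \<le> (\<Sum>j\<in>I. 2 * half j)"
      by (rule sum_mono2) (use insert.prems assms(1) in auto)
    finally obtain xs where "branch c (cyclic i) (half i) xs" "set xs \<inter> ?U = {}"
      using branch_avoiding[of i ?U] insert by auto
    then show ?case using fan_insert[OF xss insert.hyps(2)] by blast
  qed
  then show ?thesis by blast
qed

lemma hub_path:
  assumes "finite S" "S \<subseteq> L" "Q \<subseteq> common_nbhd L" "q \<in> Q" "1 \<le> k" "k - 1 \<le> card S" "k \<le> card Q"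
  obtains xs where "vpath xs (with_proj G)" "length xs = 2 * k - 1" "hd xs \<in> Q" "last xs = q"
    "set xs \<subseteq> Q \<union> S" "card (set xs \<inter> S) = k - 1"
proof -
  have disjoint: "Q \<inter> S = {}" using assms(2,3) common_nbhd_disjoint by blast
  have arc: "(s, q) \<in> parcs G" if "s \<in> S" "q \<in> Q" for s q
    using that assms(2,3) by (auto simp: common_nbhd_def)
  obtain xs where "alternating_vpath Q S q k xs"
  proof (rule alternating_vpath_exists[of Q q k S])
    show "Q \<subseteq> V" using assms(3) common_nbhd_subset by blast
    show "(if Q \<inter> S = {} then k - 1 else 2 * k) \<le> card (nbhd u \<inter> S)" if "u \<in> Q" for u
    proof -
      have "nbhd u \<inter> S = S" using arcs_symmetric[OF arc] that by auto
      then show ?thesis using disjoint assms(6) by simp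
    qed
    show "(if Q \<inter> S = {} then k else 2 * k) \<le> card (nbhd s \<inter> Q)" if "s \<in> S" for s
    proof -
      have "nbhd s \<inter> Q = Q" using arc that by auto
      then show ?thesis using disjoint assms(7) by simp
    qed
  qed (use assms(4,5) in auto)
  then show thesis using that[of xs] disjoint by (simp add: alternating_vpath_def)
qed

lemma hub_branch:
  assumes "c \<in> L" "finite S" "S \<subseteq> L - {c}" "Q \<subseteq> common_nbhd L" "1 \<le> k" "k - 1 \<le> card S" "k \<le> card Q"
  obtains xs where "branch c cyc k xs" "set xs \<subseteq> S \<union> Q" "card (set xs \<inter> S) = k - 1"
proof -
  have "Q \<noteq> {}" using assms(5,7) by auto
  then obtain q where q: "q \<in> Q" by blast
  obtain xs where xs: "vpath xs (with_proj G)" "length xs = 2 * k - 1" "hd xs \<in> Q" "last xs = q"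
      "set xs \<subseteq> Q \<union> S" "card (set xs \<inter> S) = k - 1"
    by (rule hub_path[OF _ _ assms(4) q assms(5)]) (use assms in auto)
  have "(c, u) \<in> parcs G" if "u \<in> Q" for u
    using that assms(1,4) by (auto simp: common_nbhd_def)
  moreover have "c \<notin> set xs"
    using xs(5) assms(1,3,4) common_nbhd_disjoint by blast
  ultimately have "branch c cyc k xs"
    using xs q by (intro branchI) (auto intro: arcs_symmetric)
  then show thesis using that xs(5,6) by blast
qed

lemma hub_fan:
  assumes "finite I" "c \<in> L" "finite S" "S \<subseteq> L - {c}" "Q \<subseteq> common_nbhd L"
    and "\<And>i. i \<in> I \<Longrightarrow> 1 \<le> half i" "(\<Sum>i\<in>I. half i - 1) \<le> card S" "(\<Sum>i\<in>I. 2 * half i) \<le> card Q"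
  shows "\<exists>xss. fan I half cyclic c xss \<and> (\<forall>i\<in>I. set (xss i) \<subseteq> S \<union> Q)"
  using assms
proof (induction I arbitrary: S Q rule: finite_induct)
  case empty
  show ?case by (simp add: fan_def disjoint_family_on_def)
next
  case (insert i I)
  have half_i: "1 \<le> half i" "half i - 1 \<le> card S" "half i \<le> card Q"
    using insert.prems(5,6,7) insert.hyps by auto
  obtain xs where xs: "branch c (cyclic i) (half i) xs" "set xs \<subseteq> S \<union> Q"
      "card (set xs \<inter> S) = half i - 1"
    using hub_branch[OF insert.prems(1-4) half_i] by blast
  have "\<exists>xss. fan I half cyclic c xss \<and> (\<forall>i\<in>I. set (xss i) \<subseteq> (S - set xs) \<union> (Q - set xs))"
  proof (rule insert.IH)
    have "card (S - set xs) = card S - (half i - 1)"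
      using xs(3) insert.prems(2) by (simp add: card_Diff_subset_Int Int_commute)
    then show "(\<Sum>i\<in>I. half i - 1) \<le> card (S - set xs)"
      using insert.prems(6) insert.hyps by simp
    have "card Q - (2 * half i - 1) \<le> card (Q - set xs)"
      using diff_card_le_card_Diff[of "set xs" Q] card_set_branch[OF xs(1)] by simp
    then show "(\<Sum>i\<in>I. 2 * half i) \<le> card (Q - set xs)"
      using insert.prems(7) insert.hyps by simp
  qed (use insert.prems in auto)
  then obtain xss where xss: "fan I half cyclic c xss"
      "\<forall>i\<in>I. set (xss i) \<subseteq> (S - set xs) \<union> (Q - set xs)"
    by blast
  have "fan (insert i I) half cyclic c (xss(i := xs))"
    by (rule fan_insert[OF xss(1) insert.hyps(2) xs(1)]) (use xss(2) in auto)
  moreover have "\<forall>j\<in>insert i I. set ((xss(i := xs)) j) \<subseteq> S \<union> Q"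
    using xss(2) xs(2) by auto
  ultimately show ?case by blast
qed

end

section \<open>Edges and common neighbourhoods in fan-free graphs\<close>

locale fan_shape =
  fixes I :: "'i set" and half :: "'i \<Rightarrow> nat" and cyclic :: "'i \<Rightarrow> bool"
  assumes finite_I: "finite I"
    and half_ge_2: "i \<in> I \<Longrightarrow> 2 \<le> half i"
    and long_branch: "\<exists>i\<in>I. 3 \<le> half i"
    and single_cyclic: "I = {i} \<Longrightarrow> cyclic i"
begin

definition \<kappa> :: nat where
  "\<kappa> = (\<Sum>i\<in>I. half i - 1)"

definition \<sigma> :: nat where
  "\<sigma> = (\<Sum>i\<in>I. 2 * half i)"

definition edge_const :: nat where
  "edge_const = 2 * \<sigma> + 1"

lemma half_le_\<sigma>: "i \<in> I \<Longrightarrow> 2 * half i \<le> \<sigma>"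
  unfolding \<sigma>_def by (rule member_le_sum) (use finite_I in auto)

lemma half_minus_one_le_\<kappa>: "i \<in> I \<Longrightarrow> half i - 1 \<le> \<kappa>"
  unfolding \<kappa>_def by (rule member_le_sum) (use finite_I in auto)

lemma \<kappa>_ge_2: "2 \<le> \<kappa>"
  using long_branch half_minus_one_le_\<kappa> by fastforce

lemma half_le_\<kappa>:
  assumes "i \<in> I" "j \<in> I" "i \<noteq> j"
  shows "half i \<le> \<kappa>"
proof -
  have "(\<Sum>i\<in>{i, j}. half i - 1) \<le> \<kappa>"
    unfolding \<kappa>_def by (rule sum_mono2) (use assms finite_I in auto)
  then show ?thesis using assms half_ge_2[of i] half_ge_2[of j] by simp
qed

end

locale fan_free = pair_graph G + fan_shape I half cyclic
  for G :: "'a pair_pre_digraph" and I :: "'i set" and half cyclic +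
  assumes no_fan: "\<not> fan I half cyclic c xss"
begin

lemma edge_count_nbhd_le_degree_bound:
  assumes "A \<subseteq> nbhd w" "B \<subseteq> V" "w \<notin> B"
    and half_le: "\<And>i. i \<in> I \<Longrightarrow> half i \<le> K"
    and \<Delta>: "\<And>a. a \<in> A \<Longrightarrow> card (nbhd a \<inter> B) \<le> \<Delta>"
  shows "edge_count A B \<le> (if A \<inter> B = {} then K - 1 else \<sigma>) * card B + \<sigma> * (\<Delta> + 2 * card A)"
proof (rule ccontr)
  assume dense: "\<not> ?thesis"
  have fin: "finite A" "finite B"
    using assms(1,2) finite_subset[OF _ finite_nbhd] finite_if_subset_V by blast+
  have "\<exists>xss. fan I half cyclic w xss"
  proof (rule greedy_fan[OF finite_I], fold \<sigma>_def)
    fix i and U :: "'a set" assume i: "i \<in> I" and U: "finite U" "card U \<le> \<sigma>"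
    let ?A = "A - U" and ?B = "B - U"
    have "edge_count A B \<le> edge_count ?A ?B + card U * (\<Delta> + card A)"
      by (rule edge_count_delete_le) (use fin U(1) \<Delta> in auto)
    also have "card U * (\<Delta> + card A) \<le> \<sigma> * (\<Delta> + card A)" using U(2) by simp
    finally have "\<sigma> * card A + (if A \<inter> B = {} then K - 1 else \<sigma>) * card B < edge_count ?A ?B"
      using dense by (simp add: algebra_simps)
    moreover have "2 * half i * card ?A \<le> \<sigma> * card A"
      by (intro mult_le_mono half_le_\<sigma>[OF i] card_mono) (use fin in auto)
    moreover have "(if ?A \<inter> ?B = {} then half i - 1 else 2 * half i) * card ?B
        \<le> (if A \<inter> B = {} then K - 1 else \<sigma>) * card B"
      by (rule mult_le_mono) (use half_le[OF i] half_le_\<sigma>[OF i] fin in \<open>auto intro: card_mono\<close>)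
    ultimately have "2 * half i * card ?A + (if ?A \<inter> ?B = {} then half i - 1 else 2 * half i) * card ?B
        < edge_count ?A ?B"
      by linarith
    then obtain xs where "branch w (cyclic i) (half i) xs" "set xs \<subseteq> ?A \<union> ?B"
      by (rule branch_of_dense[rotated 4]) (use assms(1-3) half_ge_2[OF i] in auto)
    then show "\<exists>xs. branch w (cyclic i) (half i) xs \<and> set xs \<inter> U = {}" by blast
  qed
  then show False using no_fan by blast
qed

lemma edge_count_nbhd_le:
  assumes "A \<subseteq> nbhd w" "B \<subseteq> V"
  shows "edge_count A B \<le> edge_const * (card A + card B)"
proof -
  have fin: "finite A" "finite B"
    using assms finite_subset[OF _ finite_nbhd] finite_if_subset_V by blast+
  have half_le: "half i \<le> \<sigma>" if "i \<in> I" for i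
    using half_le_\<sigma>[OF that] by simp
  have "edge_count A B \<le> edge_count A (B - {w}) + edge_count A {w}"
    by (rule order_trans[OF edge_count_mono edge_count_Un_right_le]) auto
  also have "edge_count A (B - {w})
      \<le> (if A \<inter> (B - {w}) = {} then \<sigma> - 1 else \<sigma>) * card (B - {w}) + \<sigma> * (card (B - {w}) + 2 * card A)"
    by (rule edge_count_nbhd_le_degree_bound[OF assms(1)])
      (use assms(2) fin half_le in \<open>auto intro: card_mono\<close>)
  also have "\<dots> \<le> \<sigma> * card (B - {w}) + \<sigma> * (card (B - {w}) + 2 * card A)" by simp
  also have "\<dots> \<le> \<sigma> * card B + \<sigma> * (card B + 2 * card A)"
    by (intro add_mono mult_le_mono2 order_refl card_mono) (use fin in auto)
  also have "edge_count A {w} \<le> card A"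
    using edge_count_le_mult[OF fin(1), of "{w}"] by simp
  finally show ?thesis by (simp add: edge_const_def algebra_simps)
qed

lemma card_common_nbhd_less:
  assumes "S \<subseteq> V" "card S = Suc \<kappa>"
  shows "card (common_nbhd S) < \<sigma>"
proof (rule ccontr)
  assume large: "\<not> ?thesis"
  obtain c where c: "c \<in> S" using assms(2) by fastforce
  have "\<exists>xss. fan I half cyclic c xss \<and> (\<forall>i\<in>I. set (xss i) \<subseteq> (S - {c}) \<union> common_nbhd S)"
  proof (rule hub_fan[OF finite_I c])
    show "finite (S - {c})" using assms(1) finite_if_subset_V by blast
    show "1 \<le> half i" if "i \<in> I" for i using half_ge_2[OF that] by simp
    show "(\<Sum>i\<in>I. half i - 1) \<le> card (S - {c})"
      using assms(2) c by (simp add: \<kappa>_def card_Diff_singleton)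
    show "(\<Sum>i\<in>I. 2 * half i) \<le> card (common_nbhd S)" using large by (simp add: \<sigma>_def)
  qed auto
  then show False using no_fan by blast
qed

lemma card_nbhd_Int_common_nbhd_less:
  assumes "L \<subseteq> V" "card L = \<kappa>" "v \<in> V - L"
  shows "card (nbhd v \<inter> common_nbhd L) < \<sigma>"
proof -
  have "finite L" using assms(1) finite_if_subset_V by blast
  then have "card (common_nbhd (insert v L)) < \<sigma>"
    by (intro card_common_nbhd_less) (use assms in auto)
  then show ?thesis by (simp add: common_nbhd_insert)
qed

lemma card_many_nbhd_Int_le:
  assumes "S \<subseteq> V"
  shows "card {v \<in> V. \<kappa> < card (nbhd v \<inter> S)} \<le> 2 ^ card S * \<sigma>"
proof -
  let ?\<T> = "{T. T \<subseteq> S \<and> card T = Suc \<kappa>}"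
  have "finite S" using assms finite_if_subset_V by blast
  then have fin: "finite ?\<T>" and "card ?\<T> \<le> card (Pow S)"
    by (auto intro: finite_subset[of _ "Pow S"] card_mono)
  have "{v \<in> V. \<kappa> < card (nbhd v \<inter> S)} \<subseteq> (\<Union>T\<in>?\<T>. common_nbhd T)"
  proof
    fix v assume v: "v \<in> {v \<in> V. \<kappa> < card (nbhd v \<inter> S)}"
    then obtain T where T: "T \<subseteq> nbhd v \<inter> S" "card T = Suc \<kappa>"
      by (metis (no_types, lifting) Suc_leI mem_Collect_eq obtain_subset_with_card_n)
    then have "v \<in> common_nbhd T" using v arcs_sym_iff by (auto simp: common_nbhd_def)
    then show "v \<in> (\<Union>T\<in>?\<T>. common_nbhd T)" using T by blast
  qed
  then have "card {v \<in> V. \<kappa> < card (nbhd v \<inter> S)} \<le> card (\<Union>T\<in>?\<T>. common_nbhd T)"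
    using fin by (intro card_mono) auto
  also have "\<dots> \<le> (\<Sum>T\<in>?\<T>. card (common_nbhd T))" by (rule card_UN_le[OF fin])
  also have "\<dots> \<le> card ?\<T> * \<sigma>"
  proof -
    have "card (common_nbhd T) \<le> \<sigma>" if "T \<in> ?\<T>" for T
      using card_common_nbhd_less[of T] that assms by (simp add: less_imp_le order_trans[of T S V])
    then show ?thesis using sum_bounded_above[of ?\<T> "\<lambda>T. card (common_nbhd T)" \<sigma>] by simp
  qed
  also have "\<dots> \<le> 2 ^ card S * \<sigma>"
    using \<open>card ?\<T> \<le> card (Pow S)\<close> \<open>finite S\<close> by (simp add: card_Pow)
  finally show ?thesis .
qed

lemma edge_count_into_le:
  assumes "W \<subseteq> V" "S \<subseteq> V"
  shows "edge_count W S \<le> \<kappa> * card W + card S * (\<sigma> * 2 ^ card S)"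
proof -
  define Many where "Many = {v \<in> V. \<kappa> < card (nbhd v \<inter> S)}"
  have fin: "finite W" "finite S" "finite Many"
    using assms finite_if_subset_V by (auto simp: Many_def)
  have "edge_count W S \<le> edge_count (W - Many) S + edge_count Many S"
    by (rule order_trans[OF edge_count_mono edge_count_Un_left_le]) auto
  also have "edge_count (W - Many) S \<le> card (W - Many) * \<kappa>"
    by (rule edge_count_le_degree_bound) (use fin assms in \<open>auto simp: Many_def\<close>)
  also have "\<dots> \<le> card W * \<kappa>" using fin by (simp add: card_mono)
  also have "edge_count Many S \<le> card Many * card S" using fin by (intro edge_count_le_mult)
  also have "\<dots> \<le> 2 ^ card S * \<sigma> * card S"
    using card_many_nbhd_Int_le[OF assms(2)] by (simp add: Many_def)
  finally show ?thesis by (simp add: mult.commute mult.left_commute)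
qed

text \<open>
  When all degrees in \<open>W\<close> are small, each branch can be found after deleting the previous ones at
  little cost; so the leading term is governed by the longest single branch, and not by the whole fan.
\<close>

lemma edge_count_low_degree_le:
  assumes W: "W \<subseteq> V" "w \<in> W" and deg: "\<And>v. v \<in> W \<Longrightarrow> card (nbhd v) \<le> \<Delta>"
    and half_le: "\<And>i. i \<in> I \<Longrightarrow> half i \<le> K"
  shows "edge_count (nbhd w \<inter> W) W \<le> (K - 1) * card V + \<sigma> * (3 * \<Delta>) + edge_const * (2 * \<Delta> + 1)"
proof -
  let ?A = "nbhd w \<inter> W" and ?B = "W - insert w (nbhd w)"
  have card_A: "card ?A \<le> \<Delta>" using card_mono[of "nbhd w" ?A] deg[OF W(2)] by simp
  have BV: "?B \<subseteq> V" using W(1) by blast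
  have "edge_count ?A W \<le> edge_count ?A (?B \<union> insert w (nbhd w))"
    by (rule edge_count_mono) auto
  also have "\<dots> \<le> edge_count ?A ?B + edge_count ?A (insert w (nbhd w))"
    by (rule edge_count_Un_right_le)
  also have "edge_count ?A ?B \<le> (if ?A \<inter> ?B = {} then K - 1 else \<sigma>) * card ?B + \<sigma> * (\<Delta> + 2 * card ?A)"
  proof (rule edge_count_nbhd_le_degree_bound)
    show "card (nbhd a \<inter> ?B) \<le> \<Delta>" if "a \<in> ?A" for a
      using card_mono[of "nbhd a" "nbhd a \<inter> ?B"] deg[of a] that by simp
  qed (use half_le BV in auto)
  also have "\<dots> \<le> (K - 1) * card V + \<sigma> * (3 * \<Delta>)"
  proof -
    have "?A \<inter> ?B = {}" by auto
    then show ?thesis using card_A card_mono[OF pair_finite_verts BV] by (simp add: add_mono)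
  qed
  also have "edge_count ?A (insert w (nbhd w)) \<le> edge_const * (card ?A + card (insert w (nbhd w)))"
    by (rule edge_count_nbhd_le[of ?A w]) (use W nbhd_subset in auto)
  also have "\<dots> \<le> edge_const * (2 * \<Delta> + 1)"
    using card_A deg[OF W(2)] by (intro mult_le_mono2) simp
  finally show ?thesis by simp
qed

text \<open>
  A branch that spends fewer than \<open>half i - 1\<close> vertices of \<open>L\<close> besides its centre leaves enough of
  them for all other branches.
\<close>

lemma half_le_card_branch_Int_hubs:
  assumes L: "L \<subseteq> V" "card L = \<kappa>" "\<sigma> \<le> card (common_nbhd L)" "c \<in> L"
    and i: "i \<in> I" and xs: "branch c (cyclic i) (half i) xs"
  shows "half i - 1 \<le> card (set xs \<inter> L)"
proof (rule ccontr)
  assume few: "\<not> ?thesis"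
  have finite_L: "finite L" using L(1) finite_if_subset_V by blast
  let ?S = "L - insert c (set xs)" and ?Q = "common_nbhd L - set xs"
  have "\<exists>xss. fan (I - {i}) half cyclic c xss \<and> (\<forall>j\<in>I - {i}. set (xss j) \<subseteq> ?S \<union> ?Q)"
  proof (rule hub_fan[OF _ L(4)])
    show "1 \<le> half j" if "j \<in> I - {i}" for j using half_ge_2[of j] that by simp
    have "card (L \<inter> insert c (set xs)) = Suc (card (set xs \<inter> L))"
      using L(4) centre_notin_branch[OF xs] finite_L by (simp add: Int_commute)
    then have "card ?S = \<kappa> - Suc (card (set xs \<inter> L))"
      using L(2) by (simp add: card_Diff_subset_Int)
    then show "(\<Sum>j\<in>I - {i}. half j - 1) \<le> card ?S"
      using few sum.remove[OF finite_I i, of "\<lambda>j. half j - 1"] by (simp add: \<kappa>_def)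
    have "\<sigma> - (2 * half i - 1) \<le> card ?Q"
      using diff_card_le_card_Diff[of "set xs" "common_nbhd L"] card_set_branch[OF xs] L(3) by simp
    then show "(\<Sum>j\<in>I - {i}. 2 * half j) \<le> card ?Q"
      using sum.remove[OF finite_I i, of "\<lambda>j. 2 * half j"] by (simp add: \<sigma>_def)
  qed (use finite_I finite_L in auto)
  then obtain xss where xss: "fan (I - {i}) half cyclic c xss"
      "\<forall>j\<in>I - {i}. set (xss j) \<subseteq> ?S \<union> ?Q"
    by blast
  have "fan (insert i (I - {i})) half cyclic c (xss(i := xs))"
    by (rule fan_insert[OF xss(1) _ xs]) (use xss(2) in blast)+
  then show False using no_fan i by (simp add: insert_absorb)
qed

end

context fan_free
begin

text \<open>
  Along a path that alternates between \<open>L\<close> and its common neighbourhood, every second vertex is a hub.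
  A detour \<open>zs\<close> with fewer hubs closes to a branch that leaves too many hubs to the others.
\<close>

lemma no_path_saving_hub:
  assumes L: "L \<subseteq> V" "card L = \<kappa>" "\<sigma> \<le> card (common_nbhd L)"
    and i: "i \<in> I" and c: "c \<in> L" "c \<notin> set zs"
    and zs: "vpath (q # zs) (with_proj G)" "length zs = 2 * m" "1 \<le> m" "m < half i"
    and ends: "q \<in> common_nbhd L" "last zs \<in> common_nbhd L"
    and few: "card (set zs \<inter> L) < m"
  shows False
proof -
  have "finite L" using L(1) by (rule finite_if_subset_V)
  have "zs \<noteq> []" using zs(2,3) by auto
  have "q \<notin> set zs" using zs(1) by (simp add: vpath_iff)
  let ?S = "L - insert c (set zs)" and ?Q = "common_nbhd L - set zs"
  obtain ys where ys: "vpath ys (with_proj G)" "length ys = 2 * (half i - m) - 1" "hd ys \<in> ?Q"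
      "last ys = q" "set ys \<subseteq> ?Q \<union> ?S" "card (set ys \<inter> ?S) = half i - m - 1"
  proof (rule hub_path[of ?S L ?Q q "half i - m"])
    have "card (L \<inter> insert c (set zs)) = Suc (card (set zs \<inter> L))"
      using c \<open>finite L\<close> by (simp add: Int_commute)
    then have "card ?S = \<kappa> - Suc (card (set zs \<inter> L))"
      using L(2) by (simp add: card_Diff_subset_Int)
    then show "half i - m - 1 \<le> card ?S" using half_minus_one_le_\<kappa>[OF i] few by linarith
    have "\<sigma> - 2 * m \<le> card ?Q"
      using diff_card_le_card_Diff[of "set zs" "common_nbhd L"] card_length[of zs] L(3) zs(2) by simp
    then show "half i - m \<le> card ?Q" using half_le_\<sigma>[OF i] by linarith
  qed (use \<open>finite L\<close> \<open>q \<notin> set zs\<close> ends(1) zs(4) in auto)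
  have adj: "(c, u) \<in> parcs G" if "u \<in> common_nbhd L" for u
    using that c(1) by (simp add: common_nbhd_def)
  have "branch c (cyclic i) (half i) (ys @ zs)"
  proof (rule branchI)
    have "ys \<noteq> []" using ys(1) by (simp add: vpath_iff)
    then show "vpath (ys @ zs) (with_proj G)" "(c, hd (ys @ zs)) \<in> parcs G"
      using ys(1,3-5) zs(1) adj by (auto simp: vpath_append_iff vpath_Cons_iff \<open>zs \<noteq> []\<close>)
    show "length (ys @ zs) = 2 * half i - 1" using ys(2) zs(2,4) by simp
    show "c \<notin> set (ys @ zs)" using ys(5) c common_nbhd_disjoint[of L] by auto
    show "(last (ys @ zs), c) \<in> parcs G" using arcs_symmetric[OF adj] ends(2) \<open>zs \<noteq> []\<close> by simp
  qed
  then have "half i - 1 \<le> card (set (ys @ zs) \<inter> L)"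
    by (rule half_le_card_branch_Int_hubs[OF L c(1) i])
  moreover have "set (ys @ zs) \<inter> L = (set ys \<inter> ?S) \<union> (set zs \<inter> L)"
    using ys(5) common_nbhd_disjoint[of L] by auto
  then have "card (set (ys @ zs) \<inter> L) \<le> half i - m - 1 + card (set zs \<inter> L)"
    using card_Un_le[of "set ys \<inter> ?S" "set zs \<inter> L"] ys(6) by simp
  ultimately show False using few zs(4) by linarith
qed

lemma no_path3_in_common_nbhd:
  assumes L: "L \<subseteq> V" "card L = \<kappa>" "\<sigma> \<le> card (common_nbhd L)"
    and pqr: "p \<in> common_nbhd L" "q \<in> common_nbhd L" "r \<in> common_nbhd L" "p \<noteq> r"
    and arcs: "(p, q) \<in> parcs G" "(q, r) \<in> parcs G"
  shows False
proof -
  obtain c where c: "c \<in> L" using L(2) \<kappa>_ge_2 by fastforce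
  obtain i where i: "i \<in> I" "3 \<le> half i" using long_branch by blast
  have notin_L: "p \<notin> L" "q \<notin> L" using pqr common_nbhd_disjoint[of L] by auto
  show False
  proof (rule no_path_saving_hub[OF L i(1) c, of "[q, r]" p 1])
    show "vpath [p, q, r] (with_proj G)"
      using pqr arcs common_nbhd_subset[of L] by (auto simp: vpath_iff)
    show "c \<notin> set [q, r]" using c pqr common_nbhd_disjoint[of L] by auto
    have "set [q, r] \<inter> L = {}" using pqr common_nbhd_disjoint[of L] by auto
    then show "card (set [q, r] \<inter> L) < 1" by (simp only: card.empty zero_less_one)
  qed (use i pqr in auto)
qed

lemma no_disjoint_edges_in_common_nbhd:
  assumes L: "L \<subseteq> V" "card L = \<kappa>" "\<sigma> \<le> card (common_nbhd L)"
    and pq: "{p, p', q, q'} \<subseteq> common_nbhd L" "distinct [p, p', q, q']"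
    and arcs: "(p, p') \<in> parcs G" "(q, q') \<in> parcs G"
  shows False
proof -
  obtain i where i: "i \<in> I" "3 \<le> half i" using long_branch by blast
  obtain c where c: "c \<in> L" using L(2) \<kappa>_ge_2 by fastforce
  have "L - {c} \<noteq> {}"
    using L(2) \<kappa>_ge_2 card_Diff_singleton[OF c] by fastforce
  then obtain h where h: "h \<in> L" "h \<noteq> c" by blast
  have adj: "(h, u) \<in> parcs G" "(u, h) \<in> parcs G" if "u \<in> common_nbhd L" for u
    using that h(1) arcs_symmetric by (auto simp: common_nbhd_def)
  have notin_L: "p \<notin> L" "p' \<notin> L" "q \<notin> L" "q' \<notin> L"
    using pq(1) common_nbhd_disjoint[of L] by auto
  show False
  proof (rule no_path_saving_hub[OF L i(1) c, of "[p', h, q, q']" p 2])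
    show "vpath [p, p', h, q, q'] (with_proj G)"
      using pq arcs adj h(1) notin_L L(1) common_nbhd_subset[of L] by (auto simp: vpath_iff)
    show "c \<notin> set [p', h, q, q']" using c h(2) notin_L by auto
    have "set [p', h, q, q'] \<inter> L = {h}" using h(1) notin_L by auto
    then show "card (set [p', h, q, q'] \<inter> L) < 2" by (simp only:) simp
  qed (use i pq in auto)
qed

lemma common_nbhd_edge_unique:
  assumes L: "L \<subseteq> V" "card L = \<kappa>" "\<sigma> \<le> card (common_nbhd L)"
  obtains r s where "r \<in> common_nbhd L" "s \<in> common_nbhd L" "r \<noteq> s"
    "\<And>u v. u \<in> common_nbhd L \<Longrightarrow> v \<in> common_nbhd L \<Longrightarrow> (u, v) \<in> parcs G \<Longrightarrow> {u, v} = {r, s}"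
proof (cases "\<exists>r\<in>common_nbhd L. \<exists>s\<in>common_nbhd L. (r, s) \<in> parcs G")
  case True
  then obtain r s where rs: "r \<in> common_nbhd L" "s \<in> common_nbhd L" "(r, s) \<in> parcs G" by blast
  have "{u, v} = {r, s}"
    if uv: "u \<in> common_nbhd L" "v \<in> common_nbhd L" "(u, v) \<in> parcs G" for u v
  proof (rule ccontr)
    assume ne: "{u, v} \<noteq> {r, s}"
    have sym: "(v, u) \<in> parcs G" "(s, r) \<in> parcs G" using uv(3) rs(3) arcs_symmetric by auto
    note no_path3 = no_path3_in_common_nbhd[OF L]
    have "u \<noteq> r" using no_path3[of v u s] ne uv rs sym by auto
    moreover have "u \<noteq> s" using no_path3[of v u r] ne uv rs sym by auto
    moreover have "v \<noteq> r" using no_path3[of u v s] ne uv rs sym by auto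
    moreover have "v \<noteq> s" using no_path3[of u v r] ne uv rs sym by auto
    ultimately have "distinct [u, v, r, s]" using uv(3) rs(3) by auto
    then show False
      using no_disjoint_edges_in_common_nbhd[OF L _ _ uv(3) rs(3)] uv rs by auto
  qed
  moreover have "r \<noteq> s" using rs(3) by auto
  ultimately show thesis using that[OF rs(1,2)] by blast
next
  case False
  obtain i where "i \<in> I" using long_branch by blast
  then have "2 \<le> card (common_nbhd L)" using half_ge_2[of i] half_le_\<sigma>[of i] L(3) by simp
  then obtain S where "S \<subseteq> common_nbhd L" "card S = 2" by (meson obtain_subset_with_card_n)
  then obtain r s where "r \<in> common_nbhd L" "s \<in> common_nbhd L" "r \<noteq> s" by (auto simp: card_2_iff)
  then show thesis by (rule that) (use False in blast)
qed

end

section \<open>Second neighbourhoods in graphs without a cycle of given even length\<close>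

text \<open>
  Each \<open>x \<in> X\<close> is coloured by a neighbour \<open>\<phi> x\<close> that it shares with \<open>w\<close>. A path of length \<open>2k - 4\<close>
  in \<open>X \<union> Z\<close> with ends of different colours closes through \<open>w\<close> to a cycle of length \<open>2k\<close>. Hence two
  neighbours of a vertex \<open>y\<close> have the same colour, namely that of the end of a path that starts
  with \<open>y\<close> and a third neighbour. So all vertices of an alternating path in the core have one colour,
  and such a path closes through this colour.
\<close>

locale coloured_core = pair_graph G
  for G :: "'a pair_pre_digraph" +
  fixes k :: nat and w :: 'a and X Z :: "'a set" and \<phi> :: "'a \<Rightarrow> 'a"
  assumes k_ge_3: "3 \<le> k"
    and no_cycle: "\<not> branch c True k xs"
    and core_subset: "X \<union> Z \<subseteq> V - insert w (nbhd w)"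
    and colour: "x \<in> X \<Longrightarrow> \<phi> x \<in> nbhd w" "x \<in> X \<Longrightarrow> (\<phi> x, x) \<in> parcs G"
    and degree_X: "x \<in> X \<Longrightarrow> 2 * k + 3 \<le> card (nbhd x \<inter> Z)"
    and degree_Z: "z \<in> Z \<Longrightarrow> 2 * k + 3 \<le> card (nbhd z \<inter> X)"
begin

lemma colour_eq_if_path:
  assumes zs: "vpath zs (with_proj G)" "length zs = 2 * (k - 2) - 1" "hd zs \<in> X" "set zs \<subseteq> X \<union> Z"
    and y: "y \<in> Z" "y \<notin> set zs" "(last zs, y) \<in> parcs G"
    and x: "x \<in> X" "x \<notin> set zs" "(y, x) \<in> parcs G"
  shows "\<phi> (hd zs) = \<phi> x"
proof (rule ccontr)
  assume "\<phi> (hd zs) \<noteq> \<phi> x"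
  let ?a = "\<phi> (hd zs)" and ?b = "\<phi> x"
  have ends: "?a \<in> nbhd w" "(?a, hd zs) \<in> parcs G" "?b \<in> nbhd w" "(x, ?b) \<in> parcs G"
    using colour zs(3) x(1) arcs_symmetric by auto
  have "zs \<noteq> []" using zs(1) by (simp add: vpath_iff)
  have outside: "set (zs @ [y, x]) \<subseteq> V - insert w (nbhd w)"
    using core_subset zs(4) y(1) x(1) by auto
  have "vpath [y, x, ?b] (with_proj G)"
    using outside ends x(3) in_arcsD2[OF ends(4)] by (auto simp: vpath_iff)
  then have "vpath (zs @ [y, x, ?b]) (with_proj G)"
    using \<open>zs \<noteq> []\<close> zs(1) y x outside ends(3) by (auto simp: vpath_append_iff)
  moreover have "?a \<notin> set (zs @ [y, x, ?b])"
    using outside ends(1) \<open>?a \<noteq> ?b\<close> by auto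
  ultimately have "vpath (?a # zs @ [y, x, ?b]) (with_proj G)"
    using \<open>zs \<noteq> []\<close> ends(2) by (simp add: vpath_Cons_iff)
  moreover have "w \<notin> set (?a # zs @ [y, x, ?b])"
    using outside ends(1,3) not_in_nbhd_self[of w] by (auto simp del: mem_nbhd_iff)
  moreover have "length (?a # zs @ [y, x, ?b]) = 2 * k - 1"
    using zs(2) k_ge_3 by simp
  ultimately have "branch w True k (?a # zs @ [y, x, ?b])"
    using ends(1,3) by (intro branchI) (auto intro: arcs_symmetric)
  then show False using no_cycle by blast
qed

lemma colour_eq_if_common_neighbour:
  assumes y: "y \<in> Z" and x: "x\<^sub>1 \<in> X" "x\<^sub>2 \<in> X" "(y, x\<^sub>1) \<in> parcs G" "(y, x\<^sub>2) \<in> parcs G"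
  shows "\<phi> x\<^sub>1 = \<phi> x\<^sub>2"
proof -
  let ?F = "{x\<^sub>1, x\<^sub>2, y}"
  have "card ?F \<le> 3" by (simp add: card_insert_if)
  then have large: "2 * k \<le> card (D - ?F)" if "2 * k + 3 \<le> card D" for D
    using diff_card_le_card_Diff[of ?F D] that by simp
  have "nbhd y \<inter> X - ?F \<noteq> {}" using large[OF degree_Z[OF y]] k_ge_3 by force
  then obtain x\<^sub>3 where "x\<^sub>3 \<in> nbhd y \<inter> X - ?F" by blast
  then have x\<^sub>3: "x\<^sub>3 \<in> X - ?F" "(y, x\<^sub>3) \<in> parcs G" by auto
  obtain zs where "alternating_vpath (X - ?F) (Z - ?F) x\<^sub>3 (k - 2) zs"
  proof (rule alternating_vpath_exists[of "X - ?F" x\<^sub>3 "k - 2" "Z - ?F"])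
    show "X - ?F \<subseteq> V" using core_subset by auto
    show "(if (X - ?F) \<inter> (Z - ?F) = {} then k - 2 - 1 else 2 * (k - 2)) \<le> card (nbhd a \<inter> (Z - ?F))"
      if "a \<in> X - ?F" for a
      using large[OF degree_X[of a]] that by (auto simp: Int_Diff)
    show "(if (X - ?F) \<inter> (Z - ?F) = {} then k - 2 else 2 * (k - 2)) \<le> card (nbhd b \<inter> (X - ?F))"
      if "b \<in> Z - ?F" for b
      using large[OF degree_Z[of b]] that by (auto simp: Int_Diff)
  qed (use x\<^sub>3(1) k_ge_3 in auto)
  then have zs: "vpath zs (with_proj G)" "length zs = 2 * (k - 2) - 1" "hd zs \<in> X - ?F"
      "last zs = x\<^sub>3" "set zs \<subseteq> (X - ?F) \<union> (Z - ?F)"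
    by (simp_all only: alternating_vpath_def)
  have "\<phi> (hd zs) = \<phi> x" if "x \<in> {x\<^sub>1, x\<^sub>2}" for x
    by (rule colour_eq_if_path[OF zs(1,2) _ _ y])
      (use that zs(3-5) x arcs_symmetric[OF x\<^sub>3(2)] in auto)
  from this[of x\<^sub>1] this[of x\<^sub>2] show ?thesis by simp
qed

lemma core_empty: "X = {}"
proof (rule ccontr)
  assume "X \<noteq> {}"
  then obtain x\<^sub>0 where x\<^sub>0: "x\<^sub>0 \<in> X" by blast
  let ?A = "{x \<in> X. \<phi> x = \<phi> x\<^sub>0}"
  let ?B = "{z \<in> Z. \<exists>x\<in>?A. (x, z) \<in> parcs G}"
  obtain zs where "alternating_vpath ?A ?B x\<^sub>0 k zs"
  proof (rule alternating_vpath_exists[of ?A x\<^sub>0 k ?B])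
    show "?A \<subseteq> V" using core_subset by auto
    show "(if ?A \<inter> ?B = {} then k - 1 else 2 * k) \<le> card (nbhd a \<inter> ?B)" if "a \<in> ?A" for a
    proof -
      have "nbhd a \<inter> ?B = nbhd a \<inter> Z" using that by auto
      then show ?thesis using degree_X[of a] that by auto
    qed
    show "(if ?A \<inter> ?B = {} then k else 2 * k) \<le> card (nbhd b \<inter> ?A)" if b: "b \<in> ?B" for b
    proof -
      obtain x where "x \<in> ?A" "(b, x) \<in> parcs G" using b arcs_symmetric by blast
      then have "nbhd b \<inter> ?A = nbhd b \<inter> X"
        using colour_eq_if_common_neighbour[of b _ x] b by auto
      then show ?thesis using degree_Z[of b] b by auto
    qed
  qed (use x\<^sub>0 k_ge_3 in auto)
  then have zs: "vpath zs (with_proj G)" "length zs = 2 * k - 1" "hd zs \<in> ?A" "last zs = x\<^sub>0"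
      "set zs \<subseteq> ?A \<union> ?B"
    by (simp_all only: alternating_vpath_def)
  have "\<phi> x\<^sub>0 \<notin> set zs" using zs(5) colour(1)[OF x\<^sub>0] core_subset by blast
  moreover have "(\<phi> x\<^sub>0, hd zs) \<in> parcs G" "(last zs, \<phi> x\<^sub>0) \<in> parcs G"
    using colour(2)[of "hd zs"] colour(2)[OF x\<^sub>0] zs(3,4) arcs_symmetric by auto
  ultimately have "branch (\<phi> x\<^sub>0) True k zs" using zs(1,2) by (intro branchI)
  then show False using no_cycle by blast
qed

end

context pair_graph
begin

definition second_nbhd :: "'a \<Rightarrow> 'a set" where
  "second_nbhd w = {u \<in> V - insert w (nbhd w). nbhd u \<inter> nbhd w \<noteq> {}}"

lemma second_nbhd_subset: "second_nbhd w \<subseteq> V - insert w (nbhd w)"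
  by (auto simp: second_nbhd_def)

lemma edge_count_second_nbhd_le:
  assumes no_cycle: "\<And>c xs. \<not> branch c True k xs" and "3 \<le> k"
  shows "edge_count (second_nbhd w) (V - insert w (nbhd w))
    \<le> (2 * k + 3) * (card (second_nbhd w) + card (V - insert w (nbhd w)))"
proof (rule ccontr)
  let ?N = "second_nbhd w" and ?Y = "V - insert w (nbhd w)"
  assume "\<not> edge_count ?N ?Y \<le> (2 * k + 3) * (card ?N + card ?Y)"
  then have "(2 * k + 3) * card ?N + (2 * k + 3) * card ?Y < card (parcs G \<inter> ?N \<times> ?Y)"
    by (simp add: edge_count_def algebra_simps)
  moreover have "finite ?N" "finite ?Y"
    using second_nbhd_subset by (auto intro: finite_if_subset_V)
  ultimately obtain X Z where core: "X \<subseteq> ?N" "Z \<subseteq> ?Y" "X \<noteq> {}"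
      "\<And>x. x \<in> X \<Longrightarrow> 2 * k + 3 < card (nbhd x \<inter> Z)" "\<And>z. z \<in> Z \<Longrightarrow> 2 * k + 3 < card (nbhd z \<inter> X)"
    using dense_core[of ?N ?Y "2 * k + 3" "2 * k + 3" "parcs G"] unfolding converse_parcs nbhd_def
    by blast
  have "\<forall>x\<in>X. \<exists>a. a \<in> nbhd w \<and> (a, x) \<in> parcs G"
    using core(1) arcs_symmetric by (fastforce simp: second_nbhd_def)
  then obtain \<phi> where \<phi>: "\<And>x. x \<in> X \<Longrightarrow> \<phi> x \<in> nbhd w" "\<And>x. x \<in> X \<Longrightarrow> (\<phi> x, x) \<in> parcs G"
    by metis
  interpret coloured_core G k w X Z \<phi>
  proof
    show "X \<union> Z \<subseteq> ?Y" using core(1,2) second_nbhd_subset by blast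
    show "2 * k + 3 \<le> card (nbhd x \<inter> Z)" if "x \<in> X" for x using core(4)[OF that] by simp
    show "2 * k + 3 \<le> card (nbhd z \<inter> X)" if "z \<in> Z" for z using core(5)[OF that] by simp
  qed (use assms \<phi> in auto)
  show False using core_empty core(3) by contradiction
qed

end

lemma (in fan_free) sum_degree_second_nbhd_le:
  assumes I: "I = {i}" "3 \<le> half i"
  shows "(\<Sum>u\<in>second_nbhd w. card (nbhd u)) \<le> 8 * edge_const * card V"
proof -
  let ?N = "second_nbhd w" and ?Y = "V - insert w (nbhd w)"
  have "i \<in> I" using I(1) by blast
  have NV: "?N \<subseteq> V" using second_nbhd_subset by blast
  have card_le: "card ?N \<le> card V" "card ?Y \<le> card V" "card (nbhd w) \<le> card V"
    using NV nbhd_subset by (auto intro: card_mono[OF pair_finite_verts])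
  have "nbhd u \<inter> (?Y \<union> nbhd w) = nbhd u" if "u \<in> ?N" for u
    using that nbhd_subset[of u] arcs_symmetric[of u w] by (auto simp: second_nbhd_def)
  then have "(\<Sum>u\<in>?N. card (nbhd u)) = edge_count ?N (?Y \<union> nbhd w)"
    by (simp add: edge_count_eq_sum finite_if_subset_V[OF NV])
  also have "\<dots> \<le> edge_count ?N ?Y + edge_count ?N (nbhd w)" by (rule edge_count_Un_right_le)
  also have "edge_count ?N ?Y \<le> (2 * half i + 3) * (card ?N + card ?Y)"
  proof (rule edge_count_second_nbhd_le[OF _ I(2)])
    show "\<not> branch c True (half i) xs" for c xs
      using no_fan[of c "\<lambda>_. xs"] single_cyclic[OF I(1)] I(1)
      by (simp add: fan_def disjoint_family_on_def)
  qed
  also have "\<dots> \<le> (3 * edge_const) * (card V + card V)"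
  proof -
    have "2 * half i + 3 \<le> 3 * edge_const"
      using half_le_\<sigma>[OF \<open>i \<in> I\<close>] by (simp add: edge_const_def)
    then show ?thesis using card_le by (intro mult_le_mono add_mono)
  qed
  also have "edge_count ?N (nbhd w) \<le> edge_const * (card (nbhd w) + card ?N)"
    unfolding edge_count_commute[of ?N] by (rule edge_count_nbhd_le[OF order_refl NV])
  also have "\<dots> \<le> edge_const * (card V + card V)"
    using card_le by (intro mult_le_mono2 add_mono)
  finally show ?thesis by (simp add: algebra_simps)
qed

section \<open>Embedding the fan graph\<close>

lemma digraph_iso_image:
  fixes F :: "'a pair_pre_digraph" and f :: "'a \<Rightarrow> 'b"
  assumes "pair_graph F" "inj_on f (pverts F)"
  shows "digraph_iso (with_proj F) (with_proj \<lparr>pverts = f ` pverts F, parcs = map_prod f f ` parcs F\<rparr>)"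
proof -
  interpret pair_graph F by fact
  let ?hom = "\<lparr>iso_verts = f, iso_arcs = map_prod f f, iso_head = snd, iso_tail = fst\<rparr>"
  have "parcs F \<subseteq> pverts F \<times> pverts F" using in_arcsD1 in_arcsD2 by auto
  then have "inj_on (map_prod f f) (parcs F)"
    using map_prod_inj_on[OF assms(2,2)] inj_on_subset by blast
  then have "digraph_isomorphism ?hom"
    using assms(2) wf_digraph_axioms by (auto simp: digraph_isomorphism_def)
  moreover have "with_proj \<lparr>pverts = f ` pverts F, parcs = map_prod f f ` parcs F\<rparr>
     = app_iso ?hom (with_proj F)"
    by (simp add: app_iso_def with_proj_def)
  ultimately show ?thesis unfolding digraph_iso_def by blast
qed

lemma contains_subgraph_if_inj:
  assumes G: "pair_graph G" and F: "pair_graph F" and inj: "inj_on f (pverts F)"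
    and verts: "f ` pverts F \<subseteq> pverts G" and arcs: "\<And>u v. (u, v) \<in> parcs F \<Longrightarrow> (f u, f v) \<in> parcs G"
  shows "contains_subgraph G F"
proof -
  interpret G: pair_graph G by fact
  interpret F: pair_graph F by fact
  let ?H = "\<lparr>pverts = f ` pverts F, parcs = map_prod f f ` parcs F\<rparr>"
  have "digraph_iso (with_proj ?H) (with_proj F)"
    by (rule digraph_iso_swap[OF F.wf_digraph_axioms digraph_iso_image[OF F inj]])
  moreover have "wf_digraph (with_proj ?H)"
    by unfold_locales (use F.in_arcsD1 F.in_arcsD2 in auto)
  then have "subgraph (with_proj ?H) (with_proj G)"
    unfolding subgraph_def compatible_def using verts arcs G.wf_digraph_axioms by auto
  ultimately show ?thesis unfolding contains_subgraph_def by blast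
qed

text \<open>The branches of \<open>CP_graph ks ps\<close> are indexed by the positions in \<open>ks @ ps\<close>.\<close>

definition branch_pos :: "nat list \<Rightarrow> nat \<Rightarrow> nat \<Rightarrow> cp_vertex" where
  "branch_pos ks i j = (if i < length ks then cycle_pos i j else path_pos (i - length ks) j)"

definition fan_embedding :: "nat list \<Rightarrow> 'a \<Rightarrow> (nat \<Rightarrow> 'a list) \<Rightarrow> cp_vertex \<Rightarrow> 'a" where
  "fan_embedding ks c xss v =
     (case v of
        Centre \<Rightarrow> c
      | Cycle_Vertex i j \<Rightarrow> (c # xss i) ! j
      | Path_Vertex i j \<Rightarrow> (c # xss (length ks + i)) ! j)"

lemma branch_pos_0 [simp]: "branch_pos ks i 0 = Centre"
  by (simp add: branch_pos_def cycle_pos_def path_pos_def)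

lemma fan_embedding_Centre [simp]: "fan_embedding ks c xss Centre = c"
  by (simp add: fan_embedding_def)

lemma fan_embedding_branch_pos [simp]: "fan_embedding ks c xss (branch_pos ks i j) = (c # xss i) ! j"
  by (simp add: fan_embedding_def branch_pos_def cycle_pos_def path_pos_def)

lemma pverts_CP_graph_cases:
  assumes "v \<in> pverts (CP_graph ks ps)" "ks @ ps \<noteq> []" "\<forall>k\<in>set (ks @ ps). 1 \<le> k"
  obtains i j where "i < length (ks @ ps)" "j < 2 * (ks @ ps) ! i" "v = branch_pos ks i j"
proof -
  consider (centre) "v = Centre"
    | (cycle) i j where "v = cycle_pos i j" "i < length ks" "j < 2 * ks ! i"
    | (path) i j where "v = path_pos i j" "i < length ps" "j < 2 * ps ! i"
    using assms(1) by (auto simp: CP_graph_def)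
  then show thesis
  proof cases
    case centre
    have "1 \<le> (ks @ ps) ! 0" using assms(2,3) nth_mem by blast
    then show thesis using centre assms(2) by (intro that[of 0 0]) auto
  next
    case (cycle i j)
    then show thesis by (intro that[of i j]) (simp_all add: branch_pos_def nth_append)
  next
    case (path i j)
    then show thesis by (intro that[of "length ks + i" j]) (simp_all add: branch_pos_def)
  qed
qed

lemma CP_oriented_arcs_cases:
  assumes "(u, v) \<in> CP_oriented_arcs ks ps"
  obtains (step) i j where "i < length (ks @ ps)" "Suc j < 2 * (ks @ ps) ! i"
      "u = branch_pos ks i j" "v = branch_pos ks i (Suc j)"
  | (closing) i where "i < length ks" "0 < ks ! i" "u = branch_pos ks i (2 * ks ! i - 1)" "v = Centre"
proof -
  consider (cycle) i j where "i < length ks" "j < 2 * ks ! i" "u = cycle_pos i j"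
      "v = cycle_pos i (Suc j mod (2 * ks ! i))"
    | (path) i j where "i < length ps" "Suc j < 2 * ps ! i" "u = path_pos i j" "v = path_pos i (Suc j)"
    using assms unfolding CP_oriented_arcs_def by blast
  then show thesis
  proof cases
    case cycle
    show thesis
    proof (cases "Suc j = 2 * ks ! i")
      case True
      then have "j = 2 * ks ! i - 1" "0 < ks ! i" "v = Centre"
        using cycle by (auto simp: cycle_pos_def)
      then show thesis using closing[of i] cycle by (simp add: branch_pos_def)
    next
      case False
      then show thesis using step[of i j] cycle by (simp add: branch_pos_def nth_append)
    qed
  next
    case path
    then show thesis by (intro step[of "length ks + i" j]) (simp_all add: branch_pos_def)
  qed
qed

context pair_graph
begin

lemma length_Cons_branch: "branch c cyc k xs \<Longrightarrow> 1 \<le> k \<Longrightarrow> length (c # xs) = 2 * k"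
  by (simp add: branch_def)

lemma branch_nth_arc:
  assumes "branch c cyc k xs" "Suc j < 2 * k"
  shows "((c # xs) ! j, (c # xs) ! Suc j) \<in> parcs G"
proof -
  have "successively (\<lambda>u v. (u, v) \<in> parcs G) (c # xs)"
    using assms(1) by (simp add: branch_def vpath_iff)
  then show ?thesis
    by (rule successively_nth) (use assms length_Cons_branch[OF assms(1)] in simp)
qed

lemma branch_closing_arc:
  assumes "branch c True k xs" "1 \<le> k"
  shows "((c # xs) ! (2 * k - 1), c) \<in> parcs G"
proof -
  have "xs \<noteq> []" using assms by (auto simp: branch_def)
  then have "last xs = (c # xs) ! (length (c # xs) - 1)"
    by (metis last_ConsR last_conv_nth list.distinct(1))
  then have "last xs = (c # xs) ! (2 * k - 1)"
    by (simp only: length_Cons_branch[OF assms])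
  then show ?thesis using assms(1) by (simp add: branch_def)
qed

lemma branch_nth_in_V:
  assumes "branch c cyc k xs" "j < 2 * k"
  shows "(c # xs) ! j \<in> V"
proof -
  have "set (c # xs) \<subseteq> V" using assms(1) by (simp add: branch_def vpath_iff)
  then show ?thesis
    using nth_mem[of j "c # xs"] length_Cons_branch[OF assms(1)] assms(2) by auto
qed

lemma fan_nth_eqD:
  assumes fan: "fan I half cyclic c xss" and i: "i \<in> I" "j < 2 * half i"
    and i': "i' \<in> I" "j' < 2 * half i'" and eq: "(c # xss i) ! j = (c # xss i') ! j'"
  shows "j = j' \<and> (j = 0 \<or> i = i')"
proof -
  have branch: "branch c (cyclic i) (half i) (xss i)" if "i \<in> I" for i
    using fan that by (simp add: fan_def)
  have mem: "(c # xss i) ! j \<in> set (xss i)" "(c # xss i) ! j \<noteq> c"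
    if "i \<in> I" "j < 2 * half i" "j \<noteq> 0" for i j
  proof -
    show "(c # xss i) ! j \<in> set (xss i)"
      using length_Cons_branch[OF branch[OF that(1)]] that by (cases j) auto
    then show "(c # xss i) ! j \<noteq> c" using centre_notin_branch[OF branch] that(1) by metis
  qed
  show ?thesis
  proof (cases "j = 0 \<or> j' = 0")
    case True
    then show ?thesis using mem(2) i i' eq by (metis nth_Cons_0)
  next
    case False
    then have "set (xss i) \<inter> set (xss i') \<noteq> {}" using mem(1)[OF i] mem(1)[OF i'] eq by auto
    then have "i = i'" using fan i i' by (auto simp: fan_def disjoint_family_on_def)
    moreover have "distinct (c # xss i)" using branch[OF i(1)] by (simp add: branch_def vpath_iff)
    ultimately show ?thesis
      using eq i i' length_Cons_branch[OF branch[OF i(1)]] by (simp add: nth_eq_iff_index_eq)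
  qed
qed

lemma inj_on_fan_embedding:
  assumes fan: "fan {..<length (ks @ ps)} (nth (ks @ ps)) cyclic c xss"
    and "ks @ ps \<noteq> []" "\<forall>k\<in>set (ks @ ps). 1 \<le> k"
  shows "inj_on (fan_embedding ks c xss) (pverts (CP_graph ks ps))"
proof (rule inj_onI)
  fix u v assume u: "u \<in> pverts (CP_graph ks ps)" and v: "v \<in> pverts (CP_graph ks ps)"
    and eq: "fan_embedding ks c xss u = fan_embedding ks c xss v"
  obtain i j where ij: "i < length (ks @ ps)" "j < 2 * (ks @ ps) ! i" "u = branch_pos ks i j"
    using pverts_CP_graph_cases[OF u assms(2,3)] .
  obtain i' j' where ij': "i' < length (ks @ ps)" "j' < 2 * (ks @ ps) ! i'" "v = branch_pos ks i' j'"
    using pverts_CP_graph_cases[OF v assms(2,3)] .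
  have "j = j' \<and> (j = 0 \<or> i = i')"
    by (rule fan_nth_eqD[OF fan]) (use ij ij' eq in auto)
  then show "u = v" using ij(3) ij'(3) by auto
qed

lemma fan_embedding_arc:
  assumes fan: "fan {..<length (ks @ ps)} (nth (ks @ ps)) (\<lambda>i. i < length ks) c xss"
    and uv: "(u, v) \<in> parcs (CP_graph ks ps)"
  shows "(fan_embedding ks c xss u, fan_embedding ks c xss v) \<in> parcs G"
proof -
  have branch: "branch c (i < length ks) ((ks @ ps) ! i) (xss i)" if "i < length (ks @ ps)" for i
    using fan that by (simp add: fan_def)
  have oriented: "(fan_embedding ks c xss u, fan_embedding ks c xss v) \<in> parcs G"
    if "(u, v) \<in> CP_oriented_arcs ks ps" for u v
    using that
  proof (cases rule: CP_oriented_arcs_cases)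
    case (step i j)
    then show ?thesis using branch_nth_arc[OF branch] by simp
  next
    case (closing i)
    then have "branch c True (ks ! i) (xss i)" using branch[of i] by (simp add: nth_append)
    then show ?thesis using branch_closing_arc[of c "ks ! i"] closing by simp
  qed
  have "(u, v) \<in> CP_oriented_arcs ks ps \<or> (v, u) \<in> CP_oriented_arcs ks ps"
    using uv by (auto simp: CP_graph_def)
  then show ?thesis using oriented arcs_symmetric by blast
qed

lemma contains_CP_graph_if_fan:
  assumes fan: "fan {..<length (ks @ ps)} (nth (ks @ ps)) (\<lambda>i. i < length ks) c xss"
    and ge_2: "\<forall>k\<in>set ks. 2 \<le> k" "\<forall>p\<in>set ps. 2 \<le> p" and nonempty: "ks @ ps \<noteq> []"
  shows "contains_subgraph G (CP_graph ks ps)"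
proof (rule contains_subgraph_if_inj[OF pair_graph pair_graph_CP_graph[OF ge_2]])
  have ge_1: "\<forall>k\<in>set (ks @ ps). 1 \<le> k" using ge_2 by force
  show "inj_on (fan_embedding ks c xss) (pverts (CP_graph ks ps))"
    by (rule inj_on_fan_embedding[OF fan nonempty ge_1])
  show "(fan_embedding ks c xss u, fan_embedding ks c xss v) \<in> parcs G"
    if "(u, v) \<in> parcs (CP_graph ks ps)" for u v
    by (rule fan_embedding_arc[OF fan that])
  have "fan_embedding ks c xss v \<in> V" if v: "v \<in> pverts (CP_graph ks ps)" for v
  proof -
    obtain i j where ij: "i < length (ks @ ps)" "j < 2 * (ks @ ps) ! i" "v = branch_pos ks i j"
      using pverts_CP_graph_cases[OF v nonempty ge_1] .
    then have "branch c (i < length ks) ((ks @ ps) ! i) (xss i)" using fan by (simp add: fan_def)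
    then show ?thesis using branch_nth_in_V ij(2,3) by simp
  qed
  then show "fan_embedding ks c xss ` pverts (CP_graph ks ps) \<subseteq> V" by blast
qed

end

section \<open>The spectral radius and eigenfunctions\<close>

context pair_graph
begin

definition eigenfunction :: "'b :: comm_ring_1 \<Rightarrow> ('a \<Rightarrow> 'b) \<Rightarrow> bool" where
  "eigenfunction \<theta> h \<longleftrightarrow> (\<exists>v\<in>V. h v \<noteq> 0) \<and> (\<forall>v\<in>V. sum h (nbhd v) = \<theta> * h v)"

lemma adjacency_matrix_mult_vec:
  assumes vs: "distinct vs" "set vs = V" and i: "i < length vs"
  shows "(adjacency_matrix G vs *\<^sub>v vec (length vs) (\<lambda>i. h (vs ! i))) $ i = sum h (nbhd (vs ! i))"
proof -
  let ?a = "\<lambda>u. if (vs ! i, u) \<in> parcs G then h u else 0"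
  have "(adjacency_matrix G vs *\<^sub>v vec (length vs) (\<lambda>i. h (vs ! i))) $ i
      = (\<Sum>j\<in>{0..<length vs}. ?a (vs ! j))"
    using i by (auto simp: adjacency_matrix_def scalar_prod_def intro!: sum.cong)
  also have "\<dots> = sum ?a V"
    by (rule sum.reindex_bij_betw)
      (use bij_betw_nth[OF vs(1) _ vs(2)[symmetric]] in \<open>simp add: lessThan_atLeast0\<close>)
  also have "\<dots> = sum h {u \<in> V. (vs ! i, u) \<in> parcs G}"
    by (rule sum.inter_filter[symmetric]) (rule pair_finite_verts)
  also have "{u \<in> V. (vs ! i, u) \<in> parcs G} = nbhd (vs ! i)" using in_arcsD2 by auto
  finally show ?thesis .
qed

lemma vec_eq_vec_of_nth:
  assumes "distinct vs" "w \<in> carrier_vec (length vs)"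
  obtains h where "w = vec (length vs) (\<lambda>i. h (vs ! i))"
proof
  have inj: "inj_on (nth vs) {..<length vs}" using assms(1) by (simp add: inj_on_nth)
  show "w = vec (length vs) (\<lambda>i. (\<lambda>v. w $ the_inv_into {..<length vs} (nth vs) v) (vs ! i))"
    by (rule eq_vecI) (use assms(2) the_inv_into_f_f[OF inj] in auto)
qed

lemma eigenvalue_adjacency_matrix_iff:
  assumes vs: "distinct vs" "set vs = V"
  shows "eigenvalue (adjacency_matrix G vs) \<theta> \<longleftrightarrow> (\<exists>h. eigenfunction \<theta> h)"
proof -
  let ?n = "length vs" and ?A = "adjacency_matrix G vs"
  have all_V: "(\<forall>v\<in>V. P v) \<longleftrightarrow> (\<forall>i<?n. P (vs ! i))" for P
    using vs(2) by (metis in_set_conv_nth)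
  have "vec ?n (\<lambda>i. h (vs ! i)) = 0\<^sub>v ?n \<longleftrightarrow> (\<forall>v\<in>V. h v = 0)" for h :: "'a \<Rightarrow> complex"
    unfolding all_V by (auto simp: vec_eq_iff)
  moreover have "?A *\<^sub>v vec ?n (\<lambda>i. h (vs ! i)) = \<theta> \<cdot>\<^sub>v vec ?n (\<lambda>i. h (vs ! i))
      \<longleftrightarrow> (\<forall>v\<in>V. sum h (nbhd v) = \<theta> * h v)" for h
    unfolding all_V vec_eq_iff using adjacency_matrix_mult_vec[OF vs]
    by (auto simp: adjacency_matrix_def)
  ultimately have "eigenvector ?A (vec ?n (\<lambda>i. h (vs ! i))) \<theta> \<longleftrightarrow> eigenfunction \<theta> h" for h
    by (simp add: eigenvector_def eigenfunction_def adjacency_matrix_def)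
  moreover have "eigenvector ?A w \<theta> \<Longrightarrow> \<exists>h. w = vec ?n (\<lambda>i. h (vs ! i))" for w
    using vec_eq_vec_of_nth[OF vs(1), of w] by (auto simp: eigenvector_def adjacency_matrix_def)
  ultimately show ?thesis unfolding eigenvalue_def by metis
qed

lemma adj_spectral_radius_attained:
  assumes "V \<noteq> {}"
  obtains \<theta> h where "eigenfunction \<theta> h" "cmod \<theta> = adj_spectral_radius G"
proof -
  obtain vs where vs: "distinct vs" "set vs = V"
    using finite_distinct_list[OF pair_finite_verts] by blast
  let ?A = "adjacency_matrix G vs"
  have "?A \<in> carrier_mat (length vs) (length vs)" "0 < length vs"
    using assms vs(2) by (auto simp: adjacency_matrix_def)
  then have "spectral_radius ?A \<in> cmod ` spectrum ?A" by (rule spectral_radius_mem_max(1))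
  then show thesis
    using that eigenvalue_adjacency_matrix_iff[OF vs]
    unfolding adj_spectral_radius_eq[OF vs] spectrum_def by auto
qed

lemma cmod_eigenvalue_le_adj_spectral_radius:
  assumes "eigenfunction \<theta> h"
  shows "cmod \<theta> \<le> adj_spectral_radius G"
proof -
  obtain vs where vs: "distinct vs" "set vs = V"
    using finite_distinct_list[OF pair_finite_verts] by blast
  let ?A = "adjacency_matrix G vs"
  have A: "?A \<in> carrier_mat (length vs) (length vs)" "0 < length vs"
    using assms vs(2) by (auto simp: adjacency_matrix_def eigenfunction_def)
  have "\<theta> \<in> spectrum ?A"
    using assms eigenvalue_adjacency_matrix_iff[OF vs] by (auto simp: spectrum_def)
  then show ?thesis
    unfolding adj_spectral_radius_eq[OF vs] by (intro spectral_radius_mem_max(2)[OF A] imageI)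
qed

lemma real_eigenvalue_le_adj_spectral_radius:
  fixes \<mu> :: real and y :: "'a \<Rightarrow> real"
  assumes "eigenfunction \<mu> y"
  shows "\<mu> \<le> adj_spectral_radius G"
proof -
  have "eigenfunction (complex_of_real \<mu>) (\<lambda>v. complex_of_real (y v))"
    using assms by (simp add: eigenfunction_def flip: of_real_sum)
  then have "cmod (complex_of_real \<mu>) \<le> adj_spectral_radius G"
    by (rule cmod_eigenvalue_le_adj_spectral_radius)
  then show ?thesis by simp
qed

lemma adj_spectral_radius_subinvariant:
  assumes "V \<noteq> {}"
  obtains x :: "'a \<Rightarrow> real" and z where "\<And>v. v \<in> V \<Longrightarrow> 0 \<le> x v" "\<And>v. v \<in> V \<Longrightarrow> x v \<le> 1"
    "z \<in> V" "x z = 1" "\<And>v. v \<in> V \<Longrightarrow> adj_spectral_radius G * x v \<le> sum x (nbhd v)"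
proof -
  obtain \<theta> :: complex and h where h: "eigenfunction \<theta> h" "cmod \<theta> = adj_spectral_radius G"
    using adj_spectral_radius_attained[OF assms] .
  define m where "m = Max ((\<lambda>v. cmod (h v)) ` V)"
  have le_m: "cmod (h v) \<le> m" if "v \<in> V" for v
    unfolding m_def using that pair_finite_verts by (intro Max_ge) auto
  have "m \<in> (\<lambda>v. cmod (h v)) ` V"
    unfolding m_def using assms pair_finite_verts by (intro Max_in) auto
  then obtain z where z: "z \<in> V" "cmod (h z) = m" by auto
  obtain v where "v \<in> V" "h v \<noteq> 0" using h(1) by (auto simp: eigenfunction_def)
  then have m: "0 < m" using le_m[of v] by (simp add: less_le_trans[of 0 "cmod (h v)" m])
  have subinvariant: "adj_spectral_radius G * cmod (h v) \<le> (\<Sum>u\<in>nbhd v. cmod (h u))" if "v \<in> V" for v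
  proof -
    have "adj_spectral_radius G * cmod (h v) = cmod (sum h (nbhd v))"
      using h that by (simp add: eigenfunction_def norm_mult)
    then show ?thesis using norm_sum[of h "nbhd v"] by simp
  qed
  show thesis
  proof (rule that[of "\<lambda>v. cmod (h v) / m" z])
    show "adj_spectral_radius G * (cmod (h v) / m) \<le> (\<Sum>u\<in>nbhd v. cmod (h u) / m)" if "v \<in> V" for v
      using subinvariant[OF that] m by (simp add: sum_divide_distrib[symmetric] divide_right_mono)
  qed (use z m le_m in auto)
qed

end

section \<open>The adjacency form and Rayleigh's inequality\<close>

context pair_graph
begin

definition adj_form :: "('a \<Rightarrow> real) \<Rightarrow> real" where
  "adj_form x = (\<Sum>(u, v)\<in>parcs G. x u * x v)"

lemma sum_arcs: "(\<Sum>(u, v)\<in>parcs G. f u v) = (\<Sum>u\<in>V. \<Sum>v\<in>nbhd u. f u v)"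
proof -
  have "parcs G \<inter> V \<times> UNIV = parcs G" using in_arcsD1 by auto
  then show ?thesis using sum_arcs_between[OF pair_finite_verts, of f UNIV] by simp
qed

lemma sum_arcs_commute: "(\<Sum>(u, v)\<in>parcs G. f u v) = (\<Sum>(u, v)\<in>parcs G. f v u)"
  using sum_arcs_swap[of _ UNIV UNIV] unfolding UNIV_Times_UNIV Int_UNIV_right .

lemma adj_form_eq_sum_nbhd: "adj_form x = (\<Sum>v\<in>V. x v * sum x (nbhd v))"
  by (simp add: adj_form_def sum_arcs sum_distrib_left)

lemma adj_form_diff:
  assumes "pair_graph H"
  shows "pair_graph.adj_form H x - adj_form x
    = (\<Sum>(u, v)\<in>parcs H - parcs G. x u * x v) - (\<Sum>(u, v)\<in>parcs G - parcs H. x u * x v)"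
proof -
  interpret H: pair_graph H by fact
  let ?f = "\<lambda>(u, v). x u * x v"
  have "sum ?f (parcs H) = sum ?f (parcs H \<inter> parcs G) + sum ?f (parcs H - parcs G)"
    by (rule sum.Int_Diff[OF H.pair_finite_arcs])
  moreover have "sum ?f (parcs G) = sum ?f (parcs H \<inter> parcs G) + sum ?f (parcs G - parcs H)"
    using sum.Int_Diff[OF pair_finite_arcs, of ?f "parcs H"] by (simp only: Int_commute)
  ultimately show ?thesis by (simp add: H.adj_form_def adj_form_def)
qed

lemma rayleigh_defect:
  fixes \<mu> :: real and x y :: "'a \<Rightarrow> real"
  assumes pos: "\<And>v. v \<in> V \<Longrightarrow> 0 < y v" and ev: "\<And>v. v \<in> V \<Longrightarrow> sum y (nbhd v) = \<mu> * y v"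
  shows "2 * (\<mu> * (\<Sum>v\<in>V. (x v)\<^sup>2) - adj_form x)
    = (\<Sum>(u, v)\<in>parcs G. (x u * y v - x v * y u)\<^sup>2 / (y u * y v))"
proof -
  have "(\<Sum>(u, v)\<in>parcs G. (x u)\<^sup>2 * y v / y u) = (\<Sum>u\<in>V. \<mu> * (x u)\<^sup>2)"
    unfolding sum_arcs
  proof (rule sum.cong[OF refl])
    fix u assume u: "u \<in> V"
    have "(\<Sum>v\<in>nbhd u. (x u)\<^sup>2 * y v / y u) = (x u)\<^sup>2 / y u * sum y (nbhd u)"
      by (simp add: sum_distrib_left)
    then show "(\<Sum>v\<in>nbhd u. (x u)\<^sup>2 * y v / y u) = \<mu> * (x u)\<^sup>2"
      using ev[OF u] pos[OF u] by simp
  qed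
  then have diag: "(\<Sum>(u, v)\<in>parcs G. (x u)\<^sup>2 * y v / y u) = \<mu> * (\<Sum>v\<in>V. (x v)\<^sup>2)"
    by (simp add: sum_distrib_left)
  have "(\<Sum>(u, v)\<in>parcs G. (x u * y v - x v * y u)\<^sup>2 / (y u * y v))
      = (\<Sum>(u, v)\<in>parcs G. (x u)\<^sup>2 * y v / y u + (x v)\<^sup>2 * y u / y v - 2 * (x u * x v))"
  proof (rule sum.cong[OF refl], safe)
    fix u v assume "(u, v) \<in> parcs G"
    then have "0 < y u" "0 < y v" using pos in_arcsD1 in_arcsD2 by auto
    then show "(x u * y v - x v * y u)\<^sup>2 / (y u * y v)
        = (x u)\<^sup>2 * y v / y u + (x v)\<^sup>2 * y u / y v - 2 * (x u * x v)"
      by (simp add: field_simps power2_eq_square)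
  qed
  also have "\<dots> = (\<Sum>(u, v)\<in>parcs G. (x u)\<^sup>2 * y v / y u) + (\<Sum>(u, v)\<in>parcs G. (x v)\<^sup>2 * y u / y v)
      - 2 * adj_form x"
    by (simp add: adj_form_def case_prod_unfold sum.distrib sum_subtractf sum_distrib_left)
  also have "(\<Sum>(u, v)\<in>parcs G. (x v)\<^sup>2 * y u / y v) = (\<Sum>(u, v)\<in>parcs G. (x u)\<^sup>2 * y v / y u)"
    by (rule sum_arcs_commute)
  finally show ?thesis using diag by simp
qed

lemma rayleigh_le:
  fixes \<mu> :: real and x y :: "'a \<Rightarrow> real"
  assumes pos: "\<And>v. v \<in> V \<Longrightarrow> 0 < y v" and ev: "\<And>v. v \<in> V \<Longrightarrow> sum y (nbhd v) = \<mu> * y v"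
  shows "adj_form x \<le> \<mu> * (\<Sum>v\<in>V. (x v)\<^sup>2)"
    and "adj_form x = \<mu> * (\<Sum>v\<in>V. (x v)\<^sup>2) \<Longrightarrow> (u, v) \<in> parcs G \<Longrightarrow> x u * y v = x v * y u"
proof -
  let ?defect = "\<lambda>(u, v). (x u * y v - x v * y u)\<^sup>2 / (y u * y v)"
  have pos_arc: "0 < y u" "0 < y v" if "(u, v) \<in> parcs G" for u v
    using that pos in_arcsD1 in_arcsD2 by auto
  then have nonneg: "\<And>e. e \<in> parcs G \<Longrightarrow> 0 \<le> ?defect e" by force
  show "adj_form x \<le> \<mu> * (\<Sum>v\<in>V. (x v)\<^sup>2)"
    using rayleigh_defect[OF assms, of x] sum_nonneg[of "parcs G" ?defect] nonneg by simp
  assume eq: "adj_form x = \<mu> * (\<Sum>v\<in>V. (x v)\<^sup>2)" and arc: "(u, v) \<in> parcs G"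
  have "sum ?defect (parcs G) = 0" using rayleigh_defect[OF assms, of x] eq by simp
  then have "\<forall>e\<in>parcs G. ?defect e = 0"
    using sum_nonneg_eq_0_iff[OF pair_finite_arcs, of ?defect] nonneg by blast
  then have "?defect (u, v) = 0" using arc by blast
  then show "x u * y v = x v * y u" using pos_arc[OF arc] by simp
qed

end

section \<open>The extremal graph\<close>

definition S_plus_on :: "'a set \<Rightarrow> 'a set \<Rightarrow> 'a \<Rightarrow> 'a \<Rightarrow> 'a pair_pre_digraph" where
  "S_plus_on W L r s =
     \<lparr> pverts = W,
       parcs = {(u, v). u \<in> W \<and> v \<in> W \<and> u \<noteq> v \<and> (u \<in> L \<or> v \<in> L \<or> {u, v} = {r, s})} \<rparr>"

definition S_plus_root :: "nat \<Rightarrow> nat \<Rightarrow> real \<Rightarrow> bool" where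
  "S_plus_root n k \<mu> \<longleftrightarrow>
     2 \<le> \<mu> \<and> \<mu> + 1 = k + 2 * (k / (\<mu> - 1)) + (real n - real k - 2) * (k / \<mu>)"

definition S_plus_vec :: "'a set \<Rightarrow> 'a \<Rightarrow> 'a \<Rightarrow> real \<Rightarrow> 'a \<Rightarrow> real" where
  "S_plus_vec L r s \<mu> v =
     (if v \<in> L then 1 else if v \<in> {r, s} then card L / (\<mu> - 1) else card L / \<mu>)"

lemma S_plus_on_simps [simp]:
  "pverts (S_plus_on W L r s) = W"
  "(u, v) \<in> parcs (S_plus_on W L r s) \<longleftrightarrow>
     u \<in> W \<and> v \<in> W \<and> u \<noteq> v \<and> (u \<in> L \<or> v \<in> L \<or> {u, v} = {r, s})"
  by (simp_all add: S_plus_on_def)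

lemma S_plus_graph_eq:
  assumes "k + 2 \<le> n"
  shows "S_plus_graph n k = S_plus_on {..<n} {..<k} k (k + 1)"
  using assms by (auto simp: S_plus_graph_def S_graph_def S_plus_on_def doubleton_eq_iff)

lemma S_plus_on_image:
  assumes inj: "inj_on f W" and sub: "L \<subseteq> W" "r \<in> W" "s \<in> W"
  shows "S_plus_on (f ` W) (f ` L) (f r) (f s)
    = \<lparr>pverts = f ` W, parcs = map_prod f f ` parcs (S_plus_on W L r s)\<rparr>"
proof -
  let ?S = "S_plus_on W L r s" and ?S' = "S_plus_on (f ` W) (f ` L) (f r) (f s)"
  have arc_iff: "(f u, f v) \<in> parcs ?S' \<longleftrightarrow> (u, v) \<in> parcs ?S" if uv: "u \<in> W" "v \<in> W" for u v
  proof -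
    have "{f u, f v} = {f r, f s} \<longleftrightarrow> {u, v} = {r, s}"
      using inj_on_image_eq_iff[OF inj, of "{u, v}" "{r, s}"] uv sub(2,3) by simp
    moreover have "f u = f v \<longleftrightarrow> u = v" by (rule inj_on_eq_iff[OF inj uv])
    ultimately show ?thesis
      using uv inj_on_image_mem_iff[OF inj uv(1) sub(1)] inj_on_image_mem_iff[OF inj uv(2) sub(1)]
      by simp
  qed
  have "parcs ?S' = map_prod f f ` parcs ?S"
  proof (intro equalityI subsetI)
    fix e assume e: "e \<in> parcs ?S'"
    then obtain u v where "e = (f u, f v)" "u \<in> W" "v \<in> W" by (cases e) auto
    then show "e \<in> map_prod f f ` parcs ?S"
      using e arc_iff by (intro image_eqI[of _ _ "(u, v)"]) simp_all
  next
    fix e assume "e \<in> map_prod f f ` parcs ?S"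
    then obtain u v where "e = (f u, f v)" "(u, v) \<in> parcs ?S" by auto
    then show "e \<in> parcs ?S'" using arc_iff by simp
  qed
  then show ?thesis by (simp add: S_plus_on_def)
qed

lemma S_plus_root_exists:
  assumes "1 \<le> k" "k + 6 \<le> n"
  obtains \<mu> where "S_plus_root n k \<mu>" "k * (real n - real k) \<le> \<mu>\<^sup>2"
proof -
  define a where "a = sqrt (k * (real n - real k))"
  define b where "b = real n * k + 2 * k + 2"
  define g where "g \<mu> = \<mu> + 1 - real k - 2 * (k / (\<mu> - 1)) - (real n - real k - 2) * (k / \<mu>)" for \<mu>
  have k1: "1 \<le> real k" and nk: "6 \<le> real n - real k" and nk0: "0 \<le> real n * k"
    using assms by auto
  have "6 \<le> k * (real n - real k)" using mult_mono[OF k1 nk] k1 by simp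
  then have a2: "a\<^sup>2 = k * (real n - real k)" and a: "2 \<le> a"
    by (auto simp: a_def intro: real_le_rsqrt)
  have b: "k + 1 \<le> b" "2 * k \<le> b - 1" "(real n - real k - 2) * k \<le> b" "a\<^sup>2 \<le> b"
    using k1 nk0 unfolding a2 b_def by (auto simp: algebra_simps)
  have "1 \<le> b" using b(1) k1 by linarith
  then have "a\<^sup>2 \<le> b\<^sup>2" using b(4) self_le_power[of b 2] by simp
  then have "a \<le> b" by (rule power2_le_imp_le) (use \<open>1 \<le> b\<close> in simp)
  have "g a \<le> 0"
  proof -
    have "a - (real n - real k - 2) * (k / a) = 2 * (k / a)"
      using a a2 by (simp add: field_simps power2_eq_square)
    moreover have "k / a \<le> k / (a - 1)" by (rule divide_left_mono) (use a k1 in auto)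
    ultimately show ?thesis using k1 unfolding g_def by linarith
  qed
  have "0 \<le> g b"
  proof -
    have "2 * (k / (b - 1)) \<le> 1" "(real n - real k - 2) * (k / b) \<le> 1"
      using b k1 by (simp_all add: field_simps)
    then show ?thesis using b(1) unfolding g_def by linarith
  qed
  moreover have "continuous_on {a..b} g"
    unfolding g_def by (intro continuous_intros) (use a in auto)
  ultimately obtain \<mu> where \<mu>: "a \<le> \<mu>" "g \<mu> = 0"
    using IVT'[of g a 0 b] \<open>g a \<le> 0\<close> \<open>a \<le> b\<close> by auto
  have "a\<^sup>2 \<le> \<mu>\<^sup>2" using \<mu>(1) a by (intro power_mono) auto
  then show thesis using that[of \<mu>] \<mu> a a2 by (simp add: g_def S_plus_root_def)
qed

locale S_plus_data =
  fixes W L :: "'a set" and r s :: 'a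
  assumes finite_W: "finite W" and L_subset: "L \<subseteq> W"
    and rs_in: "r \<in> W - L" "s \<in> W - L" and rs_distinct: "r \<noteq> s"
begin

lemma finite_L: "finite L"
  using finite_subset[OF L_subset finite_W] .

lemma pair_graph_S_plus_on: "pair_graph (S_plus_on W L r s)"
proof
  show "finite (parcs (S_plus_on W L r s))"
    by (rule finite_subset[of _ "W \<times> W"]) (auto simp: finite_W)
  show "symmetric (with_proj (S_plus_on W L r s))"
    by (auto simp: symmetric_def sym_def insert_commute)
qed (auto simp: finite_W)

sublocale S: pair_graph "S_plus_on W L r s"
  by (rule pair_graph_S_plus_on)

lemma nbhd_S_plus_on:
  assumes "v \<in> W"
  shows "v \<in> L \<Longrightarrow> S.nbhd v = W - {v}"
    and "v \<in> {r, s} \<Longrightarrow> \<exists>u\<in>{r, s}. S.nbhd v = insert u L"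
    and "v \<notin> insert r (insert s L) \<Longrightarrow> S.nbhd v = L"
  using assms L_subset rs_in rs_distinct by (auto simp: doubleton_eq_iff)

lemma S_plus_vec_pos: "S_plus_root (card W) (card L) \<mu> \<Longrightarrow> L \<noteq> {} \<Longrightarrow> 0 < S_plus_vec L r s \<mu> v"
  using finite_L by (auto simp: S_plus_vec_def S_plus_root_def card_gt_0_iff)

lemma sum_S_plus_vec:
  assumes "S_plus_root (card W) (card L) \<mu>"
  shows "sum (S_plus_vec L r s \<mu>) L = card L" "sum (S_plus_vec L r s \<mu>) W = \<mu> + 1"
proof -
  let ?y = "S_plus_vec L r s \<mu>" and ?U = "insert r (insert s L)"
  show L: "sum ?y L = card L" by (simp add: S_plus_vec_def)
  have "?U \<subseteq> W" using L_subset rs_in by auto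
  have card_U: "card ?U = card L + 2" using finite_L rs_in rs_distinct by simp
  then have "card (W - ?U) = card W - (card L + 2)" "card L + 2 \<le> card W"
    using card_Diff_subset[OF _ \<open>?U \<subseteq> W\<close>] card_mono[OF finite_W \<open>?U \<subseteq> W\<close>] finite_L by auto
  then have "real (card (W - ?U)) = real (card W) - real (card L) - 2" by simp
  moreover have "sum ?y (W - ?U) = (\<Sum>v\<in>W - ?U. card L / \<mu>)"
    by (rule sum.cong) (auto simp: S_plus_vec_def)
  ultimately have "sum ?y (W - ?U) = (real (card W) - real (card L) - 2) * (card L / \<mu>)" by simp
  moreover have "sum ?y ?U = card L + 2 * (card L / (\<mu> - 1))"
    using L finite_L rs_in rs_distinct by (simp add: S_plus_vec_def)
  ultimately show "sum ?y W = \<mu> + 1"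
    using sum.subset_diff[OF \<open>?U \<subseteq> W\<close> finite_W, of ?y] assms by (simp add: S_plus_root_def)
qed

lemma sum_S_plus_vec_nbhd:
  assumes root: "S_plus_root (card W) (card L) \<mu>" and v: "v \<in> W"
  shows "sum (S_plus_vec L r s \<mu>) (S.nbhd v) = \<mu> * S_plus_vec L r s \<mu> v"
proof -
  let ?y = "S_plus_vec L r s \<mu>"
  have \<mu>: "2 \<le> \<mu>" using root by (simp add: S_plus_root_def)
  note sums = sum_S_plus_vec[OF root]
  consider (clique) "v \<in> L" | (extra_edge) "v \<in> {r, s}" | (rest) "v \<notin> insert r (insert s L)"
    by blast
  then show ?thesis
  proof cases
    case clique
    have "?y v = 1" using clique by (simp add: S_plus_vec_def)
    moreover have "sum ?y W = ?y v + sum ?y (S.nbhd v)"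
      unfolding nbhd_S_plus_on(1)[OF v clique] by (rule sum.remove[OF finite_W v])
    ultimately show ?thesis using sums(2) by simp
  next
    case extra_edge
    then obtain u where u: "u \<in> {r, s}" "S.nbhd v = insert u L"
      using nbhd_S_plus_on(2)[OF v] by blast
    have y: "?y u = card L / (\<mu> - 1)" "?y v = card L / (\<mu> - 1)" "u \<notin> L"
      using u(1) extra_edge rs_in by (auto simp: S_plus_vec_def)
    have "sum ?y (S.nbhd v) = card L / (\<mu> - 1) + card L"
      using y(1,3) finite_L by (simp add: u(2) sums(1))
    then show ?thesis unfolding y(2) using \<mu> by (simp add: field_simps)
  next
    case rest
    then show ?thesis using nbhd_S_plus_on(3)[OF v] sums(1) \<mu> by (simp add: S_plus_vec_def)
  qed
qed

lemma adj_form_S_plus_on_le: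
  assumes "S_plus_root (card W) (card L) \<mu>" "L \<noteq> {}"
  shows "S.adj_form x \<le> \<mu> * (\<Sum>v\<in>W. (x v)\<^sup>2)"
  using S.rayleigh_le(1)[of "S_plus_vec L r s \<mu>" \<mu> x] S_plus_vec_pos[OF assms]
    sum_S_plus_vec_nbhd[OF assms(1)] by simp

lemma pos_if_adj_form_S_plus_on_eq:
  assumes root: "S_plus_root (card W) (card L) \<mu>"
    and eq: "S.adj_form x = \<mu> * (\<Sum>v\<in>W. (x v)\<^sup>2)" and c: "c \<in> L" "0 < x c" and v: "v \<in> W"
  shows "0 < x v"
proof (cases "v = c")
  case False
  let ?y = "S_plus_vec L r s \<mu>"
  have y_pos: "0 < ?y u" for u by (rule S_plus_vec_pos[OF root]) (use c(1) in blast)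
  have "(v, c) \<in> parcs (S_plus_on W L r s)" using False c(1) v L_subset by auto
  then have "x v * ?y c = x c * ?y v"
    using S.rayleigh_le(2)[of ?y \<mu> x v c] y_pos sum_S_plus_vec_nbhd[OF root] eq by simp
  then have "0 < x v * ?y c" using c(2) y_pos[of v] by simp
  then show ?thesis using y_pos[of c] by (simp add: zero_less_mult_iff)
qed (use c in simp)

end

lemma S_plus_root_le_adj_spectral_radius:
  assumes "1 \<le> k" "k + 2 \<le> n" "S_plus_root n k \<mu>"
  shows "\<mu> \<le> adj_spectral_radius (S_plus_graph n k)"
proof -
  interpret S_plus_data "{..<n}" "{..<k}" k "k + 1"
    by unfold_locales (use assms(2) in auto)
  have root: "S_plus_root (card {..<n}) (card {..<k}) \<mu>" using assms(3) by simp
  have "S.eigenfunction \<mu> (S_plus_vec {..<k} k (k + 1) \<mu>)"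
    unfolding S.eigenfunction_def
  proof
    show "\<exists>v\<in>S.V. S_plus_vec {..<k} k (k + 1) \<mu> v \<noteq> 0"
      using assms(1,2) by (intro bexI[of _ 0]) (auto simp: S_plus_vec_def)
  qed (use sum_S_plus_vec_nbhd[OF root] in auto)
  then show ?thesis
    unfolding S_plus_graph_eq[OF assms(2)] by (rule S.real_eigenvalue_le_adj_spectral_radius)
qed

lemma digraph_iso_S_plus_on:
  assumes "S_plus_data W L r s" "S_plus_data W' L' r' s'" "card W = card W'" "card L = card L'"
  shows "digraph_iso (with_proj (S_plus_on W L r s)) (with_proj (S_plus_on W' L' r' s'))"
proof -
  interpret A: S_plus_data W L r s by fact
  interpret B: S_plus_data W' L' r' s' by fact
  let ?R = "W - insert r (insert s L)" and ?R' = "W' - insert r' (insert s' L')"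
  have "card (insert r (insert s L)) = card (insert r' (insert s' L'))"
    using assms(4) A.finite_L B.finite_L A.rs_in B.rs_in A.rs_distinct B.rs_distinct by simp
  moreover have "insert r (insert s L) \<subseteq> W" "insert r' (insert s' L') \<subseteq> W'"
    using A.L_subset A.rs_in B.L_subset B.rs_in by auto
  ultimately have "card ?R = card ?R'"
    using assms(3) A.finite_L B.finite_L by (simp add: card_Diff_subset)
  then obtain h where h: "bij_betw h ?R ?R'"
    using finite_same_card_bij[of ?R ?R'] A.finite_W B.finite_W by auto
  obtain l where l: "bij_betw l L L'"
    using finite_same_card_bij[OF A.finite_L B.finite_L assms(4)] by blast
  define f where "f v = (if v \<in> L then l v else if v = r then r' else if v = s then s' else h v)" for v
  have f_L: "bij_betw f L L'"
    using l by (rule bij_betw_cong[THEN iffD1, rotated]) (simp add: f_def)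
  have "bij_betw f ?R ?R'"
    using h by (rule bij_betw_cong[THEN iffD1, rotated]) (simp add: f_def)
  moreover have f_rs: "f r = r'" "f s = s'" using A.rs_in A.rs_distinct by (auto simp: f_def)
  then have "bij_betw f {r, s} {r', s'}" using A.rs_distinct B.rs_distinct by (auto simp: bij_betw_def)
  ultimately have "bij_betw f (L \<union> {r, s} \<union> ?R) (L' \<union> {r', s'} \<union> ?R')"
    using B.rs_in by (intro bij_betw_combine f_L) auto
  moreover have "L \<union> {r, s} \<union> ?R = W" "L' \<union> {r', s'} \<union> ?R' = W'"
    using A.L_subset A.rs_in B.L_subset B.rs_in by auto
  ultimately have "bij_betw f W W'" by (simp only:)
  then have f: "inj_on f W" "f ` W = W'" by (simp_all add: bij_betw_def)
  have "f ` L = L'" using f_L by (simp add: bij_betw_def)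
  then have "S_plus_on W' L' r' s' = S_plus_on (f ` W) (f ` L) (f r) (f s)"
    unfolding f(2) f_rs by simp
  also have "\<dots> = \<lparr>pverts = f ` W, parcs = map_prod f f ` parcs (S_plus_on W L r s)\<rparr>"
    by (rule S_plus_on_image[OF f(1)]) (use A.L_subset A.rs_in in auto)
  finally show ?thesis
    using digraph_iso_image[OF A.pair_graph_S_plus_on, of f] f(1) by (simp only: S_plus_on_simps)
qed

section \<open>Subinvariant weights on fan-free graphs\<close>

locale spectral_fan_free = fan_free G I half cyclic
  for G :: "'a pair_pre_digraph" and I :: "'i set" and half cyclic +
  fixes x :: "'a \<Rightarrow> real" and lam :: real and z :: 'a
  assumes x_nonneg: "v \<in> V \<Longrightarrow> 0 \<le> x v" and x_le_1: "v \<in> V \<Longrightarrow> x v \<le> 1"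
    and z_in: "z \<in> V" and x_z: "x z = 1"
    and subinvariant: "v \<in> V \<Longrightarrow> lam * x v \<le> sum x (nbhd v)"
    and lam_nonneg: "0 \<le> lam"
    and lam_sq_ge: "real \<kappa> * (real (card V) - real \<kappa>) \<le> lam\<^sup>2"
    and order_ge: "4 * (\<kappa>\<^sup>2 + \<sigma>) \<le> card V"
begin

abbreviation n :: real where
  "n \<equiv> real (card V)"

definition walk_weight :: "'a set \<Rightarrow> 'a set \<Rightarrow> real" where
  "walk_weight A B = (\<Sum>(a, u)\<in>parcs G \<inter> A \<times> B. x u)"

lemma n_pos: "0 < n"
  using z_in pair_finite_verts by (auto simp: card_gt_0_iff)

lemma n_ge: "4 * (real \<kappa>)\<^sup>2 \<le> n" "4 * real \<sigma> \<le> n"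
proof -
  have "real (4 * (\<kappa>\<^sup>2 + \<sigma>)) \<le> n" using order_ge by (simp only: of_nat_le_iff)
  then have "4 * (real \<kappa>)\<^sup>2 + 4 * real \<sigma> \<le> n" by simp
  then show "4 * (real \<kappa>)\<^sup>2 \<le> n" "4 * real \<sigma> \<le> n"
    using zero_le_power2[of "real \<kappa>"] by linarith+
qed

lemma lam_sq_ge_linear: "real \<kappa> * n - n / 4 \<le> lam\<^sup>2"
  using lam_sq_ge n_ge(1) by (simp add: algebra_simps power2_eq_square)

lemma n_le_lam_sq: "n \<le> lam\<^sup>2"
proof -
  have "2 * n \<le> real \<kappa> * n" using \<kappa>_ge_2 by (intro mult_right_mono) auto
  then show ?thesis using lam_sq_ge_linear n_pos by linarith
qed

lemma lam_pos: "0 < lam"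
  using n_le_lam_sq n_pos lam_nonneg by (cases "lam = 0") auto

lemma lam_mult_le_degree:
  assumes "v \<in> V"
  shows "lam * x v \<le> card (nbhd v)"
proof -
  have "sum x (nbhd v) \<le> (\<Sum>u\<in>nbhd v. 1)"
    by (rule sum_mono) (use x_le_1 nbhd_subset in blast)
  then show ?thesis using subinvariant[OF assms] by simp
qed

lemma walk_weight_eq_sum: "finite A \<Longrightarrow> walk_weight A B = (\<Sum>a\<in>A. sum x (nbhd a \<inter> B))"
  unfolding walk_weight_def by (rule sum_arcs_between)

lemma walk_weight_mono:
  assumes "\<And>a u. (a, u) \<in> parcs G \<Longrightarrow> a \<in> A \<Longrightarrow> u \<in> B \<Longrightarrow> a \<in> A' \<and> u \<in> B'"
  shows "walk_weight A B \<le> walk_weight A' B'"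
  unfolding walk_weight_def
  by (rule sum_mono2) (use assms in \<open>auto intro: x_nonneg dest: in_arcsD2\<close>)

lemma walk_weight_Un_le: "walk_weight A (B \<union> B') \<le> walk_weight A B + walk_weight A B'"
proof -
  let ?E = "\<lambda>B. parcs G \<inter> A \<times> B"
  have "walk_weight A (B \<union> B') + walk_weight A (B \<inter> B') = walk_weight A B + walk_weight A B'"
    using sum.union_inter[of "?E B" "?E B'" "\<lambda>(a, u). x u"]
    by (simp add: walk_weight_def Sigma_Un_distrib2 Int_Un_distrib Sigma_Int_distrib2 Int_assoc
        Int_left_commute)
  moreover have "0 \<le> walk_weight A (B \<inter> B')"
    unfolding walk_weight_def by (rule sum_nonneg) (auto intro: x_nonneg dest: in_arcsD2)
  ultimately show ?thesis by linarith
qed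

lemma walk_weight_le_mult:
  assumes "\<And>u. u \<in> B \<Longrightarrow> u \<in> V \<Longrightarrow> x u \<le> c"
  shows "walk_weight A B \<le> c * edge_count A B"
proof -
  have "(case e of (a, u) \<Rightarrow> x u) \<le> c" if "e \<in> parcs G \<inter> A \<times> B" for e
    using that assms in_arcsD2 by auto
  then show ?thesis
    using sum_bounded_above[of "parcs G \<inter> A \<times> B" "\<lambda>(a, u). x u" c]
    by (simp add: walk_weight_def edge_count_def mult.commute)
qed

lemma walk_weight_nbhd_le:
  assumes "finite H" "H \<subseteq> V"
  shows "walk_weight (nbhd v) H = (\<Sum>u\<in>H. card (nbhd v \<inter> nbhd u) * x u)"
proof -
  have "walk_weight (nbhd v) H = (\<Sum>(u, a)\<in>parcs G \<inter> H \<times> nbhd v. x u)"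
    unfolding walk_weight_def by (rule sum_arcs_swap)
  also have "\<dots> = (\<Sum>u\<in>H. \<Sum>a\<in>nbhd u \<inter> nbhd v. x u)"
    by (rule sum_arcs_between[OF assms(1)])
  finally show ?thesis by (simp add: Int_commute)
qed

lemma lam_sq_mult_le:
  assumes v: "v \<in> V" and H: "H \<subseteq> V"
  shows "lam\<^sup>2 * x v \<le> card H * lam + (\<Sum>u\<in>H. card (nbhd v \<inter> nbhd u) * x u)
    + walk_weight (nbhd v - H) (V - H)"
proof -
  have fin: "finite H" by (rule finite_if_subset_V[OF H])
  have "sum x (nbhd v \<inter> H) \<le> (\<Sum>u\<in>nbhd v \<inter> H. 1)"
    by (rule sum_mono) (use x_le_1 H in blast)
  also have "\<dots> \<le> card H" using fin by (simp add: card_mono)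
  finally have into_H: "lam * sum x (nbhd v \<inter> H) \<le> lam * card H"
    by (rule mult_left_mono[OF _ lam_nonneg])
  have "lam\<^sup>2 * x v = lam * (lam * x v)" by (simp add: power2_eq_square)
  also have "\<dots> \<le> lam * sum x (nbhd v)" by (rule mult_left_mono[OF subinvariant[OF v] lam_nonneg])
  also have "\<dots> = lam * sum x (nbhd v \<inter> H) + (\<Sum>a\<in>nbhd v - H. lam * x a)"
    using sum.Int_Diff[of "nbhd v" x H] by (simp add: distrib_left sum_distrib_left)
  also note into_H
  also have "(\<Sum>a\<in>nbhd v - H. lam * x a) \<le> (\<Sum>a\<in>nbhd v - H. sum x (nbhd a))"
    by (rule sum_mono) (use subinvariant nbhd_subset in blast)
  also have "\<dots> = walk_weight (nbhd v - H) V"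
    using nbhd_subset by (simp add: walk_weight_eq_sum Int_absorb2)
  also have "\<dots> \<le> walk_weight (nbhd v - H) H + walk_weight (nbhd v - H) (V - H)"
    using walk_weight_Un_le[of "nbhd v - H" H "V - H"] H by (simp add: Un_absorb1)
  also have "walk_weight (nbhd v - H) H \<le> walk_weight (nbhd v) H"
    by (rule walk_weight_mono) auto
  also have "\<dots> = (\<Sum>u\<in>H. card (nbhd v \<inter> nbhd u) * x u)" by (rule walk_weight_nbhd_le[OF fin H])
  finally show ?thesis by (simp add: algebra_simps)
qed

lemma edge_count_nbhd_V_le:
  assumes "A \<subseteq> nbhd w" "B \<subseteq> V"
  shows "real (edge_count A B) \<le> 2 * edge_const * n"
proof -
  have "edge_count A B \<le> edge_const * (card A + card B)" by (rule edge_count_nbhd_le[OF assms])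
  also have "\<dots> \<le> edge_const * (card V + card V)"
    using assms nbhd_subset[of w] by (intro mult_le_mono2 add_mono card_mono pair_finite_verts) auto
  finally have "real (edge_count A B) \<le> real (edge_const * (card V + card V))"
    by (simp only: of_nat_le_iff)
  then show ?thesis by simp
qed

lemma lam_sq_le: "lam\<^sup>2 \<le> 2 * edge_const * n"
proof -
  have "lam\<^sup>2 * x z \<le> walk_weight (nbhd z) V" using lam_sq_mult_le[OF z_in, of "{}"] by simp
  also have "\<dots> \<le> 1 * real (edge_count (nbhd z) V)" by (rule walk_weight_le_mult) (rule x_le_1)
  finally show ?thesis using edge_count_nbhd_V_le[OF order_refl order_refl, of z] x_z by simp
qed

end

section \<open>The constants\<close>

text \<open>
  Vertices of degree below \<open>n / precision\<^sup>2\<close> have weight at most \<open>light_const / precision\<^sup>2\<close>, and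
  fewer than \<open>hub_limit\<close> vertices have larger degree.
\<close>

context fan_shape
begin

definition light_const :: nat where
  "light_const = 2 * (\<kappa> + 2 + 6 * edge_const)"

definition weight_const :: nat where
  "weight_const = 2 + 2 * light_const * edge_const"

definition precision :: nat where
  "precision = 256 * (\<kappa> + 1) ^ 3 * edge_const * (weight_const + 2)"

definition hub_limit :: nat where
  "hub_limit = (\<kappa> + 1) * precision\<^sup>2"

definition order_threshold :: nat where
  "order_threshold = 128 * edge_const\<^sup>2 * hub_limit ^ 4 * 2 ^ hub_limit"

lemma edge_const_pos: "1 \<le> edge_const" "\<sigma> < edge_const"
  by (simp_all add: edge_const_def)

lemma precision_ge: "1 \<le> precision" "20 * edge_const \<le> precision"
proof -
  have "20 * edge_const * 1 \<le> 256 * (\<kappa> + 1) ^ 3 * edge_const * (weight_const + 2)"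
    by (intro mult_le_mono order_refl) (auto simp: numeral_eq_Suc)
  then show "20 * edge_const \<le> precision" by (simp add: precision_def)
  then show "1 \<le> precision" using edge_const_pos(1) by linarith
qed

lemma hub_limit_ge: "1 \<le> hub_limit" "\<kappa> \<le> hub_limit" "precision \<le> hub_limit" "precision\<^sup>2 \<le> hub_limit"
proof -
  have "1 \<le> precision\<^sup>2" using precision_ge(1) by simp
  then have "(\<kappa> + 1) * 1 \<le> hub_limit" unfolding hub_limit_def by (intro mult_le_mono2)
  then show "\<kappa> \<le> hub_limit" "1 \<le> hub_limit" by simp_all
  show sq: "precision\<^sup>2 \<le> hub_limit" by (simp add: hub_limit_def)
  have "precision \<le> precision\<^sup>2" using precision_ge(1) by (simp add: power2_eq_square)
  then show "precision \<le> hub_limit" using sq by linarith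
qed

lemma monomial_le_order_threshold:
  assumes "a \<le> 2" "b \<le> 4" "c \<le> 1"
  shows "128 * (edge_const ^ a * hub_limit ^ b * (2 ^ hub_limit) ^ c) \<le> order_threshold"
proof -
  have "edge_const ^ a * hub_limit ^ b * (2 ^ hub_limit) ^ c
      \<le> edge_const\<^sup>2 * hub_limit ^ 4 * (2 ^ hub_limit) ^ 1"
    using assms edge_const_pos(1) hub_limit_ge(1) by (intro mult_le_mono power_increasing) auto
  then show ?thesis by (simp add: order_threshold_def)
qed

lemma codegree_excess_less_order_threshold:
  "hub_limit * (\<sigma> * 2 ^ hub_limit) * precision\<^sup>2 < order_threshold"
proof -
  have "hub_limit * (\<sigma> * 2 ^ hub_limit) * precision\<^sup>2
      \<le> hub_limit * (edge_const * 2 ^ hub_limit) * hub_limit"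
    using edge_const_pos(2) by (intro mult_le_mono hub_limit_ge order_refl) auto
  also have "\<dots> = edge_const ^ 1 * hub_limit\<^sup>2 * (2 ^ hub_limit) ^ 1" by (simp add: power2_eq_square)
  also have "\<dots> < 128 * (edge_const ^ 1 * hub_limit\<^sup>2 * (2 ^ hub_limit) ^ 1)"
    using edge_const_pos(1) hub_limit_ge(1) by simp
  also have "\<dots> \<le> order_threshold" by (rule monomial_le_order_threshold) auto
  finally show ?thesis .
qed

lemma edge_const_hub_limit_le_order_threshold:
  "2 * edge_const * (hub_limit * precision\<^sup>2)\<^sup>2 \<le> order_threshold"
proof -
  have "2 * edge_const * (hub_limit * precision\<^sup>2)\<^sup>2 \<le> 2 * edge_const * (hub_limit * hub_limit)\<^sup>2"
    by (intro mult_le_mono power_mono hub_limit_ge order_refl) auto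
  also have "\<dots> \<le> 128 * (edge_const ^ 1 * hub_limit ^ 4 * (2 ^ hub_limit) ^ 0)"
    by (simp add: power2_eq_square power4_eq_xxxx)
  also have "\<dots> \<le> order_threshold" by (rule monomial_le_order_threshold) auto
  finally show ?thesis .
qed

lemma edge_const_precision_le_order_threshold:
  "2 * (8 * edge_const * precision\<^sup>2 * precision\<^sup>2)\<^sup>2 \<le> order_threshold"
proof -
  have "2 * (8 * edge_const * precision\<^sup>2 * precision\<^sup>2)\<^sup>2
      \<le> 2 * (8 * edge_const * hub_limit * hub_limit)\<^sup>2"
    by (intro mult_le_mono power_mono hub_limit_ge order_refl) auto
  also have "\<dots> = 128 * (edge_const\<^sup>2 * hub_limit ^ 4 * (2 ^ hub_limit) ^ 0)"
    by (simp add: power2_eq_square power4_eq_xxxx algebra_simps)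
  also have "\<dots> \<le> order_threshold" by (rule monomial_le_order_threshold) auto
  finally show ?thesis .
qed

lemma small_products_le_order_threshold:
  "1 * precision\<^sup>2 \<le> order_threshold"
  "\<kappa>\<^sup>2 * precision\<^sup>2 \<le> order_threshold"
  "\<sigma> * precision \<le> order_threshold"
  "4 * (\<kappa>\<^sup>2 + \<sigma>) \<le> order_threshold"
proof -
  have monomial: "128 * (edge_const ^ a * hub_limit ^ b) \<le> order_threshold" if "a \<le> 2" "b \<le> 4" for a b
    using monomial_le_order_threshold[OF that, of 0] by simp
  show "1 * precision\<^sup>2 \<le> order_threshold" using hub_limit_ge(4) monomial[of 0 1] by simp
  have "\<kappa>\<^sup>2 * precision\<^sup>2 \<le> hub_limit\<^sup>2 * hub_limit" by (intro mult_le_mono power_mono hub_limit_ge) auto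
  then show "\<kappa>\<^sup>2 * precision\<^sup>2 \<le> order_threshold"
    using monomial[of 0 3] by (simp add: eval_nat_numeral)
  have "\<sigma> * precision \<le> edge_const * hub_limit"
    using edge_const_pos(2) by (intro mult_le_mono hub_limit_ge) auto
  then show "\<sigma> * precision \<le> order_threshold" using monomial[of 1 1] by simp
  have "4 * (\<kappa>\<^sup>2 + \<sigma>) \<le> 4 * (hub_limit\<^sup>2 + edge_const)"
    using edge_const_pos(2) by (intro mult_le_mono2 add_mono power_mono hub_limit_ge) auto
  also have "\<dots> \<le> order_threshold" using monomial[of 0 2] monomial[of 1 0] by simp
  finally show "4 * (\<kappa>\<^sup>2 + \<sigma>) \<le> order_threshold" .
qed

end

section \<open>Weights of vertices of small degree\<close>

locale large_spectral_fan_free = spectral_fan_free G I half cyclic x lam z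
  for G :: "'a pair_pre_digraph" and I :: "'i set" and half cyclic x lam z +
  assumes order_ge_threshold: "order_threshold \<le> card V"
begin

definition \<epsilon> :: real where
  "\<epsilon> = 1 / precision"

definition \<delta> :: real where
  "\<delta> = \<epsilon>\<^sup>2"

definition High :: "'a set" where
  "High = {v \<in> V. \<delta> * n \<le> card (nbhd v)}"

definition codegree_weight :: "'a \<Rightarrow> real" where
  "codegree_weight v = (\<Sum>u\<in>High. card (nbhd v \<inter> nbhd u) * x u)"

definition low_walks :: "'a \<Rightarrow> real" where
  "low_walks v = walk_weight (nbhd v - High) (V - High)"

lemma \<epsilon>_bounds: "0 < \<epsilon>" "\<epsilon> \<le> 1" "20 * edge_const * \<epsilon> \<le> 1"
proof -
  have "real 1 \<le> precision" "real (20 * edge_const) \<le> precision"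
    using precision_ge by (simp_all only: of_nat_le_iff)
  then show "0 < \<epsilon>" "\<epsilon> \<le> 1" "20 * edge_const * \<epsilon> \<le> 1"
    by (simp_all add: \<epsilon>_def field_simps)
qed

lemma \<delta>_bounds: "0 < \<delta>" "\<delta> \<le> \<epsilon>" "\<delta> \<le> 1"
proof -
  show "0 < \<delta>" using \<epsilon>_bounds(1) by (simp add: \<delta>_def)
  show "\<delta> \<le> \<epsilon>" using \<epsilon>_bounds(1,2) by (simp add: \<delta>_def power2_eq_square mult_left_le)
  then show "\<delta> \<le> 1" using \<epsilon>_bounds(2) by linarith
qed

lemma \<delta>_mult_precision_sq: "\<delta> * (real precision)\<^sup>2 = 1"
  using precision_ge(1) by (simp add: \<delta>_def \<epsilon>_def power_divide)

lemma hub_limit_mult_\<delta>: "hub_limit * \<delta> = real \<kappa> + 1"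
  using \<delta>_mult_precision_sq by (simp add: hub_limit_def algebra_simps)

lemma le_order_threshold_imp_le_n: "k \<le> order_threshold \<Longrightarrow> real k \<le> n"
  using order_ge_threshold by (meson le_trans of_nat_mono)

lemma le_\<delta>_mult_n:
  assumes "k * precision\<^sup>2 \<le> order_threshold"
  shows "k \<le> \<delta> * n"
proof -
  have "\<delta> * real (k * precision\<^sup>2) \<le> \<delta> * n"
    using le_order_threshold_imp_le_n[OF assms] \<delta>_bounds(1) by (intro mult_left_mono) auto
  moreover have "\<delta> * real (k * precision\<^sup>2) = k * (\<delta> * (real precision)\<^sup>2)" by simp
  ultimately show ?thesis by (simp only: \<delta>_mult_precision_sq mult_1_right)
qed

lemma \<delta>n_ge_1: "1 \<le> \<delta> * n"
  using le_\<delta>_mult_n[OF small_products_le_order_threshold(1)] by simp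

lemma \<kappa>_sq_le: "(real \<kappa>)\<^sup>2 \<le> \<delta> * n"
  using le_\<delta>_mult_n[OF small_products_le_order_threshold(2)] by simp

lemma codegree_excess_le: "hub_limit * (\<sigma> * 2 ^ hub_limit) \<le> \<delta> * n"
  by (rule le_\<delta>_mult_n[OF less_imp_le[OF codegree_excess_less_order_threshold]])

lemma \<sigma>_le_\<epsilon>n: "\<sigma> \<le> \<epsilon> * n"
proof -
  have "real (\<sigma> * precision) \<le> n"
    by (rule le_order_threshold_imp_le_n[OF small_products_le_order_threshold(3)])
  then show ?thesis using precision_ge(1) by (simp add: \<epsilon>_def field_simps)
qed

lemma hub_limit_mult_lam_le: "hub_limit * lam \<le> \<delta> * n"
proof -
  have le_n: "real (2 * edge_const * (hub_limit * precision\<^sup>2)\<^sup>2) \<le> n"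
    by (rule le_order_threshold_imp_le_n[OF edge_const_hub_limit_le_order_threshold])
  have "(hub_limit * lam)\<^sup>2 = (real hub_limit)\<^sup>2 * lam\<^sup>2" by (rule power_mult_distrib)
  also have "\<dots> \<le> (real hub_limit)\<^sup>2 * (2 * edge_const * n)" by (rule mult_left_mono[OF lam_sq_le]) simp
  also have "\<dots> = (\<delta> * (real precision)\<^sup>2)\<^sup>2 * (real hub_limit)\<^sup>2 * (2 * edge_const * n)"
    unfolding \<delta>_mult_precision_sq by simp
  also have "\<dots> = \<delta>\<^sup>2 * n * real (2 * edge_const * (hub_limit * precision\<^sup>2)\<^sup>2)"
    by (simp add: power_mult_distrib)
  also have "\<dots> \<le> \<delta>\<^sup>2 * n * n" by (rule mult_left_mono[OF le_n]) simp
  also have "\<dots> = (\<delta> * n)\<^sup>2" by (simp add: power2_eq_square)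
  finally have "(hub_limit * lam)\<^sup>2 \<le> (\<delta> * n)\<^sup>2" .
  then show ?thesis by (rule power2_le_imp_le) (use \<delta>_bounds(1) in simp)
qed

lemma edge_const_le_lam: "8 * edge_const \<le> \<delta>\<^sup>2 * lam"
proof -
  let ?b = "8 * edge_const * precision\<^sup>2 * precision\<^sup>2"
  have "real (2 * ?b\<^sup>2) \<le> n"
    by (rule le_order_threshold_imp_le_n[OF edge_const_precision_le_order_threshold])
  then have "(real ?b)\<^sup>2 \<le> lam\<^sup>2" using n_le_lam_sq by simp
  then have "real ?b \<le> lam" by (rule power2_le_imp_le) (rule lam_nonneg)
  then have "\<delta>\<^sup>2 * ?b \<le> \<delta>\<^sup>2 * lam" by (rule mult_left_mono) simp
  moreover have "\<delta>\<^sup>2 * ?b = 8 * edge_const * (\<delta> * (real precision)\<^sup>2)\<^sup>2"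
    by (simp add: power2_eq_square)
  ultimately show ?thesis unfolding \<delta>_mult_precision_sq by (simp only: one_power2 mult_1_right)
qed

lemma High_subset: "High \<subseteq> V"
  by (auto simp: High_def)

lemma degree_notin_High: "v \<in> V - High \<Longrightarrow> card (nbhd v) \<le> \<delta> * n"
  by (auto simp: High_def)

lemma card_High_less: "card High < hub_limit"
proof (rule ccontr)
  assume "\<not> card High < hub_limit"
  then obtain S where S: "S \<subseteq> High" "card S = hub_limit"
    by (meson linorder_not_less obtain_subset_with_card_n)
  have SV: "S \<subseteq> V" using S(1) High_subset by blast
  have "(real \<kappa> + 1) * n = hub_limit * (\<delta> * n)"
    using hub_limit_mult_\<delta> by (simp add: mult.assoc[symmetric])
  also have "\<dots> \<le> (\<Sum>v\<in>S. real (card (nbhd v)))"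
    using sum_bounded_below[of S "\<delta> * n" "\<lambda>v. real (card (nbhd v))"] S by (auto simp: High_def)
  also have "\<dots> = edge_count S V"
    using nbhd_subset by (simp add: edge_count_eq_sum[OF finite_if_subset_V[OF SV]] Int_absorb2)
  also have "\<dots> \<le> real (\<kappa> * card V + hub_limit * (\<sigma> * 2 ^ hub_limit))"
    using edge_count_into_le[OF order_refl SV] S(2)
    unfolding edge_count_commute[of S] of_nat_le_iff by simp
  also have "\<dots> < (real \<kappa> + 1) * n"
  proof -
    have "1 \<le> precision\<^sup>2" using precision_ge(1) by simp
    then have "hub_limit * (\<sigma> * 2 ^ hub_limit) * 1 \<le> hub_limit * (\<sigma> * 2 ^ hub_limit) * precision\<^sup>2"
      by (rule mult_le_mono2)
    then have "hub_limit * (\<sigma> * 2 ^ hub_limit) < card V"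
      using codegree_excess_less_order_threshold order_ge_threshold by linarith
    then have "real (hub_limit * (\<sigma> * 2 ^ hub_limit)) < n" by (simp only: of_nat_less_iff)
    then show ?thesis by (simp add: algebra_simps)
  qed
  finally show False by simp
qed

lemma codegree_sum_High_le: "(\<Sum>u\<in>High. real (card (nbhd v \<inter> nbhd u))) \<le> \<kappa> * card (nbhd v) + \<delta> * n"
proof -
  have "(\<Sum>u\<in>High. card (nbhd v \<inter> nbhd u)) = edge_count (nbhd v) High"
    by (simp add: edge_count_commute[of "nbhd v"] edge_count_eq_sum finite_if_subset_V[OF High_subset]
        Int_commute)
  also have "\<dots> \<le> \<kappa> * card (nbhd v) + card High * (\<sigma> * 2 ^ card High)"
    by (rule edge_count_into_le[OF nbhd_subset High_subset])
  also have "card High * (\<sigma> * 2 ^ card High) \<le> hub_limit * (\<sigma> * 2 ^ hub_limit)"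
    by (intro mult_le_mono power_increasing) (use card_High_less in auto)
  finally have "real (\<Sum>u\<in>High. card (nbhd v \<inter> nbhd u))
      \<le> real (\<kappa> * card (nbhd v) + hub_limit * (\<sigma> * 2 ^ hub_limit))"
    by (simp only: of_nat_le_iff)
  then show ?thesis using codegree_excess_le by simp
qed

lemma codegree_weight_le: "codegree_weight v \<le> \<kappa> * card (nbhd v) + \<delta> * n"
proof -
  have "codegree_weight v \<le> (\<Sum>u\<in>High. real (card (nbhd v \<inter> nbhd u)))"
    unfolding codegree_weight_def
    by (rule sum_mono) (use x_le_1 High_subset in \<open>auto intro!: mult_left_le\<close>)
  then show ?thesis using codegree_sum_High_le[of v] by linarith
qed

lemma lam_sq_mult_le_High:
  assumes "v \<in> V"
  shows "lam\<^sup>2 * x v \<le> codegree_weight v + low_walks v + \<delta> * n"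
proof -
  have "card High * lam \<le> hub_limit * lam"
    by (rule mult_right_mono) (use card_High_less lam_nonneg in auto)
  then show ?thesis
    using lam_sq_mult_le[OF assms High_subset] hub_limit_mult_lam_le
    unfolding codegree_weight_def low_walks_def by linarith
qed

lemma lam_sq_mult_le_low_walks:
  assumes "v \<in> V - High"
  shows "lam\<^sup>2 * x v \<le> (real \<kappa> + 2) * (\<delta> * n) + low_walks v"
proof -
  have "\<kappa> * real (card (nbhd v)) \<le> \<kappa> * (\<delta> * n)"
    by (rule mult_left_mono[OF degree_notin_High[OF assms]]) simp
  then show ?thesis
    using lam_sq_mult_le_High[of v] codegree_weight_le[of v] assms by (simp add: algebra_simps)
qed

lemma edge_count_notin_High_le:
  assumes w: "w \<in> V - High" and half_le: "\<And>i. i \<in> I \<Longrightarrow> half i \<le> \<kappa>"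
  shows "edge_count (nbhd w - High) (V - High) \<le> (real \<kappa> - 1) * n + 5 * edge_const * (\<delta> * n)"
proof -
  define \<Delta> where "\<Delta> = nat \<lfloor>\<delta> * n\<rfloor>"
  have \<Delta>: "real \<Delta> \<le> \<delta> * n" using \<delta>n_ge_1 by (simp add: \<Delta>_def of_nat_floor)
  have "nbhd w - High = nbhd w \<inter> (V - High)" using nbhd_subset by blast
  moreover have "edge_count (nbhd w \<inter> (V - High)) (V - High)
      \<le> (\<kappa> - 1) * card V + \<sigma> * (3 * \<Delta>) + edge_const * (2 * \<Delta> + 1)"
  proof (rule edge_count_low_degree_le[OF _ w _ half_le])
    show "card (nbhd v) \<le> \<Delta>" if "v \<in> V - High" for v
      using degree_notin_High[OF that] by (simp add: \<Delta>_def le_nat_floor)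
  qed auto
  ultimately have "real (edge_count (nbhd w - High) (V - High))
      \<le> real ((\<kappa> - 1) * card V + \<sigma> * (3 * \<Delta>) + edge_const * (2 * \<Delta> + 1))"
    by (simp only: of_nat_le_iff)
  also have "\<dots> = (real \<kappa> - 1) * n + \<sigma> * (3 * \<Delta>) + edge_const * (2 * \<Delta> + 1)"
    using \<kappa>_ge_2 by simp
  also have "\<dots> \<le> (real \<kappa> - 1) * n + 5 * edge_const * (\<delta> * n)"
  proof -
    have "real edge_const * (2 * real \<Delta> + 1) \<le> edge_const * (3 * (\<delta> * n))"
      using \<Delta> \<delta>n_ge_1 by (intro mult_left_mono) auto
    moreover have "3 * real \<sigma> * \<Delta> \<le> 2 * edge_const * (\<delta> * n)"
      using \<Delta> by (intro mult_mono) (auto simp: edge_const_def)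
    ultimately show ?thesis by (simp add: algebra_simps)
  qed
  finally show ?thesis .
qed

lemma card_heavy_second_nbhd_le:
  assumes I: "I = {i}" "3 \<le> half i"
  shows "card {u \<in> second_nbhd w. \<delta> \<le> x u} \<le> \<delta> * n"
proof -
  define Heavy where "Heavy = {u \<in> second_nbhd w. \<delta> \<le> x u}"
  have NV: "second_nbhd w \<subseteq> V" using second_nbhd_subset by blast
  have "card Heavy * (lam * \<delta>) \<le> (\<Sum>u\<in>Heavy. real (card (nbhd u)))"
  proof (rule sum_bounded_below)
    fix u assume "u \<in> Heavy"
    then have "u \<in> V" "\<delta> \<le> x u" using NV by (auto simp: Heavy_def)
    then show "lam * \<delta> \<le> card (nbhd u)"
      using lam_mult_le_degree[of u] mult_left_mono[OF _ lam_nonneg, of \<delta> "x u"] by linarith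
  qed
  also have "\<dots> \<le> (\<Sum>u\<in>second_nbhd w. real (card (nbhd u)))"
    by (rule sum_mono2) (use finite_if_subset_V[OF NV] in \<open>auto simp: Heavy_def\<close>)
  also have "\<dots> \<le> real (8 * edge_const * card V)"
    unfolding of_nat_sum[symmetric] of_nat_le_iff by (rule sum_degree_second_nbhd_le[OF I])
  also have "\<dots> = 8 * edge_const * n" by simp
  also have "\<dots> \<le> (\<delta>\<^sup>2 * lam) * n" by (rule mult_right_mono[OF edge_const_le_lam]) simp
  also have "\<dots> = (\<delta> * n) * (lam * \<delta>)" by (simp add: power2_eq_square)
  finally show ?thesis using lam_pos \<delta>_bounds(1) by (simp add: Heavy_def mult_le_cancel_right)
qed

lemma low_walks_le_single_cycle:
  assumes I: "I = {i}" "3 \<le> half i" and w: "w \<in> V - High"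
  shows "low_walks w \<le> 6 * edge_const * (\<delta> * n)"
proof -
  define Heavy where "Heavy = {u \<in> second_nbhd w. \<delta> \<le> x u}"
  define Big where "Big = insert w (nbhd w \<union> Heavy)"
  have BigV: "Big \<subseteq> V" using w nbhd_subset second_nbhd_subset by (auto simp: Big_def Heavy_def)
  have "card Big \<le> Suc (card (nbhd w) + card Heavy)"
    unfolding Big_def by (rule card_insert_le_m1) (simp_all add: card_Un_le)
  then have card_Big: "card Big \<le> 3 * (\<delta> * n)"
    using degree_notin_High[OF w] card_heavy_second_nbhd_le[OF I, of w] \<delta>n_ge_1
    by (simp add: Heavy_def)
  have "low_walks w \<le> walk_weight (nbhd w) (Big \<union> (second_nbhd w - Heavy))"
    unfolding low_walks_def
  proof (rule walk_weight_mono)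
    fix a u assume au: "(a, u) \<in> parcs G" "a \<in> nbhd w - High" "u \<in> V - High"
    then have "a \<in> nbhd u \<inter> nbhd w" by (auto intro: arcs_symmetric)
    then have "u \<in> insert w (nbhd w) \<union> second_nbhd w"
      using au(3) by (auto simp: second_nbhd_def)
    then show "a \<in> nbhd w \<and> u \<in> Big \<union> (second_nbhd w - Heavy)"
      using au(2) by (auto simp: Big_def)
  qed
  also have "\<dots> \<le> walk_weight (nbhd w) Big + walk_weight (nbhd w) (second_nbhd w - Heavy)"
    by (rule walk_weight_Un_le)
  also have "walk_weight (nbhd w) Big \<le> 1 * real (edge_count (nbhd w) Big)"
    by (rule walk_weight_le_mult) (rule x_le_1)
  also have "\<dots> \<le> real (edge_const * (card (nbhd w) + card Big))"
    using edge_count_nbhd_le[OF order_refl BigV] by (simp only: of_nat_le_iff mult_1)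
  also have "\<dots> \<le> edge_const * (\<delta> * n + 3 * (\<delta> * n))"
    using card_Big degree_notin_High[OF w] by (simp add: mult_left_mono)
  also have "walk_weight (nbhd w) (second_nbhd w - Heavy)
      \<le> \<delta> * edge_count (nbhd w) (second_nbhd w - Heavy)"
    by (rule walk_weight_le_mult) (auto simp: Heavy_def)
  also have "\<dots> \<le> \<delta> * (2 * edge_const * n)"
  proof (rule mult_left_mono[OF edge_count_nbhd_V_le[OF order_refl]])
    show "second_nbhd w - Heavy \<subseteq> V" using second_nbhd_subset by blast
  qed (use \<delta>_bounds in simp)
  finally show ?thesis by (simp add: algebra_simps)
qed

lemma low_walks_le_branches:
  assumes w: "w \<in> V - High" and max: "\<And>v. v \<in> V - High \<Longrightarrow> x v \<le> x w"
    and half_le: "\<And>i. i \<in> I \<Longrightarrow> half i \<le> \<kappa>"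
  shows "low_walks w \<le> (\<kappa> * n - 3 / 4 * n) * x w"
proof -
  have "low_walks w \<le> x w * edge_count (nbhd w - High) (V - High)"
    unfolding low_walks_def by (rule walk_weight_le_mult) (rule max)
  also have "\<dots> \<le> x w * ((real \<kappa> - 1) * n + 1 / 4 * n)"
  proof (rule mult_left_mono)
    have "20 * edge_const * \<delta> \<le> 20 * edge_const * \<epsilon>"
      using \<delta>_bounds(2) by (intro mult_left_mono) auto
    then have "5 * edge_const * \<delta> \<le> 1 / 4" using \<epsilon>_bounds(3) by linarith
    then have "5 * edge_const * \<delta> * n \<le> 1 / 4 * n" by (rule mult_right_mono) simp
    then show "edge_count (nbhd w - High) (V - High) \<le> (real \<kappa> - 1) * n + 1 / 4 * n"
      using edge_count_notin_High_le[OF w half_le] by (simp add: mult.assoc)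
  qed (use x_nonneg w in blast)
  finally show ?thesis by (simp add: algebra_simps)
qed

lemma max_weight_notin_High_le:
  assumes w: "w \<in> V - High" and max: "\<And>v. v \<in> V - High \<Longrightarrow> x v \<le> x w"
  shows "x w \<le> light_const * \<delta>"
proof -
  let ?c = "real \<kappa> + 2 + 6 * edge_const"
  have xw: "0 \<le> x w" using x_nonneg w by blast
  note walks = lam_sq_mult_le_low_walks[OF w]
  have "n * x w \<le> 2 * (?c * (\<delta> * n))"
  proof (cases "\<exists>i. I = {i}")
    case True
    then obtain i where "I = {i}" "3 \<le> half i" using long_branch by auto
    then have "n * x w \<le> ?c * (\<delta> * n)"
      using mult_right_mono[OF n_le_lam_sq xw] walks low_walks_le_single_cycle[of i w] w
      by (simp add: algebra_simps)
    then show ?thesis using \<delta>n_ge_1 mult_left_mono[of 0 "\<delta> * n" ?c] by linarith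
  next
    case False
    have half_le: "half i \<le> \<kappa>" if "i \<in> I" for i
      using False half_le_\<kappa>[OF that] that by blast
    have "n * x w \<le> 2 * ((real \<kappa> + 2) * (\<delta> * n))"
      using walks mult_right_mono[OF lam_sq_ge_linear xw] low_walks_le_branches[OF w max half_le]
      by (simp add: algebra_simps)
    also have "\<dots> \<le> 2 * (?c * (\<delta> * n))"
      using \<delta>n_ge_1 by (intro mult_left_mono mult_right_mono) auto
    finally show ?thesis .
  qed
  then have "n * x w \<le> n * (light_const * \<delta>)" by (simp add: light_const_def algebra_simps)
  then show ?thesis using n_pos by (simp add: mult_le_cancel_left)
qed

lemma weight_notin_High_le:
  assumes v: "v \<in> V - High"
  shows "x v \<le> light_const * \<delta>"
proof -
  have fin: "finite (x ` (V - High))" "x ` (V - High) \<noteq> {}"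
    using v pair_finite_verts by auto
  then have "Max (x ` (V - High)) \<in> x ` (V - High)" by (rule Max_in)
  then obtain w where w: "w \<in> V - High" "x w = Max (x ` (V - High))" by auto
  have max: "x u \<le> x w" if "u \<in> V - High" for u
    unfolding w(2) using fin(1) that by (intro Max_ge) auto
  show ?thesis using max[OF v] max_weight_notin_High_le[OF w(1) max] by linarith
qed

end

section \<open>The hub vertices\<close>

lemma (in pair_graph) card_diff_common_nbhd_le:
  fixes d :: real
  assumes "finite S" "\<And>s. s \<in> S \<Longrightarrow> real (card V) - card (nbhd s) \<le> d"
  shows "card (V - common_nbhd S) \<le> card S * d"
proof -
  have "V - common_nbhd S \<subseteq> (\<Union>s\<in>S. V - nbhd s)" by (auto simp: common_nbhd_def)
  then have "card (V - common_nbhd S) \<le> card (\<Union>s\<in>S. V - nbhd s)"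
    using assms(1) pair_finite_verts by (intro card_mono) auto
  also have "\<dots> \<le> (\<Sum>s\<in>S. card (V - nbhd s))" by (rule card_UN_le[OF assms(1)])
  finally have "real (card (V - common_nbhd S)) \<le> (\<Sum>s\<in>S. real (card (V - nbhd s)))"
    by (simp flip: of_nat_sum)
  also have "\<dots> \<le> card S * d"
  proof (rule sum_bounded_above)
    fix s assume "s \<in> S"
    then show "real (card (V - nbhd s)) \<le> d"
      using assms(2)[of s] card_Diff_subset[OF finite_nbhd nbhd_subset, of s] card_nbhd_le[of s]
      by (simp)
  qed
  finally show ?thesis .
qed

context large_spectral_fan_free
begin

definition \<eta> :: real where
  "\<eta> = (real \<kappa> + 1) * (real weight_const + 2) * \<epsilon>"

definition Hubs :: "'a set" where
  "Hubs = {u \<in> High. 1 - \<epsilon> \<le> x u}"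

lemma \<eta>_small: "256 * (real \<kappa> + 1)\<^sup>2 * edge_const * \<eta> \<le> 1"
proof -
  have "256 * (real \<kappa> + 1)\<^sup>2 * edge_const * \<eta> = precision * \<epsilon>"
    by (simp add: \<eta>_def precision_def power2_eq_square power3_eq_cube algebra_simps)
  then show ?thesis using precision_ge(1) by (simp add: \<epsilon>_def)
qed

lemma \<eta>_bounds: "\<epsilon> \<le> \<eta>" "(real weight_const + 2) * \<epsilon> \<le> \<eta>" "\<eta> \<le> 1 / 4"
proof -
  have nonneg: "0 \<le> (real weight_const + 2) * \<epsilon>" using \<epsilon>_bounds(1) by simp
  show le: "(real weight_const + 2) * \<epsilon> \<le> \<eta>"
    unfolding \<eta>_def mult.assoc using nonneg mult_right_mono[of 1 "real \<kappa> + 1", OF _ nonneg] by simp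
  have "1 * \<epsilon> \<le> (real weight_const + 2) * \<epsilon>" using \<epsilon>_bounds(1) by (intro mult_right_mono) auto
  then show "\<epsilon> \<le> \<eta>" using le by linarith
  moreover have "1 \<le> (real \<kappa> + 1)\<^sup>2" by (rule one_le_power) simp
  ultimately have "4 * 1 * 1 * \<eta> \<le> 256 * (real \<kappa> + 1)\<^sup>2 * edge_const * \<eta>"
    using \<epsilon>_bounds(1) edge_const_pos(1) by (intro mult_mono) auto
  then show "\<eta> \<le> 1 / 4" using \<eta>_small by linarith
qed

lemma low_walks_le: "low_walks v \<le> (real weight_const - 2) * (\<delta> * n)"
proof -
  have "low_walks v \<le> (light_const * \<delta>) * edge_count (nbhd v - High) (V - High)"
    unfolding low_walks_def by (rule walk_weight_le_mult) (rule weight_notin_High_le)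
  also have "\<dots> \<le> (light_const * \<delta>) * (2 * edge_const * n)"
    using \<delta>_bounds(1) by (intro mult_left_mono edge_count_nbhd_V_le[of _ v]) auto
  finally show ?thesis by (simp add: weight_const_def algebra_simps)
qed

lemma weight_le_codegree_weight:
  assumes v: "v \<in> V"
  shows "\<kappa> * n * x v \<le> codegree_weight v + weight_const * (\<delta> * n)"
proof -
  have "(real \<kappa> * (n - real \<kappa>)) * x v \<le> lam\<^sup>2 * x v"
    by (rule mult_right_mono[OF lam_sq_ge x_nonneg[OF v]])
  moreover have "(real \<kappa>)\<^sup>2 * x v \<le> \<delta> * n"
    using mult_left_le[OF x_le_1[OF v], of "(real \<kappa>)\<^sup>2"] \<kappa>_sq_le by simp
  ultimately have "\<kappa> * n * x v - \<delta> * n \<le> lam\<^sup>2 * x v"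
    by (simp add: algebra_simps power2_eq_square)
  then show ?thesis
    using lam_sq_mult_le_High[OF v] low_walks_le[of v] by (simp add: algebra_simps)
qed

lemma weight_le_degree:
  assumes v: "v \<in> V"
  shows "n * x v \<le> card (nbhd v) + (real weight_const + 1) * (\<delta> * n)"
proof -
  let ?r = "(real weight_const + 1) * (\<delta> * n)"
  have "\<kappa> * (n * x v) \<le> \<kappa> * card (nbhd v) + ?r"
    using weight_le_codegree_weight[OF v] codegree_weight_le[of v] by (simp add: algebra_simps)
  also have "?r \<le> \<kappa> * ?r"
    using \<kappa>_ge_2 \<delta>n_ge_1 mult_right_mono[of 1 "real \<kappa>" ?r] by simp
  finally have "\<kappa> * (n * x v) \<le> \<kappa> * (card (nbhd v) + ?r)" by (simp add: distrib_left)
  then show ?thesis using \<kappa>_ge_2 by (simp add: mult_le_cancel_left)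
qed

lemma Hubs_subset: "Hubs \<subseteq> V" "finite Hubs"
  using High_subset finite_if_subset_V[of Hubs] by (auto simp: Hubs_def)

lemma degree_deficit_Hubs_le:
  assumes "u \<in> Hubs"
  shows "n - card (nbhd u) \<le> (real weight_const + 2) * \<epsilon> * n"
proof -
  have u: "u \<in> V" "1 - \<epsilon> \<le> x u" using assms High_subset by (auto simp: Hubs_def)
  have "n * (1 - \<epsilon>) \<le> n * x u" by (rule mult_left_mono[OF u(2)]) simp
  moreover have "(real weight_const + 1) * (\<delta> * n) \<le> (real weight_const + 1) * (\<epsilon> * n)"
    using \<delta>_bounds(2) by (intro mult_left_mono mult_right_mono) auto
  ultimately show ?thesis using weight_le_degree[OF u(1)] by (simp add: algebra_simps)
qed

lemma card_diff_common_nbhd_Hubs_le: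
  assumes "S \<subseteq> Hubs" "card S \<le> \<kappa> + 1"
  shows "card (V - common_nbhd S) \<le> \<eta> * n"
proof -
  have "card (V - common_nbhd S) \<le> card S * ((real weight_const + 2) * \<epsilon> * n)"
    using assms(1) degree_deficit_Hubs_le finite_subset[OF assms(1) Hubs_subset(2)]
    by (intro card_diff_common_nbhd_le) auto
  also have "\<dots> \<le> (real \<kappa> + 1) * ((real weight_const + 2) * \<epsilon> * n)"
    using assms(2) \<epsilon>_bounds(1) by (intro mult_right_mono) auto
  finally show ?thesis by (simp add: \<eta>_def mult.assoc)
qed

lemma card_Hubs_le: "card Hubs \<le> \<kappa>"
proof (rule ccontr)
  assume "\<not> card Hubs \<le> \<kappa>"
  then obtain S where S: "S \<subseteq> Hubs" "card S = Suc \<kappa>" by (meson not_less_eq_eq obtain_subset_with_card_n)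
  have "card (common_nbhd S) < \<sigma>"
    using S Hubs_subset(1) by (intro card_common_nbhd_less) auto
  moreover have "card (V - common_nbhd S) \<le> \<eta> * n" using S by (intro card_diff_common_nbhd_Hubs_le) auto
  moreover have "\<eta> * n \<le> 1 / 4 * n" by (rule mult_right_mono[OF \<eta>_bounds(3)]) simp
  ultimately show False using card_diff_common_nbhd[of S] n_ge(2) n_pos by linarith
qed

text \<open>
  At the vertex \<open>z\<close> of weight 1 the codegree bound \<open>\<kappa> n + \<delta> n\<close> is almost attained, so a vertex of
  \<open>High\<close> of weight below \<open>1 - \<epsilon>\<close> can only have small codegree with \<open>z\<close>.
\<close>

lemma codegree_sum_not_Hubs_le:
  "(\<Sum>u\<in>High - Hubs. real (card (nbhd z \<inter> nbhd u))) \<le> (real weight_const + 1) * (\<epsilon> * n)"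
proof -
  let ?c = "\<lambda>u. real (card (nbhd z \<inter> nbhd u))"
  have "\<epsilon> * sum ?c (High - Hubs) \<le> (\<Sum>u\<in>High - Hubs. ?c u * (1 - x u))"
    unfolding sum_distrib_left
  proof (rule sum_mono)
    fix u assume "u \<in> High - Hubs"
    then have "\<epsilon> \<le> 1 - x u" by (auto simp: Hubs_def)
    then show "\<epsilon> * ?c u \<le> ?c u * (1 - x u)" by (subst mult.commute) (rule mult_left_mono, auto)
  qed
  also have "\<dots> \<le> (\<Sum>u\<in>High. ?c u * (1 - x u))"
    by (rule sum_mono2) (use High_subset finite_if_subset_V x_le_1 in auto)
  also have "\<dots> = sum ?c High - codegree_weight z"
    by (simp add: codegree_weight_def right_diff_distrib sum_subtractf)
  also have "\<dots> \<le> (real weight_const + 1) * (\<delta> * n)"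
  proof -
    have "\<kappa> * card (nbhd z) \<le> \<kappa> * card V" using card_nbhd_le by simp
    then have "real (\<kappa> * card (nbhd z)) \<le> real (\<kappa> * card V)" by (simp only: of_nat_le_iff)
    then show ?thesis
      using codegree_sum_High_le[of z] weight_le_codegree_weight[OF z_in] x_z
      by (simp add: algebra_simps)
  qed
  also have "\<dots> = \<epsilon> * ((real weight_const + 1) * (\<epsilon> * n))" by (simp add: \<delta>_def power2_eq_square)
  finally show ?thesis using \<epsilon>_bounds(1) by (simp add: mult_le_cancel_left)
qed

lemma card_Hubs: "card Hubs = \<kappa>"
proof -
  let ?c = "\<lambda>u. real (card (nbhd z \<inter> nbhd u))"
  have codegree_mult_weight_le: "?c u * x u \<le> ?c u" if "u \<in> High" for u
    using that x_le_1 High_subset by (intro mult_left_le) auto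
  have "Hubs \<subseteq> High" by (auto simp: Hubs_def)
  then have "codegree_weight z = (\<Sum>u\<in>Hubs. ?c u * x u) + (\<Sum>u\<in>High - Hubs. ?c u * x u)"
    using sum.subset_diff[of Hubs High "\<lambda>u. ?c u * x u"] finite_if_subset_V[OF High_subset]
    by (simp add: codegree_weight_def)
  moreover have "(\<Sum>u\<in>Hubs. ?c u * x u) \<le> card Hubs * n"
  proof (rule sum_bounded_above)
    fix u assume "u \<in> Hubs"
    then have "?c u * x u \<le> ?c u" using codegree_mult_weight_le \<open>Hubs \<subseteq> High\<close> by blast
    also have "?c u \<le> n"
      unfolding of_nat_le_iff using nbhd_subset by (intro card_mono pair_finite_verts) auto
    finally show "?c u * x u \<le> n" .
  qed
  moreover have "(\<Sum>u\<in>High - Hubs. ?c u * x u) \<le> sum ?c (High - Hubs)"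
    using codegree_mult_weight_le by (intro sum_mono) auto
  ultimately have "\<kappa> * n \<le> card Hubs * n + (real weight_const + 1) * (\<epsilon> * n) + weight_const * (\<delta> * n)"
    using weight_le_codegree_weight[OF z_in] x_z codegree_sum_not_Hubs_le by simp
  also have "\<dots> \<le> card Hubs * n + (real weight_const + 1) * (\<epsilon> * n) + weight_const * (\<epsilon> * n)"
    using \<delta>_bounds(2) by (intro add_left_mono mult_left_mono mult_right_mono) auto
  finally have "\<kappa> * n \<le> (card Hubs + (2 * real weight_const + 1) * \<epsilon>) * n" by (simp add: algebra_simps)
  then have "real \<kappa> \<le> card Hubs + (2 * real weight_const + 1) * \<epsilon>"
    using n_pos by (simp add: mult_le_cancel_right)
  moreover have "(2 * real weight_const + 1) * \<epsilon> < 1"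
    using \<eta>_bounds \<epsilon>_bounds(1) by (simp add: algebra_simps)
  ultimately show ?thesis using card_Hubs_le by linarith
qed

lemma weight_notin_Hubs_le:
  assumes v: "v \<in> V - Hubs"
  shows "x v \<le> \<eta>"
proof -
  let ?C = "common_nbhd Hubs"
  have "nbhd v \<subseteq> (nbhd v \<inter> ?C) \<union> (V - ?C)" using nbhd_subset by blast
  then have "card (nbhd v) \<le> card ((nbhd v \<inter> ?C) \<union> (V - ?C))"
    using pair_finite_verts by (intro card_mono) auto
  also have "\<dots> \<le> card (nbhd v \<inter> ?C) + card (V - ?C)" by (rule card_Un_le)
  also have "card (nbhd v \<inter> ?C) \<le> \<sigma>"
    using card_nbhd_Int_common_nbhd_less[OF Hubs_subset(1) card_Hubs v] by simp
  finally have "card (nbhd v) \<le> \<sigma> + card (V - ?C)" by simp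
  moreover have "card (V - ?C) \<le> \<kappa> * ((real weight_const + 2) * \<epsilon> * n)"
    using card_diff_common_nbhd_le[OF Hubs_subset(2) degree_deficit_Hubs_le] by (simp add: card_Hubs)
  ultimately have "card (nbhd v) \<le> \<epsilon> * n + \<kappa> * ((real weight_const + 2) * \<epsilon> * n)"
    using \<sigma>_le_\<epsilon>n by linarith
  moreover have "(real weight_const + 1) * (\<delta> * n) \<le> (real weight_const + 1) * (\<epsilon> * n)"
    using \<delta>_bounds(2) by (intro mult_left_mono mult_right_mono) auto
  ultimately have "n * x v \<le> n * \<eta>"
    using weight_le_degree[of v] v by (simp add: \<eta>_def algebra_simps)
  then show ?thesis using n_pos by (simp add: mult_le_cancel_left)
qed

end

section \<open>Comparison with the extremal graph\<close>

context spectral_fan_free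
begin

definition form_between :: "'a set \<Rightarrow> 'a set \<Rightarrow> real" where
  "form_between A B = (\<Sum>(u, v)\<in>parcs G \<inter> A \<times> B. x u * x v)"

lemma form_between_eq_sum:
  "finite A \<Longrightarrow> form_between A B = (\<Sum>a\<in>A. x a * sum x (nbhd a \<inter> B))"
  unfolding form_between_def by (subst sum_arcs_between) (simp_all add: sum_distrib_left)

lemma form_between_commute: "form_between A B = form_between B A"
  unfolding form_between_def by (subst sum_arcs_swap) (simp add: mult.commute)

lemma lam_sum_sq_le_adj_form: "lam * (\<Sum>v\<in>V. (x v)\<^sup>2) \<le> adj_form x"
proof -
  have "lam * (\<Sum>v\<in>V. (x v)\<^sup>2) = (\<Sum>v\<in>V. x v * (lam * x v))"
    by (simp add: sum_distrib_left power2_eq_square mult.left_commute)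
  also have "\<dots> \<le> (\<Sum>v\<in>V. x v * sum x (nbhd v))"
    by (intro sum_mono mult_left_mono subinvariant x_nonneg)
  finally show ?thesis by (simp only: adj_form_eq_sum_nbhd)
qed

lemma sum_degree_mult_sq_le:
  assumes A: "A \<subseteq> V"
  shows "(\<Sum>v\<in>A. card (nbhd v \<inter> A) * (\<Sum>u\<in>nbhd v \<inter> A. (x u)\<^sup>2))
    \<le> 2 * real edge_const * card A * (\<Sum>v\<in>A. (x v)\<^sup>2)"
proof -
  have fin: "finite A" by (rule finite_if_subset_V[OF A])
  have "(\<Sum>v\<in>A. card (nbhd v \<inter> A) * (\<Sum>u\<in>nbhd v \<inter> A. (x u)\<^sup>2))
      = (\<Sum>(v, u)\<in>parcs G \<inter> A \<times> A. card (nbhd v \<inter> A) * (x u)\<^sup>2)"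
    by (simp add: sum_arcs_between[OF fin] sum_distrib_left)
  also have "\<dots> = (\<Sum>(u, v)\<in>parcs G \<inter> A \<times> A. card (nbhd v \<inter> A) * (x u)\<^sup>2)"
    by (rule sum_arcs_swap)
  also have "\<dots> = (\<Sum>u\<in>A. edge_count (nbhd u \<inter> A) A * (x u)\<^sup>2)"
    by (simp add: sum_arcs_between[OF fin] edge_count_eq_sum sum_distrib_right)
  also have "\<dots> \<le> (\<Sum>u\<in>A. 2 * real edge_const * card A * (x u)\<^sup>2)"
  proof (intro sum_mono mult_right_mono)
    fix u
    have "edge_count (nbhd u \<inter> A) A \<le> edge_const * (card (nbhd u \<inter> A) + card A)"
      by (rule edge_count_nbhd_le[OF _ A]) auto
    also have "\<dots> \<le> edge_const * (card A + card A)"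
      using fin by (intro mult_le_mono2 add_right_mono card_mono) auto
    finally have "real (edge_count (nbhd u \<inter> A) A) \<le> real (edge_const * (card A + card A))"
      by (simp only: of_nat_le_iff)
    then show "real (edge_count (nbhd u \<inter> A) A) \<le> 2 * real edge_const * card A" by simp
  qed simp
  finally show ?thesis by (simp add: sum_distrib_left)
qed

lemma form_between_self_sq_le:
  assumes A: "A \<subseteq> V"
  shows "(form_between A A)\<^sup>2 \<le> 2 * real edge_const * card A * (\<Sum>v\<in>A. (x v)\<^sup>2)\<^sup>2"
proof -
  let ?q = "\<Sum>v\<in>A. (x v)\<^sup>2"
  have "(form_between A A)\<^sup>2 \<le> ?q * (\<Sum>v\<in>A. (sum x (nbhd v \<inter> A))\<^sup>2)"
    unfolding form_between_eq_sum[OF finite_if_subset_V[OF A]] by (rule Cauchy_Schwarz_ineq_sum)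
  also have "\<dots> \<le> ?q * (\<Sum>v\<in>A. card (nbhd v \<inter> A) * (\<Sum>u\<in>nbhd v \<inter> A. (x u)\<^sup>2))"
  proof (intro mult_left_mono sum_mono)
    fix v
    show "(sum x (nbhd v \<inter> A))\<^sup>2 \<le> card (nbhd v \<inter> A) * (\<Sum>u\<in>nbhd v \<inter> A. (x u)\<^sup>2)"
      using Cauchy_Schwarz_ineq_sum[of "\<lambda>_. 1" x "nbhd v \<inter> A"] by simp
  qed (simp add: sum_nonneg)
  also have "\<dots> \<le> ?q * (2 * real edge_const * card A * ?q)"
    by (rule mult_left_mono[OF sum_degree_mult_sq_le[OF A]]) (simp add: sum_nonneg)
  finally show ?thesis by (simp add: power2_eq_square mult.left_commute)
qed

end

locale near_extremal = spectral_fan_free G I half cyclic x lam z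
  for G :: "'a pair_pre_digraph" and I :: "'i set" and half cyclic x lam z +
  fixes L :: "'a set" and \<eta> :: real
  assumes L_subset: "L \<subseteq> V" and card_L: "card L = \<kappa>"
    and weight_L: "v \<in> L \<Longrightarrow> 3 / 4 \<le> x v"
    and weight_notin_L: "v \<in> V - L \<Longrightarrow> x v \<le> \<eta>"
    and card_diff_common: "card (V - common_nbhd L) \<le> \<eta> * n"
    and \<eta>_small: "256 * (real \<kappa> + 1)\<^sup>2 * real edge_const * \<eta> \<le> 1"
begin

definition Rest :: "'a set" where
  "Rest = V - L - common_nbhd L"

lemma Rest_subset: "Rest \<subseteq> V" "finite Rest"
  using finite_if_subset_V[of Rest] by (auto simp: Rest_def)

lemma \<eta>_nonneg: "0 \<le> \<eta>"
proof -
  have "0 \<le> \<eta> * n" using card_diff_common by (rule order_trans[rotated]) simp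
  then show ?thesis using n_pos mult_neg_pos[of \<eta> n] by linarith
qed

lemma \<sigma>_mult_\<eta>_le: "16 * \<sigma> * \<eta> \<le> 1" "4 * \<eta> \<le> 1"
proof -
  have multiple_le_1: "real k * \<eta> \<le> 1" if "k \<le> 256 * edge_const" for k
  proof -
    have "1 \<le> (real \<kappa> + 1)\<^sup>2" by (rule one_le_power) simp
    then have "1 * real k \<le> (real \<kappa> + 1)\<^sup>2 * real (256 * edge_const)"
      by (rule mult_mono) (use that in \<open>simp_all only: of_nat_le_iff of_nat_0_le_iff zero_le_power2\<close>)
    then have "1 * real k * \<eta> \<le> (real \<kappa> + 1)\<^sup>2 * real (256 * edge_const) * \<eta>"
      by (rule mult_right_mono[OF _ \<eta>_nonneg])
    then show ?thesis using \<eta>_small by (simp add: mult.commute mult.left_commute)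
  qed
  show "16 * \<sigma> * \<eta> \<le> 1" using multiple_le_1[of "16 * \<sigma>"] by (simp add: edge_const_def)
  show "4 * \<eta> \<le> 1" using multiple_le_1[of 4] by (simp add: edge_const_def)
qed

lemma \<sigma>_le_card_common: "\<sigma> \<le> card (common_nbhd L)"
proof -
  have "\<eta> * n \<le> 1 / 4 * n"
    using \<sigma>_mult_\<eta>_le(2) by (intro mult_right_mono) auto
  then show ?thesis using card_diff_common_nbhd[of L] card_diff_common n_ge(2) n_pos by linarith
qed

lemma weight_into_common_le:
  assumes "v \<in> V - L"
  shows "sum x (nbhd v \<inter> common_nbhd L) \<le> 1 / 16"
proof -
  have "sum x (nbhd v \<inter> common_nbhd L) \<le> card (nbhd v \<inter> common_nbhd L) * \<eta>"
    using weight_notin_L common_nbhd_subset common_nbhd_disjoint by (intro sum_bounded_above) blast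
  also have "\<dots> \<le> \<sigma> * \<eta>"
    using card_nbhd_Int_common_nbhd_less[OF L_subset card_L assms] \<eta>_nonneg
    by (intro mult_right_mono) auto
  finally show ?thesis using \<sigma>_mult_\<eta>_le(1) by simp
qed

lemma form_Rest_common_le: "form_between Rest (common_nbhd L) \<le> sum x Rest / 16"
proof -
  have "form_between Rest (common_nbhd L) \<le> (\<Sum>v\<in>Rest. x v * (1 / 16))"
    unfolding form_between_eq_sum[OF Rest_subset(2)]
    using x_nonneg by (intro sum_mono mult_left_mono weight_into_common_le) (auto simp: Rest_def)
  then show ?thesis by (simp add: sum_divide_distrib)
qed

lemma lam_sum_sq_Rest_le:
  "lam * (\<Sum>v\<in>Rest. (x v)\<^sup>2) \<le> (real \<kappa> + 1) * sum x Rest + form_between Rest Rest"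
proof -
  have "lam * x v \<le> (real \<kappa> + 1) + sum x (nbhd v \<inter> Rest)" if v: "v \<in> Rest" for v
  proof -
    have vV: "v \<in> V - L" using v by (auto simp: Rest_def)
    have "nbhd v = (nbhd v \<inter> L) \<union> (nbhd v \<inter> common_nbhd L) \<union> (nbhd v \<inter> Rest)"
      using nbhd_subset[of v] by (auto simp: Rest_def)
    then have "sum x (nbhd v)
        = sum x ((nbhd v \<inter> L) \<union> (nbhd v \<inter> common_nbhd L) \<union> (nbhd v \<inter> Rest))"
      by (rule arg_cong)
    also have "\<dots> = sum x ((nbhd v \<inter> L) \<union> (nbhd v \<inter> common_nbhd L)) + sum x (nbhd v \<inter> Rest)"
      by (rule sum.union_disjoint) (auto simp: Rest_def)
    also have "sum x ((nbhd v \<inter> L) \<union> (nbhd v \<inter> common_nbhd L))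
        = sum x (nbhd v \<inter> L) + sum x (nbhd v \<inter> common_nbhd L)"
      using common_nbhd_disjoint[of L] by (intro sum.union_disjoint) auto
    finally have split: "sum x (nbhd v)
        = sum x (nbhd v \<inter> L) + sum x (nbhd v \<inter> common_nbhd L) + sum x (nbhd v \<inter> Rest)" .
    have "sum x (nbhd v \<inter> L) \<le> real (card (nbhd v \<inter> L)) * 1"
      using x_le_1 L_subset by (intro sum_bounded_above) auto
    moreover have "card (nbhd v \<inter> L) \<le> \<kappa>"
      unfolding card_L[symmetric] using finite_if_subset_V[OF L_subset] by (intro card_mono) auto
    ultimately show ?thesis
      using subinvariant[of v] weight_into_common_le[OF vV] vV split by simp
  qed
  then have "(\<Sum>v\<in>Rest. x v * (lam * x v)) \<le> (\<Sum>v\<in>Rest. x v * ((real \<kappa> + 1) + sum x (nbhd v \<inter> Rest)))"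
    using x_nonneg Rest_subset(1) by (intro sum_mono mult_left_mono) auto
  also have "\<dots> = sum x Rest * (real \<kappa> + 1) + form_between Rest Rest"
    by (simp only: form_between_eq_sum[OF Rest_subset(2)] distrib_left[of _ "real \<kappa> + 1"] sum.distrib
        sum_distrib_right)
  also have "(\<Sum>v\<in>Rest. x v * (lam * x v)) = lam * (\<Sum>v\<in>Rest. (x v)\<^sup>2)"
    by (simp add: sum_distrib_left power2_eq_square mult.left_commute)
  finally show ?thesis by (simp only: mult.commute)
qed

lemma edge_const_mult_card_Rest_le:
  "2 * real edge_const * card Rest \<le> (1 / (8 * (real \<kappa> + 1)))\<^sup>2 * lam\<^sup>2"
proof -
  let ?c = "(real \<kappa> + 1)\<^sup>2"
  have "card Rest \<le> card (V - common_nbhd L)"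
    using pair_finite_verts by (intro card_mono) (auto simp: Rest_def)
  then have "2 * real edge_const * card Rest \<le> 2 * real edge_const * (\<eta> * n)"
    using card_diff_common by (intro mult_left_mono) auto
  also have "\<dots> = (2 * real edge_const * \<eta>) * n" by simp
  also have "\<dots> \<le> 1 / (64 * ?c) * lam\<^sup>2"
  proof (rule mult_mono[OF _ n_le_lam_sq])
    have "0 < ?c" by (rule zero_less_power) simp
    moreover have "2 * real edge_const * \<eta> * (64 * ?c) \<le> 1"
      using \<eta>_small \<eta>_nonneg by (simp add: mult.commute mult.left_commute)
    ultimately show "2 * real edge_const * \<eta> \<le> 1 / (64 * ?c)"
      by (simp add: pos_le_divide_eq)
  qed auto
  finally show ?thesis by (simp only: power_divide power_mult_distrib) simp
qed

lemma form_Rest_self_le: "form_between Rest Rest \<le> sum x Rest / 4"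
proof -
  define \<theta> where "\<theta> = 1 / (8 * (real \<kappa> + 1))"
  define q where "q = (\<Sum>v\<in>Rest. (x v)\<^sup>2)"
  have \<theta>: "0 < \<theta>" "\<theta> \<le> 1 / 2" by (auto simp: \<theta>_def field_simps)
  have lam_q: "0 \<le> lam * q" using lam_nonneg by (simp add: q_def sum_nonneg)
  have "(form_between Rest Rest)\<^sup>2 \<le> 2 * real edge_const * card Rest * q\<^sup>2"
    unfolding q_def by (rule form_between_self_sq_le[OF Rest_subset(1)])
  also have "\<dots> \<le> \<theta>\<^sup>2 * lam\<^sup>2 * q\<^sup>2"
    unfolding \<theta>_def by (rule mult_right_mono[OF edge_const_mult_card_Rest_le]) simp
  also have "\<dots> = (\<theta> * (lam * q))\<^sup>2"
    by (simp only: power_mult_distrib mult.assoc)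
  finally have form_le: "form_between Rest Rest \<le> \<theta> * (lam * q)"
    by (rule power2_le_imp_le) (use \<theta>(1) lam_q in simp)
  also have "\<dots> \<le> 1 / 2 * (lam * q)" by (rule mult_right_mono[OF \<theta>(2) lam_q])
  finally have "lam * q \<le> 2 * ((real \<kappa> + 1) * sum x Rest)"
    using lam_sum_sq_Rest_le unfolding q_def[symmetric] by simp
  then have "\<theta> * (lam * q) \<le> \<theta> * (2 * ((real \<kappa> + 1) * sum x Rest))"
    using \<theta>(1) by (intro mult_left_mono) auto
  also have "\<dots> = sum x Rest / 4" by (simp add: \<theta>_def field_simps)
  finally show ?thesis using form_le by linarith
qed

lemma arcs_outside_S_plus_subset:
  assumes "\<And>u v. u \<in> common_nbhd L \<Longrightarrow> v \<in> common_nbhd L \<Longrightarrow> (u, v) \<in> parcs G \<Longrightarrow> {u, v} = {r, s}"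
  shows "parcs G - parcs (S_plus_on V L r s)
    \<subseteq> (Rest \<times> (Rest \<union> common_nbhd L)) \<union> (common_nbhd L \<times> Rest)"
proof
  fix e assume e: "e \<in> parcs G - parcs (S_plus_on V L r s)"
  obtain u v where uv: "e = (u, v)" by fastforce
  then have "u \<in> V - L" "v \<in> V - L" "\<not> (u \<in> common_nbhd L \<and> v \<in> common_nbhd L)"
    using e assms[of u v] in_arcsD1[of u v] in_arcsD2[of u v] no_loops'[of u v] by auto
  then show "e \<in> (Rest \<times> (Rest \<union> common_nbhd L)) \<union> (common_nbhd L \<times> Rest)"
    by (auto simp: uv Rest_def)
qed

lemma sum_lost_arcs_le:
  assumes "\<And>u v. u \<in> common_nbhd L \<Longrightarrow> v \<in> common_nbhd L \<Longrightarrow> (u, v) \<in> parcs G \<Longrightarrow> {u, v} = {r, s}"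
  shows "(\<Sum>(u, v)\<in>parcs G - parcs (S_plus_on V L r s). x u * x v) \<le> 3 / 8 * sum x Rest"
proof -
  let ?R = "common_nbhd L"
  let ?f = "\<lambda>(u, v). x u * x v"
  have disjoint: "Rest \<inter> ?R = {}" by (auto simp: Rest_def)
  have "sum ?f (parcs G - parcs (S_plus_on V L r s))
      \<le> sum ?f ((parcs G \<inter> Rest \<times> Rest) \<union> (parcs G \<inter> Rest \<times> ?R) \<union> (parcs G \<inter> ?R \<times> Rest))"
  proof (rule sum_mono2)
    show "parcs G - parcs (S_plus_on V L r s)
        \<subseteq> (parcs G \<inter> Rest \<times> Rest) \<union> (parcs G \<inter> Rest \<times> ?R) \<union> (parcs G \<inter> ?R \<times> Rest)"
      using arcs_outside_S_plus_subset[OF assms] by blast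
  qed (use x_nonneg in_arcsD1 in_arcsD2 in auto)
  also have "\<dots> = form_between Rest Rest + form_between Rest ?R + form_between ?R Rest"
    unfolding form_between_def using disjoint by (subst sum.union_disjoint; auto)+
  also have "\<dots> \<le> sum x Rest / 4 + sum x Rest / 16 + sum x Rest / 16"
    unfolding form_between_commute[of ?R] by (intro add_mono form_Rest_self_le form_Rest_common_le)
  finally show ?thesis by simp
qed

lemma sum_gained_arcs_ge:
  "3 / 4 * sum x Rest \<le> (\<Sum>(u, v)\<in>parcs (S_plus_on V L r s) - parcs G. x u * x v)"
proof -
  have "\<forall>v\<in>Rest. \<exists>l\<in>L. (v, l) \<notin> parcs G"
    using arcs_symmetric by (fastforce simp: Rest_def common_nbhd_def)
  then obtain l where l: "\<And>v. v \<in> Rest \<Longrightarrow> l v \<in> L" "\<And>v. v \<in> Rest \<Longrightarrow> (v, l v) \<notin> parcs G"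
    by metis
  have "3 / 4 * sum x Rest = (\<Sum>v\<in>Rest. x v * (3 / 4))" by (simp add: sum_distrib_left mult.commute)
  also have "\<dots> \<le> (\<Sum>v\<in>Rest. x v * x (l v))"
    using l(1) Rest_subset(1) x_nonneg weight_L by (intro sum_mono mult_left_mono) auto
  also have "\<dots> = (\<Sum>(u, v)\<in>(\<lambda>v. (v, l v)) ` Rest. x u * x v)"
    by (subst sum.reindex) (auto simp: inj_on_def)
  also have "\<dots> \<le> (\<Sum>(u, v)\<in>parcs (S_plus_on V L r s) - parcs G. x u * x v)"
  proof (rule sum_mono2)
    show "finite (parcs (S_plus_on V L r s) - parcs G)"
      by (rule finite_subset[of _ "V \<times> V"]) auto
    show "(\<lambda>v. (v, l v)) ` Rest \<subseteq> parcs (S_plus_on V L r s) - parcs G"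
    proof
      fix e assume "e \<in> (\<lambda>v. (v, l v)) ` Rest"
      then obtain v where v: "v \<in> Rest" "e = (v, l v)" by blast
      have "v \<in> V - L" "l v \<in> L" "l v \<in> V" using v(1) l(1)[OF v(1)] L_subset by (auto simp: Rest_def)
      then show "e \<in> parcs (S_plus_on V L r s) - parcs G" using v l(2)[OF v(1)] by auto
    qed
  qed (use x_nonneg in auto)
  finally show ?thesis .
qed

lemma eq_S_plus_on:
  fixes \<mu> :: real
  assumes root: "S_plus_root (card V) \<kappa> \<mu>" and "\<mu> \<le> lam"
  obtains r s where "S_plus_data V L r s" "G = S_plus_on V L r s"
proof -
  obtain r s where rs: "r \<in> common_nbhd L" "s \<in> common_nbhd L" "r \<noteq> s"
      and edges: "\<And>u v. u \<in> common_nbhd L \<Longrightarrow> v \<in> common_nbhd L \<Longrightarrow> (u, v) \<in> parcs G \<Longrightarrow> {u, v} = {r, s}"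
    using common_nbhd_edge_unique[OF L_subset card_L \<sigma>_le_card_common] by blast
  interpret S_plus_data V L r s
    using rs common_nbhd_subset[of L] common_nbhd_disjoint[of L] L_subset pair_finite_verts
    by unfold_locales auto
  let ?S = "S_plus_on V L r s" and ?f = "\<lambda>(u, v). x u * x v"
  obtain c where c: "c \<in> L" using card_L \<kappa>_ge_2 by fastforce
  have root': "S_plus_root (card V) (card L) \<mu>" using root card_L by simp
  have "S.adj_form x \<le> \<mu> * (\<Sum>v\<in>V. (x v)\<^sup>2)"
    by (rule adj_form_S_plus_on_le[OF root']) (use c in blast)
  moreover have "lam * (\<Sum>v\<in>V. (x v)\<^sup>2) \<le> adj_form x" by (rule lam_sum_sq_le_adj_form)
  moreover have "\<mu> * (\<Sum>v\<in>V. (x v)\<^sup>2) \<le> lam * (\<Sum>v\<in>V. (x v)\<^sup>2)"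
    by (rule mult_right_mono[OF assms(2)]) (simp add: sum_nonneg)
  moreover have diff: "S.adj_form x - adj_form x
      = sum ?f (parcs ?S - parcs G) - sum ?f (parcs G - parcs ?S)"
    by (rule adj_form_diff[OF pair_graph_S_plus_on])
  moreover have "0 \<le> sum x Rest" using x_nonneg Rest_subset(1) by (intro sum_nonneg) auto
  ultimately have eqs: "S.adj_form x = \<mu> * (\<Sum>v\<in>V. (x v)\<^sup>2)" "sum x Rest = 0" "S.adj_form x = adj_form x"
    using sum_lost_arcs_le[OF edges] sum_gained_arcs_ge[of r s] by linarith+
  have x_pos: "0 < x v" if "v \<in> V" for v
    using pos_if_adj_form_S_plus_on_eq[OF root' eqs(1) c _ that] weight_L[OF c] by simp
  have "Rest = {}"
  proof (rule ccontr)
    assume "Rest \<noteq> {}"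
    then have "0 < sum x Rest" using x_pos Rest_subset by (intro sum_pos) auto
    then show False using eqs(2) by simp
  qed
  then have G_sub: "parcs G - parcs ?S = {}" using arcs_outside_S_plus_subset[OF edges] by blast
  then have "sum ?f (parcs ?S - parcs G) = 0" using diff eqs(3) unfolding G_sub by simp
  moreover have "0 < sum ?f (parcs ?S - parcs G)" if "parcs ?S - parcs G \<noteq> {}"
    using that x_pos S.pair_finite_arcs by (intro sum_pos) auto
  ultimately have "parcs ?S - parcs G = {}" by force
  then have "G = ?S" using G_sub by (intro pair_pre_digraph.equality) auto
  then show thesis using that S_plus_data_axioms by blast
qed

end

section \<open>The main theorem\<close>

lemma (in large_spectral_fan_free) near_extremal_Hubs: "near_extremal G I half cyclic x lam z Hubs \<eta>"
proof
  show "Hubs \<subseteq> V" "card Hubs = \<kappa>" by (rule Hubs_subset card_Hubs)+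
  show "3 / 4 \<le> x v" if "v \<in> Hubs" for v using that \<eta>_bounds by (simp add: Hubs_def)
  show "x v \<le> \<eta>" if "v \<in> V - Hubs" for v by (rule weight_notin_Hubs_le[OF that])
  show "card (V - common_nbhd Hubs) \<le> \<eta> * n"
    by (rule card_diff_common_nbhd_Hubs_le) (simp_all add: card_Hubs)
  show "256 * (real \<kappa> + 1)\<^sup>2 * edge_const * \<eta> \<le> 1" by (rule \<eta>_small)
qed

lemma (in fan_shape) digraph_iso_S_plus_graph_if_no_fan:
  fixes G :: "'a pair_pre_digraph"
  assumes G: "pair_graph G" and large: "order_threshold \<le> card (pverts G)"
    and radius: "adj_spectral_radius (S_plus_graph (card (pverts G)) \<kappa>) \<le> adj_spectral_radius G"
    and no_fan: "\<And>c xss. \<not> pair_graph.fan G I half cyclic c xss"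
  shows "digraph_iso (with_proj G) (with_proj (S_plus_graph (card (pverts G)) \<kappa>))"
proof -
  interpret fan_free G I half cyclic
    using G no_fan by (simp add: fan_free_def fan_free_axioms_def fan_shape_axioms)
  have order: "4 * (\<kappa>\<^sup>2 + \<sigma>) \<le> card V" using small_products_le_order_threshold(4) large by simp
  have "2 * \<kappa> \<le> \<kappa> * \<kappa>" using \<kappa>_ge_2 by (rule mult_le_mono1)
  moreover have "4 * (\<kappa> * \<kappa>) \<le> card V" using order by (simp add: power2_eq_square)
  ultimately have n: "\<kappa> + 6 \<le> card V" using \<kappa>_ge_2 by linarith
  obtain \<mu> where \<mu>: "S_plus_root (card V) \<kappa> \<mu>" "\<kappa> * (real (card V) - \<kappa>) \<le> \<mu>\<^sup>2"
    using S_plus_root_exists[OF _ n] \<kappa>_ge_2 by auto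
  have \<mu>_le: "\<mu> \<le> adj_spectral_radius G"
    using S_plus_root_le_adj_spectral_radius[OF _ _ \<mu>(1)] \<kappa>_ge_2 n radius by simp
  have "0 \<le> \<mu>" using \<mu>(1) by (simp add: S_plus_root_def)
  have "V \<noteq> {}" using n by auto
  then obtain x z where "\<And>v. v \<in> V \<Longrightarrow> 0 \<le> x v" "\<And>v. v \<in> V \<Longrightarrow> x v \<le> 1" "z \<in> V" "x z = 1"
      "\<And>v. v \<in> V \<Longrightarrow> adj_spectral_radius G * x v \<le> sum x (nbhd v)"
    by (rule adj_spectral_radius_subinvariant) (rule that)
  moreover have "\<kappa> * (real (card V) - \<kappa>) \<le> (adj_spectral_radius G)\<^sup>2"
    using \<mu>(2) power_mono[OF \<mu>_le \<open>0 \<le> \<mu>\<close>, of 2] by linarith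
  ultimately interpret large_spectral_fan_free G I half cyclic x "adj_spectral_radius G" z
    using order large \<mu>_le \<open>0 \<le> \<mu>\<close> by unfold_locales auto
  interpret near_extremal G I half cyclic x "adj_spectral_radius G" z Hubs \<eta>
    by (rule near_extremal_Hubs)
  obtain r s where rs: "S_plus_data V Hubs r s" "G = S_plus_on V Hubs r s"
    using eq_S_plus_on[OF \<mu>(1) \<mu>_le] .
  have "digraph_iso (with_proj (S_plus_on V Hubs r s))
      (with_proj (S_plus_on {..<card V} {..<\<kappa>} \<kappa> (\<kappa> + 1)))"
    by (rule digraph_iso_S_plus_on[OF rs(1)]) (use n card_Hubs in \<open>auto intro: S_plus_data.intro\<close>)
  then show ?thesis using S_plus_graph_eq[of \<kappa> "card V"] n rs(2) by simp
qed

lemma fan_shape_of_lists: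
  assumes "length ks \<ge> 1 \<or> length ps \<ge> 2" "\<forall>k\<in>set ks. k \<ge> 2" "\<forall>p\<in>set ps. p \<ge> 2"
    and "Max (set ks \<union> set ps) \<ge> 3"
  shows "fan_shape {..<length (ks @ ps)} (nth (ks @ ps)) (\<lambda>i. i < length ks)"
proof
  have "set (ks @ ps) \<noteq> {}" using assms(1) by auto
  then have "Max (set (ks @ ps)) \<in> set (ks @ ps)" by (intro Max_in) auto
  then obtain i where "i < length (ks @ ps)" "(ks @ ps) ! i = Max (set (ks @ ps))"
    by (metis in_set_conv_nth)
  then show "\<exists>i\<in>{..<length (ks @ ps)}. 3 \<le> (ks @ ps) ! i"
    using assms(4) by (intro bexI[of _ i]) auto
  show "2 \<le> (ks @ ps) ! i" if "i \<in> {..<length (ks @ ps)}" for i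
    using that assms(2,3) nth_mem[of i "ks @ ps"] by auto
  show "i < length ks" if "{..<length (ks @ ps)} = {i}" for i
  proof -
    have "length (ks @ ps) = 1" using arg_cong[OF that, of card] by simp
    moreover have "i < length (ks @ ps)" using that by blast
    ultimately show ?thesis using assms(1) by auto
  qed
qed simp

lemma sum_nth_minus_one:
  fixes xs :: "nat list"
  assumes "\<forall>k\<in>set xs. 1 \<le> k"
  shows "(\<Sum>i<length xs. xs ! i - 1) = sum_list xs - length xs"
proof -
  have "(\<Sum>i<length xs. xs ! i - 1) = (\<Sum>i<length xs. xs ! i) - (\<Sum>i<length xs. 1)"
    by (rule sum_subtractf_nat) (use assms in auto)
  then show ?thesis by (simp add: sum_list_sum_nth atLeast0LessThan)
qed

theorem theorem1p6:
  fixes ks ps :: "nat list" and \<kappa> :: nat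
  assumes "length ks \<ge> 1 \<or> length ps \<ge> 2"
    and "\<forall>k\<in>set ks. k \<ge> 2"
    and "\<forall>p\<in>set ps. p \<ge> 2"
    and "Max (set ks \<union> set ps) \<ge> 3"
    and "\<kappa> = sum_list ks + sum_list ps - (length ks + length ps)"
  shows "\<exists>n0. \<forall>n\<ge>n0. \<forall>G :: 'a pair_pre_digraph.
           pair_graph G \<and> card (pverts G) = n \<and>
           adj_spectral_radius G \<ge> adj_spectral_radius (S_plus_graph n \<kappa>) \<and>
           \<not> digraph_iso (with_proj G) (with_proj (S_plus_graph n \<kappa>)) \<longrightarrow>
           contains_subgraph G (CP_graph ks ps)"
proof -
  interpret shape: fan_shape "{..<length (ks @ ps)}" "nth (ks @ ps)" "\<lambda>i. i < length ks"
    by (rule fan_shape_of_lists[OF assms(1-4)])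
  have "\<forall>k\<in>set (ks @ ps). 1 \<le> k" using assms(2,3) by force
  then have \<kappa>: "\<kappa> = shape.\<kappa>"
    unfolding shape.\<kappa>_def assms(5) by (subst sum_nth_minus_one) auto
  have "ks @ ps \<noteq> []" using assms(1) by auto
  show ?thesis
  proof (intro exI allI impI, elim conjE)
    fix n and G :: "'a pair_pre_digraph"
    assume "shape.order_threshold \<le> n" "pair_graph G" "card (pverts G) = n"
      "adj_spectral_radius (S_plus_graph n \<kappa>) \<le> adj_spectral_radius G"
      "\<not> digraph_iso (with_proj G) (with_proj (S_plus_graph n \<kappa>))"
    then obtain c xss where
      "pair_graph.fan G {..<length (ks @ ps)} (nth (ks @ ps)) (\<lambda>i. i < length ks) c xss"
      unfolding \<kappa> using shape.digraph_iso_S_plus_graph_if_no_fan[of G] by blast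
    then show "contains_subgraph G (CP_graph ks ps)"
      by (rule pair_graph.contains_CP_graph_if_fan[OF \<open>pair_graph G\<close> _ assms(2,3) \<open>ks @ ps \<noteq> []\<close>])
  qed
qed

end
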